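(* Let $H$ be a quasi-bialgebra, $A$ a left $H$-module algebra, $B$ a right $H$-module algebra and $\mathbb A$ an $H$-bicomodule algebra. Define on $A\otimes\mathbb A\otimes B$ (elements $a\otimes u\otimes b$ written $a\blacktriangleright\!\!<u>\!\!\blacktriangleleft b$) the multiplication $$(a\blacktriangleright\!\!<u>\!\!\blacktriangleleft b)(a'\blacktriangleright\!\!<u'>\!\!\blacktriangleleft b')=(\tilde x^1_\lambda\cdot a)(\tilde x^2_\lambda u_{[-1]}\theta^1\cdot a')\blacktriangleright\!\!<\tilde x^3_\lambda u_{[0]}\theta^2u'_{\langle0\rangle}\tilde x^1_\rho>\!\!\blacktriangleleft(b\cdot\theta^3u'_{\langle1\rangle}\tilde x^2_\rho)(b'\cdot\tilde x^3_\rho)$$ for all $a,a'\in A$, $u,u'\in\mathbb A$, $b,b'\in B$, and denote this structure by $A\blacktriangleright\!\!<\mathbb A>\!\!\blacktriangleleft B$. Then $A\blacktriangleright\!\!<\mathbb A>\!\!\blacktriangleleft B$ is an associative algebra with unit $1_A\blacktriangleright\!\!<1_{\mathbb A}>\!\!\blacktriangleleft1_B$.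
   Context: All algebras and spaces are over a field $k$, $\otimes=\otimes_k$; summation is understood. A quasi-bialgebra $(H,\Delta,\varepsilon,\Phi)$: a unital associative algebra $H$, algebra maps $\Delta:H\to H\otimes H$ ($\Delta(h)=h_1\otimes h_2$), $\varepsilon:H\to k$, and an invertible $\Phi=X^1\otimes X^2\otimes X^3\in H^{\otimes3}$, $\Phi^{-1}=x^1\otimes x^2\otimes x^3$, with $(id\otimes\Delta)(\Delta(h))=\Phi(\Delta\otimes id)(\Delta(h))\Phi^{-1}$, $(id\otimes\varepsilon)\Delta=id=(\varepsilon\otimes id)\Delta$, $(1\otimes\Phi)(id\otimes\Delta\otimes id)(\Phi)(\Phi\otimes1)=(id\otimes id\otimes\Delta)(\Phi)(\Delta\otimes id\otimes id)(\Phi)$, $(id\otimes\varepsilon\otimes id)(\Phi)=1\otimes1$. A left $H$-module algebra: a left $H$-module $A$ with bilinear multiplication and two-sided unit $1_A$ with $(aa')a''=(X^1\cdot a)[(X^2\cdot a')(X^3\cdot a'')]$, $h\cdot(aa')=(h_1\cdot a)(h_2\cdot a')$, $h\cdot1_A=\varepsilon(h)1_A$. A right $H$-module algebra: a right $H$-module $B$ with bilinear multiplication and two-sided unit $1_B$ with $(bb')b''=(b\cdot x^1)[(b'\cdot x^2)(b''\cdot x^3)]$, $(bb')\cdot h=(b\cdot h_1)(b'\cdot h_2)$, $1_B\cdot h=\varepsilon(h)1_B$. A right $H$-comodule algebra: a unital associative algebra $\mathfrak A$, an algebra map $\rho:\mathfrak A\to\mathfrak A\otimes H$, $\rho(a)=a_{\langle0\rangle}\otimes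 a_{\langle1\rangle}$, and an invertible $\Phi_\rho\in\mathfrak A\otimes H\otimes H$, $\Phi_\rho^{-1}=\tilde x^1_\rho\otimes\tilde x^2_\rho\otimes\tilde x^3_\rho$, with $\Phi_\rho(\rho\otimes id)(\rho(a))=(id\otimes\Delta)(\rho(a))\Phi_\rho$, $(1\otimes\Phi)(id\otimes\Delta\otimes id)(\Phi_\rho)(\Phi_\rho\otimes1)=(id\otimes id\otimes\Delta)(\Phi_\rho)(\rho\otimes id\otimes id)(\Phi_\rho)$, $(id\otimes\varepsilon)\rho=id$, $(id\otimes\varepsilon\otimes id)(\Phi_\rho)=(id\otimes id\otimes\varepsilon)(\Phi_\rho)=1\otimes1$. A left $H$-comodule algebra: a unital associative algebra $\mathfrak B$, an algebra map $\lambda:\mathfrak B\to H\otimes\mathfrak B$, $\lambda(b)=b_{[-1]}\otimes b_{[0]}$, and an invertible $\Phi_\lambda\in H\otimes H\otimes\mathfrak B$, $\Phi_\lambda^{-1}=\tilde x^1_\lambda\otimes\tilde x^2_\lambda\otimes\tilde x^3_\lambda$, with $(id\otimes\lambda)(\lambda(b))\Phi_\lambda=\Phi_\lambda(\Delta\otimes id)(\lambda(b))$, $(1\otimes\Phi_\lambda)(id\otimes\Delta\otimes id)(\Phi_\lambda)(\Phi\otimes1)=(id\otimes id\otimes\lambda)(\Phi_\lambda)(\Delta\otimes id\otimes id)(\Phi_\lambda)$, $(\varepsilon\otimes id)\lambda=id$, $(id\otimes\varepsilon\otimes id)(\Phi_\lambda)=(\varepsilon\otimes id\otimes id)(\Phi_\lambda)=1\otimes1$.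 An $H$-bicomodule algebra $(\mathbb A,\lambda,\rho,\Phi_\lambda,\Phi_\rho,\Phi_{\lambda,\rho})$: $(\mathbb A,\lambda,\Phi_\lambda)$ is a left and $(\mathbb A,\rho,\Phi_\rho)$ a right $H$-comodule algebra, and $\Phi_{\lambda,\rho}\in H\otimes\mathbb A\otimes H$ is invertible, $\Phi_{\lambda,\rho}^{-1}=\theta^1\otimes\theta^2\otimes\theta^3$, with $\Phi_{\lambda,\rho}(\lambda\otimes id)(\rho(u))=(id\otimes\rho)(\lambda(u))\Phi_{\lambda,\rho}$, $(1\otimes\Phi_{\lambda,\rho})(id\otimes\lambda\otimes id)(\Phi_{\lambda,\rho})(\Phi_\lambda\otimes1)=(id\otimes id\otimes\rho)(\Phi_\lambda)(\Delta\otimes id\otimes id)(\Phi_{\lambda,\rho})$, $(1\otimes\Phi_\rho)(id\otimes\rho\otimes id)(\Phi_{\lambda,\rho})(\Phi_{\lambda,\rho}\otimes1)=(id\otimes id\otimes\Delta)(\Phi_{\lambda,\rho})(\lambda\otimes id\otimes id)(\Phi_\rho)$. *)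

theory Defs
  imports Complex_Main "HOL-Library.Poly_Mapping" "HOL-Algebra.Module"
begin

section \<open>Free vector spaces\<close>

text \<open>The free vector space on a type \<open>'x\<close> is \<open>'x \<Rightarrow>\<^sub>0 'k\<close>.\<close>

definition fscale :: "'k::field \<Rightarrow> ('x \<Rightarrow>\<^sub>0 'k) \<Rightarrow> ('x \<Rightarrow>\<^sub>0 'k)" where
  "fscale c v = Poly_Mapping.map ((*) c) v"

definition gen :: "'x \<Rightarrow> ('x \<Rightarrow>\<^sub>0 'k::field)" where
  "gen x = Poly_Mapping.single x 1"

text \<open>Linear extension of \<open>f\<close> from the generators.\<close>

definition fext :: "('x \<Rightarrow> ('y \<Rightarrow>\<^sub>0 'k)) \<Rightarrow> ('x \<Rightarrow>\<^sub>0 'k) \<Rightarrow> ('y \<Rightarrow>\<^sub>0 'k::field)" where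
  "fext f v = (\<Sum>x\<in>Poly_Mapping.keys v. fscale (Poly_Mapping.lookup v x) (f x))"

lemma lookup_fscale [simp]: "Poly_Mapping.lookup (fscale c v) x = c * Poly_Mapping.lookup v x"
  by (simp add: fscale_def Poly_Mapping.map.rep_eq when_def)

lemma vector_space_fscale: "vector_space (fscale :: 'k::field \<Rightarrow> ('x \<Rightarrow>\<^sub>0 'k) \<Rightarrow> _)"
  by unfold_locales (auto intro!: poly_mapping_eqI simp: lookup_add algebra_simps)

interpretation free: vector_space "fscale :: 'k::field \<Rightarrow> ('x \<Rightarrow>\<^sub>0 'k) \<Rightarrow> _"
  by (rule vector_space_fscale)


section \<open>Tensor products\<close>

text \<open>A vector space with underlying type \<open>'a\<close> and scalar multiplication \<open>s\<close> is the quotient of the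
  free vector space on \<open>'a\<close> by the relations \<open>vrel s\<close>. If \<open>R\<close> and \<open>S\<close> are relations on
  free vector spaces on \<open>'x\<close> and \<open>'y\<close>, then \<open>R \<boxtimes> S\<close> imposes them in each argument separately, on the
  free vector space on \<open>'x \<times> 'y\<close>. In particular \<open>vrel s1 \<boxtimes> \<dots> \<boxtimes> vrel sn\<close> consists of the
  usual additivity and homogeneity relations in each of the \<open>n\<close> arguments, and the quotient by its span
  is the \<open>n\<close>-fold tensor product. Elements of the tensor product are cosets.\<close>

definition vrel :: "('k \<Rightarrow> 'a \<Rightarrow> 'a) \<Rightarrow> ('a::ab_group_add \<Rightarrow>\<^sub>0 'k::field) set" where
  "vrel s = {gen (a + a') - gen a - gen a' | a a'. True} \<union> {gen (s c a) - fscale c (gen a) | c a. True}"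

definition rel_tensor :: "('x \<Rightarrow>\<^sub>0 'k) set \<Rightarrow> ('y \<Rightarrow>\<^sub>0 'k) set \<Rightarrow> ('x \<times> 'y \<Rightarrow>\<^sub>0 'k::field) set"
    (infixr \<open>\<boxtimes>\<close> 70) where
  "R \<boxtimes> S = {fext (\<lambda>x. gen (x, y)) r | r y. r \<in> R} \<union> {fext (\<lambda>y. gen (x, y)) r | x r. r \<in> S}"

definition tcoset :: "('x \<Rightarrow>\<^sub>0 'k) set \<Rightarrow> ('x \<Rightarrow>\<^sub>0 'k) \<Rightarrow> ('x \<Rightarrow>\<^sub>0 'k::field) set" where
  "tcoset R v = {w. w - v \<in> free.span R}"

definition tensors :: "('x \<Rightarrow>\<^sub>0 'k) set \<Rightarrow> ('x \<Rightarrow>\<^sub>0 'k::field) set set" where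
  "tensors R = range (tcoset R)"

lemma tcoset_eq_iff: "tcoset R v = tcoset R w \<longleftrightarrow> v - w \<in> free.span R"
proof
  assume "tcoset R v = tcoset R w"
  moreover have "v \<in> tcoset R v" by (simp add: tcoset_def free.span_zero)
  ultimately show "v - w \<in> free.span R" by (simp add: tcoset_def)
next
  assume vw: "v - w \<in> free.span R"
  have "u - v \<in> free.span R \<longleftrightarrow> u - w \<in> free.span R" for u
    using free.span_add[OF _ vw, of "u - v"] free.span_diff[OF _ vw, of "u - w"] by auto
  then show "tcoset R v = tcoset R w" by (simp add: tcoset_def)
qed

text \<open>A pure tensor. For tuples \<open>x\<close> this is \<open>a \<otimes> b\<close>, \<open>a \<otimes> b \<otimes> c\<close>, etc.\<close>

definition pure :: "('x \<Rightarrow>\<^sub>0 'k) set \<Rightarrow> 'x \<Rightarrow> ('x \<Rightarrow>\<^sub>0 'k::field) set" where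
  "pure R x = tcoset R (gen x)"

text \<open>Sweedler notation: a representative of the tensor, i.e. a finite sum of pure tensors, is chosen,
  and \<open>f\<close> is applied to the components of each summand. Thus
  \<open>\<Delta> h \<bind> (\<lambda>(h1, h2). f (h1, h2))\<close> stands for \<open>f (h\<^sub>1, h\<^sub>2)\<close> with summation understood. All uses
  below are multilinear in the components, so modulo the relations the choice is immaterial.\<close>

definition rep :: "('x \<Rightarrow>\<^sub>0 'k) set \<Rightarrow> ('x \<Rightarrow>\<^sub>0 'k::field)" where
  "rep T = (SOME v. v \<in> T)"

definition sweedler :: "('x \<Rightarrow>\<^sub>0 'k) set \<Rightarrow> ('x \<Rightarrow> ('y \<Rightarrow>\<^sub>0 'k)) \<Rightarrow> ('y \<Rightarrow>\<^sub>0 'k::field)"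
    (infixr \<open>\<bind>\<close> 55) where
  "T \<bind> f = fext f (rep T)"

text \<open>The same for maps with values in a vector space with scalar multiplication \<open>s\<close>.\<close>

definition sweedler_val :: "('k \<Rightarrow> 'v \<Rightarrow> 'v) \<Rightarrow> ('x \<Rightarrow>\<^sub>0 'k::field) set \<Rightarrow> ('x \<Rightarrow> 'v) \<Rightarrow>
    'v::ab_group_add" where
  "sweedler_val s T f = (\<Sum>x\<in>Poly_Mapping.keys (rep T). s (Poly_Mapping.lookup (rep T) x) (f x))"

definition tmap :: "('y \<Rightarrow>\<^sub>0 'k) set \<Rightarrow> ('x \<Rightarrow> ('y \<Rightarrow>\<^sub>0 'k)) \<Rightarrow> ('x \<Rightarrow>\<^sub>0 'k) set \<Rightarrow> ('y \<Rightarrow>\<^sub>0 'k::field) set" where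
  "tmap R f T = tcoset R (T \<bind> f)"

definition tadd :: "('x \<Rightarrow>\<^sub>0 'k) set \<Rightarrow> ('x \<Rightarrow>\<^sub>0 'k) set \<Rightarrow> ('x \<Rightarrow>\<^sub>0 'k) set \<Rightarrow> ('x \<Rightarrow>\<^sub>0 'k::field) set" where
  "tadd R S T = tcoset R (rep S + rep T)"

definition tscale :: "('x \<Rightarrow>\<^sub>0 'k) set \<Rightarrow> 'k \<Rightarrow> ('x \<Rightarrow>\<^sub>0 'k) set \<Rightarrow> ('x \<Rightarrow>\<^sub>0 'k::field) set" where
  "tscale R c T = tcoset R (fscale c (rep T))"

text \<open>Componentwise multiplication of tuples, giving the algebra structure of a tensor product of
  algebras.\<close>

instantiation prod :: (times, times) times
begin
definition times_prod_def: "p * q = (fst p * fst q, snd p * snd q)"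
instance ..
end

instantiation prod :: (one, one) one
begin
definition one_prod_def: "1 = (1, 1)"
instance ..
end

definition tmul :: "('x \<Rightarrow>\<^sub>0 'k) set \<Rightarrow> ('x \<Rightarrow>\<^sub>0 'k) set \<Rightarrow> ('x \<Rightarrow>\<^sub>0 'k) set \<Rightarrow> ('x::times \<Rightarrow>\<^sub>0 'k::field) set" where
  "tmul R S T = tcoset R (S \<bind> (\<lambda>x. T \<bind> (\<lambda>y. gen (x * y))))"

definition tinverse :: "('x \<Rightarrow>\<^sub>0 'k) set \<Rightarrow> ('x \<Rightarrow>\<^sub>0 'k) set \<Rightarrow> ('x::{times,one} \<Rightarrow>\<^sub>0 'k::field) set \<Rightarrow> bool" where
  "tinverse R T T' \<longleftrightarrow> T \<in> tensors R \<and> T' \<in> tensors R \<and> tmul R T T' = pure R 1 \<and> tmul R T' T = pure R 1"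


section \<open>Algebras\<close>

definition bilinear_map :: "('k::field \<Rightarrow> 'a \<Rightarrow> 'a) \<Rightarrow> ('k \<Rightarrow> 'b \<Rightarrow> 'b) \<Rightarrow> ('k \<Rightarrow> 'c \<Rightarrow> 'c) \<Rightarrow>
    ('a::ab_group_add \<Rightarrow> 'b::ab_group_add \<Rightarrow> 'c::ab_group_add) \<Rightarrow> bool" where
  "bilinear_map s1 s2 s3 f \<longleftrightarrow>
    (\<forall>x. Vector_Spaces.linear s2 s3 (f x)) \<and>
    (\<forall>y. Vector_Spaces.linear s1 s3 (\<lambda>x. f x y))"

text \<open>The sort \<open>{ring, monoid_mult}\<close> is that of unital associative rings, where \<open>0 = 1\<close> is allowed
  (in contrast to \<open>ring_1\<close>).\<close>

locale unital_algebra = vector_space scale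
  for scale :: "'k::field \<Rightarrow> 'a::{ring,monoid_mult} \<Rightarrow> 'a" +
  assumes scale_mult_left: "scale c (x * y) = scale c x * y"
    and scale_mult_right: "scale c (x * y) = x * scale c y"

text \<open>An algebra map from an algebra with scalar multiplication \<open>s\<close> to the tensor product
  algebra given by \<open>R\<close>.\<close>

definition algebra_map_to_tensors ::
  "('k \<Rightarrow> 'a \<Rightarrow> 'a) \<Rightarrow> ('x \<Rightarrow>\<^sub>0 'k) set \<Rightarrow> ('a::{ring,monoid_mult} \<Rightarrow> ('x::{times,one} \<Rightarrow>\<^sub>0 'k::field) set) \<Rightarrow> bool" where
  "algebra_map_to_tensors s R f \<longleftrightarrow>
    (\<forall>x. f x \<in> tensors R) \<and>
    (\<forall>x y. f (x + y) = tadd R (f x) (f y)) \<and>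
    (\<forall>c x. f (s c x) = tscale R c (f x)) \<and>
    (\<forall>x y. f (x * y) = tmul R (f x) (f y)) \<and>
    f 1 = pure R 1"


section \<open>Quasi-bialgebras\<close>

text \<open>In all structures below, \<open>\<Phi>'\<close> denotes the inverse of the invertible tensor \<open>\<Phi>\<close>, and similarly
  for \<open>\<Phi>\<rho>\<close> (right coaction \<open>\<rho>\<close>), \<open>\<Phi>l\<close> (left coaction \<open>lam\<close>) and the mixed \<open>\<Phi>l\<rho>\<close>. Tensors over
  \<open>k\<close> in one leg, such as those occurring in \<open>(id \<otimes> \<epsilon>) \<Delta>\<close>, are identified with scalar multiples.\<close>

locale quasi_bialgebra = H: unital_algebra sH
  for sH :: "'k::field \<Rightarrow> 'h::{ring,monoid_mult} \<Rightarrow> 'h" +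
  fixes \<Delta> :: "'h \<Rightarrow> ('h \<times> 'h \<Rightarrow>\<^sub>0 'k) set"
    and \<epsilon> :: "'h \<Rightarrow> 'k"
    and \<Phi> \<Phi>' :: "('h \<times> 'h \<times> 'h \<Rightarrow>\<^sub>0 'k) set"
  assumes comult: "algebra_map_to_tensors sH (vrel sH \<boxtimes> vrel sH) \<Delta>"
    and counit_linear: "Vector_Spaces.linear sH (*) \<epsilon>"
    and counit_mult: "\<epsilon> (h * h') = \<epsilon> h * \<epsilon> h'"
    and counit_one: "\<epsilon> 1 = 1"
    and reassociator_inverse: "tinverse (vrel sH \<boxtimes> vrel sH \<boxtimes> vrel sH) \<Phi> \<Phi>'"
    and quasi_coassociative:
      "tmap (vrel sH \<boxtimes> vrel sH \<boxtimes> vrel sH) (\<lambda>(x, y). \<Delta> y \<bind> (\<lambda>(y1, y2). gen (x, y1, y2))) (\<Delta> h) =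
       tmul (vrel sH \<boxtimes> vrel sH \<boxtimes> vrel sH)
        (tmul (vrel sH \<boxtimes> vrel sH \<boxtimes> vrel sH) \<Phi>
          (tmap (vrel sH \<boxtimes> vrel sH \<boxtimes> vrel sH) (\<lambda>(x, y). \<Delta> x \<bind> (\<lambda>(x1, x2). gen (x1, x2, y))) (\<Delta> h)))
        \<Phi>'"
    and counit_right: "sweedler_val sH (\<Delta> h) (\<lambda>(x, y). sH (\<epsilon> y) x) = h"
    and counit_left: "sweedler_val sH (\<Delta> h) (\<lambda>(x, y). sH (\<epsilon> x) y) = h"
    and pentagon:
      "tmul (vrel sH \<boxtimes> vrel sH \<boxtimes> vrel sH \<boxtimes> vrel sH)
        (tmul (vrel sH \<boxtimes> vrel sH \<boxtimes> vrel sH \<boxtimes> vrel sH)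
          (tmap (vrel sH \<boxtimes> vrel sH \<boxtimes> vrel sH \<boxtimes> vrel sH) (\<lambda>(x, y, z). gen (1, x, y, z)) \<Phi>)
          (tmap (vrel sH \<boxtimes> vrel sH \<boxtimes> vrel sH \<boxtimes> vrel sH)
            (\<lambda>(x, y, z). \<Delta> y \<bind> (\<lambda>(y1, y2). gen (x, y1, y2, z))) \<Phi>))
        (tmap (vrel sH \<boxtimes> vrel sH \<boxtimes> vrel sH \<boxtimes> vrel sH) (\<lambda>(x, y, z). gen (x, y, z, 1)) \<Phi>) =
       tmul (vrel sH \<boxtimes> vrel sH \<boxtimes> vrel sH \<boxtimes> vrel sH)
        (tmap (vrel sH \<boxtimes> vrel sH \<boxtimes> vrel sH \<boxtimes> vrel sH)
          (\<lambda>(x, y, z). \<Delta> z \<bind> (\<lambda>(z1, z2). gen (x, y, z1, z2))) \<Phi>)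
        (tmap (vrel sH \<boxtimes> vrel sH \<boxtimes> vrel sH \<boxtimes> vrel sH)
          (\<lambda>(x, y, z). \<Delta> x \<bind> (\<lambda>(x1, x2). gen (x1, x2, y, z))) \<Phi>)"
    and reassociator_counit:
      "tmap (vrel sH \<boxtimes> vrel sH) (\<lambda>(x, y, z). fscale (\<epsilon> y) (gen (x, z))) \<Phi> = pure (vrel sH \<boxtimes> vrel sH) 1"


section \<open>Module algebras\<close>

text \<open>Module algebras need not be associative, so their multiplication and unit are explicit.\<close>

locale left_module_algebra = quasi_bialgebra sH \<Delta> \<epsilon> \<Phi> \<Phi>' + A: vector_space sA
  for sH :: "'k::field \<Rightarrow> 'h::{ring,monoid_mult} \<Rightarrow> 'h"
    and \<Delta> \<epsilon> \<Phi> \<Phi>'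
    and sA :: "'k \<Rightarrow> 'a::ab_group_add \<Rightarrow> 'a" +
  fixes mA :: "'a \<Rightarrow> 'a \<Rightarrow> 'a"
    and eA :: 'a
    and act :: "'h \<Rightarrow> 'a \<Rightarrow> 'a"
  assumes act_bilinear: "bilinear_map sH sA sA act"
    and act_one: "act 1 a = a"
    and act_mult: "act (h * h') a = act h (act h' a)"
    and mult_bilinear: "bilinear_map sA sA sA mA"
    and unit_left: "mA eA a = a"
    and unit_right: "mA a eA = a"
    and mult_quasi_assoc:
      "mA (mA a a') a'' = sweedler_val sA \<Phi> (\<lambda>(x, y, z). mA (act x a) (mA (act y a') (act z a'')))"
    and act_mA: "act h (mA a a') = sweedler_val sA (\<Delta> h) (\<lambda>(h1, h2). mA (act h1 a) (act h2 a'))"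
    and act_unit: "act h eA = sA (\<epsilon> h) eA"

locale right_module_algebra = quasi_bialgebra sH \<Delta> \<epsilon> \<Phi> \<Phi>' + B: vector_space sB
  for sH :: "'k::field \<Rightarrow> 'h::{ring,monoid_mult} \<Rightarrow> 'h"
    and \<Delta> \<epsilon> \<Phi> \<Phi>'
    and sB :: "'k \<Rightarrow> 'b::ab_group_add \<Rightarrow> 'b" +
  fixes mB :: "'b \<Rightarrow> 'b \<Rightarrow> 'b"
    and eB :: 'b
    and act :: "'b \<Rightarrow> 'h \<Rightarrow> 'b"
  assumes act_bilinear: "bilinear_map sB sH sB act"
    and act_one: "act b 1 = b"
    and act_mult: "act b (h * h') = act (act b h) h'"
    and mult_bilinear: "bilinear_map sB sB sB mB"
    and unit_left: "mB eB b = b"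
    and unit_right: "mB b eB = b"
    and mult_quasi_assoc:
      "mB (mB b b') b'' = sweedler_val sB \<Phi>' (\<lambda>(x, y, z). mB (act b x) (mB (act b' y) (act b'' z)))"
    and act_mB: "act (mB b b') h = sweedler_val sB (\<Delta> h) (\<lambda>(h1, h2). mB (act b h1) (act b' h2))"
    and act_unit: "act eB h = sB (\<epsilon> h) eB"


section \<open>Comodule algebras\<close>

locale right_comodule_algebra = quasi_bialgebra sH \<Delta> \<epsilon> \<Phi> \<Phi>' + U: unital_algebra sU
  for sH :: "'k::field \<Rightarrow> 'h::{ring,monoid_mult} \<Rightarrow> 'h"
    and \<Delta> \<epsilon> \<Phi> \<Phi>'
    and sU :: "'k \<Rightarrow> 'u::{ring,monoid_mult} \<Rightarrow> 'u" +
  fixes \<rho> :: "'u \<Rightarrow> ('u \<times> 'h \<Rightarrow>\<^sub>0 'k) set"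
    and \<Phi>\<rho> \<Phi>\<rho>' :: "('u \<times> 'h \<times> 'h \<Rightarrow>\<^sub>0 'k) set"
  assumes right_coaction: "algebra_map_to_tensors sU (vrel sU \<boxtimes> vrel sH) \<rho>"
    and right_inverse: "tinverse (vrel sU \<boxtimes> vrel sH \<boxtimes> vrel sH) \<Phi>\<rho> \<Phi>\<rho>'"
    and right_quasi_coassociative:
      "tmul (vrel sU \<boxtimes> vrel sH \<boxtimes> vrel sH) \<Phi>\<rho>
        (tmap (vrel sU \<boxtimes> vrel sH \<boxtimes> vrel sH) (\<lambda>(u, h). \<rho> u \<bind> (\<lambda>(u0, u1). gen (u0, u1, h))) (\<rho> a)) =
       tmul (vrel sU \<boxtimes> vrel sH \<boxtimes> vrel sH)
        (tmap (vrel sU \<boxtimes> vrel sH \<boxtimes> vrel sH) (\<lambda>(u, h). \<Delta> h \<bind> (\<lambda>(h1, h2). gen (u, h1, h2))) (\<rho> a))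
        \<Phi>\<rho>"
    and right_pentagon:
      "tmul (vrel sU \<boxtimes> vrel sH \<boxtimes> vrel sH \<boxtimes> vrel sH)
        (tmul (vrel sU \<boxtimes> vrel sH \<boxtimes> vrel sH \<boxtimes> vrel sH)
          (tmap (vrel sU \<boxtimes> vrel sH \<boxtimes> vrel sH \<boxtimes> vrel sH) (\<lambda>(x, y, z). gen (1, x, y, z)) \<Phi>)
          (tmap (vrel sU \<boxtimes> vrel sH \<boxtimes> vrel sH \<boxtimes> vrel sH)
            (\<lambda>(u, y, z). \<Delta> y \<bind> (\<lambda>(y1, y2). gen (u, y1, y2, z))) \<Phi>\<rho>))
        (tmap (vrel sU \<boxtimes> vrel sH \<boxtimes> vrel sH \<boxtimes> vrel sH) (\<lambda>(u, y, z). gen (u, y, z, 1)) \<Phi>\<rho>) =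
       tmul (vrel sU \<boxtimes> vrel sH \<boxtimes> vrel sH \<boxtimes> vrel sH)
        (tmap (vrel sU \<boxtimes> vrel sH \<boxtimes> vrel sH \<boxtimes> vrel sH)
          (\<lambda>(u, y, z). \<Delta> z \<bind> (\<lambda>(z1, z2). gen (u, y, z1, z2))) \<Phi>\<rho>)
        (tmap (vrel sU \<boxtimes> vrel sH \<boxtimes> vrel sH \<boxtimes> vrel sH)
          (\<lambda>(u, y, z). \<rho> u \<bind> (\<lambda>(u0, u1). gen (u0, u1, y, z))) \<Phi>\<rho>)"
    and right_coaction_counit: "sweedler_val sU (\<rho> a) (\<lambda>(u, h). sU (\<epsilon> h) u) = a"
    and right_counit_2:
      "tmap (vrel sU \<boxtimes> vrel sH) (\<lambda>(u, y, z). fscale (\<epsilon> y) (gen (u, z))) \<Phi>\<rho> = pure (vrel sU \<boxtimes> vrel sH) 1"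
    and right_counit_3:
      "tmap (vrel sU \<boxtimes> vrel sH) (\<lambda>(u, y, z). fscale (\<epsilon> z) (gen (u, y))) \<Phi>\<rho> = pure (vrel sU \<boxtimes> vrel sH) 1"

locale left_comodule_algebra = quasi_bialgebra sH \<Delta> \<epsilon> \<Phi> \<Phi>' + U: unital_algebra sU
  for sH :: "'k::field \<Rightarrow> 'h::{ring,monoid_mult} \<Rightarrow> 'h"
    and \<Delta> \<epsilon> \<Phi> \<Phi>'
    and sU :: "'k \<Rightarrow> 'u::{ring,monoid_mult} \<Rightarrow> 'u" +
  fixes lam :: "'u \<Rightarrow> ('h \<times> 'u \<Rightarrow>\<^sub>0 'k) set"
    and \<Phi>l \<Phi>l' :: "('h \<times> 'h \<times> 'u \<Rightarrow>\<^sub>0 'k) set"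
  assumes left_coaction: "algebra_map_to_tensors sU (vrel sH \<boxtimes> vrel sU) lam"
    and left_inverse: "tinverse (vrel sH \<boxtimes> vrel sH \<boxtimes> vrel sU) \<Phi>l \<Phi>l'"
    and left_quasi_coassociative:
      "tmul (vrel sH \<boxtimes> vrel sH \<boxtimes> vrel sU)
        (tmap (vrel sH \<boxtimes> vrel sH \<boxtimes> vrel sU) (\<lambda>(h, u). lam u \<bind> (\<lambda>(um1, u0). gen (h, um1, u0))) (lam b))
        \<Phi>l =
       tmul (vrel sH \<boxtimes> vrel sH \<boxtimes> vrel sU) \<Phi>l
        (tmap (vrel sH \<boxtimes> vrel sH \<boxtimes> vrel sU) (\<lambda>(h, u). \<Delta> h \<bind> (\<lambda>(h1, h2). gen (h1, h2, u))) (lam b))"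
    and left_pentagon:
      "tmul (vrel sH \<boxtimes> vrel sH \<boxtimes> vrel sH \<boxtimes> vrel sU)
        (tmul (vrel sH \<boxtimes> vrel sH \<boxtimes> vrel sH \<boxtimes> vrel sU)
          (tmap (vrel sH \<boxtimes> vrel sH \<boxtimes> vrel sH \<boxtimes> vrel sU) (\<lambda>(x, y, u). gen (1, x, y, u)) \<Phi>l)
          (tmap (vrel sH \<boxtimes> vrel sH \<boxtimes> vrel sH \<boxtimes> vrel sU)
            (\<lambda>(x, y, u). \<Delta> y \<bind> (\<lambda>(y1, y2). gen (x, y1, y2, u))) \<Phi>l))
        (tmap (vrel sH \<boxtimes> vrel sH \<boxtimes> vrel sH \<boxtimes> vrel sU) (\<lambda>(x, y, z). gen (x, y, z, 1)) \<Phi>) =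
       tmul (vrel sH \<boxtimes> vrel sH \<boxtimes> vrel sH \<boxtimes> vrel sU)
        (tmap (vrel sH \<boxtimes> vrel sH \<boxtimes> vrel sH \<boxtimes> vrel sU)
          (\<lambda>(x, y, u). lam u \<bind> (\<lambda>(um1, u0). gen (x, y, um1, u0))) \<Phi>l)
        (tmap (vrel sH \<boxtimes> vrel sH \<boxtimes> vrel sH \<boxtimes> vrel sU)
          (\<lambda>(x, y, u). \<Delta> x \<bind> (\<lambda>(x1, x2). gen (x1, x2, y, u))) \<Phi>l)"
    and left_coaction_counit: "sweedler_val sU (lam b) (\<lambda>(h, u). sU (\<epsilon> h) u) = b"
    and left_counit_2:
      "tmap (vrel sH \<boxtimes> vrel sU) (\<lambda>(x, y, u). fscale (\<epsilon> y) (gen (x, u))) \<Phi>l = pure (vrel sH \<boxtimes> vrel sU) 1"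
    and left_counit_1:
      "tmap (vrel sH \<boxtimes> vrel sU) (\<lambda>(x, y, u). fscale (\<epsilon> x) (gen (y, u))) \<Phi>l = pure (vrel sH \<boxtimes> vrel sU) 1"

locale bicomodule_algebra =
  left_comodule_algebra sH \<Delta> \<epsilon> \<Phi> \<Phi>' sU lam \<Phi>l \<Phi>l' +
  right_comodule_algebra sH \<Delta> \<epsilon> \<Phi> \<Phi>' sU \<rho> \<Phi>\<rho> \<Phi>\<rho>'
  for sH :: "'k::field \<Rightarrow> 'h::{ring,monoid_mult} \<Rightarrow> 'h"
    and \<Delta> \<epsilon> \<Phi> \<Phi>'
    and sU :: "'k \<Rightarrow> 'u::{ring,monoid_mult} \<Rightarrow> 'u"
    and lam \<Phi>l \<Phi>l' \<rho> \<Phi>\<rho> \<Phi>\<rho>' +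
  fixes \<Phi>l\<rho> \<Phi>l\<rho>' :: "('h \<times> 'u \<times> 'h \<Rightarrow>\<^sub>0 'k) set"
  assumes mixed_inverse: "tinverse (vrel sH \<boxtimes> vrel sU \<boxtimes> vrel sH) \<Phi>l\<rho> \<Phi>l\<rho>'"
    and mixed_quasi_coassociative:
      "tmul (vrel sH \<boxtimes> vrel sU \<boxtimes> vrel sH) \<Phi>l\<rho>
        (tmap (vrel sH \<boxtimes> vrel sU \<boxtimes> vrel sH) (\<lambda>(v, h). lam v \<bind> (\<lambda>(vm1, v0). gen (vm1, v0, h))) (\<rho> u)) =
       tmul (vrel sH \<boxtimes> vrel sU \<boxtimes> vrel sH)
        (tmap (vrel sH \<boxtimes> vrel sU \<boxtimes> vrel sH) (\<lambda>(h, v). \<rho> v \<bind> (\<lambda>(v0, v1). gen (h, v0, v1))) (lam u))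
        \<Phi>l\<rho>"
    and mixed_pentagon_left:
      "tmul (vrel sH \<boxtimes> vrel sH \<boxtimes> vrel sU \<boxtimes> vrel sH)
        (tmul (vrel sH \<boxtimes> vrel sH \<boxtimes> vrel sU \<boxtimes> vrel sH)
          (tmap (vrel sH \<boxtimes> vrel sH \<boxtimes> vrel sU \<boxtimes> vrel sH) (\<lambda>(x, v, z). gen (1, x, v, z)) \<Phi>l\<rho>)
          (tmap (vrel sH \<boxtimes> vrel sH \<boxtimes> vrel sU \<boxtimes> vrel sH)
            (\<lambda>(x, v, z). lam v \<bind> (\<lambda>(vm1, v0). gen (x, vm1, v0, z))) \<Phi>l\<rho>))
        (tmap (vrel sH \<boxtimes> vrel sH \<boxtimes> vrel sU \<boxtimes> vrel sH) (\<lambda>(x, y, v). gen (x, y, v, 1)) \<Phi>l) =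
       tmul (vrel sH \<boxtimes> vrel sH \<boxtimes> vrel sU \<boxtimes> vrel sH)
        (tmap (vrel sH \<boxtimes> vrel sH \<boxtimes> vrel sU \<boxtimes> vrel sH)
          (\<lambda>(x, y, v). \<rho> v \<bind> (\<lambda>(v0, v1). gen (x, y, v0, v1))) \<Phi>l)
        (tmap (vrel sH \<boxtimes> vrel sH \<boxtimes> vrel sU \<boxtimes> vrel sH)
          (\<lambda>(x, v, z). \<Delta> x \<bind> (\<lambda>(x1, x2). gen (x1, x2, v, z))) \<Phi>l\<rho>)"
    and mixed_pentagon_right:
      "tmul (vrel sH \<boxtimes> vrel sU \<boxtimes> vrel sH \<boxtimes> vrel sH)
        (tmul (vrel sH \<boxtimes> vrel sU \<boxtimes> vrel sH \<boxtimes> vrel sH)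
          (tmap (vrel sH \<boxtimes> vrel sU \<boxtimes> vrel sH \<boxtimes> vrel sH) (\<lambda>(v, y, z). gen (1, v, y, z)) \<Phi>\<rho>)
          (tmap (vrel sH \<boxtimes> vrel sU \<boxtimes> vrel sH \<boxtimes> vrel sH)
            (\<lambda>(x, v, z). \<rho> v \<bind> (\<lambda>(v0, v1). gen (x, v0, v1, z))) \<Phi>l\<rho>))
        (tmap (vrel sH \<boxtimes> vrel sU \<boxtimes> vrel sH \<boxtimes> vrel sH) (\<lambda>(x, v, z). gen (x, v, z, 1)) \<Phi>l\<rho>) =
       tmul (vrel sH \<boxtimes> vrel sU \<boxtimes> vrel sH \<boxtimes> vrel sH)
        (tmap (vrel sH \<boxtimes> vrel sU \<boxtimes> vrel sH \<boxtimes> vrel sH)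
          (\<lambda>(x, v, z). \<Delta> z \<bind> (\<lambda>(z1, z2). gen (x, v, z1, z2))) \<Phi>l\<rho>)
        (tmap (vrel sH \<boxtimes> vrel sU \<boxtimes> vrel sH \<boxtimes> vrel sH)
          (\<lambda>(v, y, z). lam v \<bind> (\<lambda>(vm1, v0). gen (vm1, v0, y, z))) \<Phi>\<rho>)"


section \<open>The two-sided product\<close>

text \<open>The value of the multiplication on a pair of pure tensors \<open>a \<otimes> u \<otimes> b\<close>, \<open>a' \<otimes> u' \<otimes> b'\<close>, as a
  representative; \<open>actA\<close> and \<open>actB\<close> are the left and right actions.\<close>

definition two_sided_formula where
  "two_sided_formula mA actA mB actB lam \<Phi>l' \<rho> \<Phi>\<rho>' \<Phi>l\<rho>' = (\<lambda>(a, u, b) (a', u', b').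
    \<Phi>l' \<bind> (\<lambda>(x1, x2, x3). lam u \<bind> (\<lambda>(um1, u0). \<Phi>l\<rho>' \<bind> (\<lambda>(t1, t2, t3).
    \<rho> u' \<bind> (\<lambda>(v0, v1). \<Phi>\<rho>' \<bind> (\<lambda>(y1, y2, y3).
      gen (mA (actA x1 a) (actA (x2 * um1 * t1) a'),
           x3 * u0 * t2 * v0 * y1,
           mB (actB b (t3 * v1 * y2)) (actB b' y3))))))))"

text \<open>The structure on \<open>A \<otimes> \<A> \<otimes> B\<close>, with the bilinear extension of the above formula as
  multiplication.\<close>

definition two_sided_product where
  "two_sided_product sA mA eA actA sB mB eB actB sU lam \<Phi>l' \<rho> \<Phi>\<rho>' \<Phi>l\<rho>' =
    (let R = vrel sA \<boxtimes> vrel sU \<boxtimes> vrel sB in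
     \<lparr>carrier = tensors R,
      monoid.mult = (\<lambda>S T. tcoset R (S \<bind> (\<lambda>p. T \<bind> (\<lambda>q.
        two_sided_formula mA actA mB actB lam \<Phi>l' \<rho> \<Phi>\<rho>' \<Phi>l\<rho>' p q)))),
      one = pure R (eA, 1, eB),
      zero = tcoset R 0,
      add = tadd R,
      smult = tscale R\<rparr>)"

definition field_record :: "'k::field ring" where
  "field_record = \<lparr>carrier = UNIV, monoid.mult = (*), one = 1, zero = 0, add = (+)\<rparr>"

text \<open>The locale \<open>algebra\<close> of HOL-Algebra is about commutative algebras only.\<close>

locale assoc_unital_algebra = Module.module K M + Ring.ring M
  for K :: "('k, 'm) ring_scheme" (structure) and M :: "('k, 'c, 'n) module_scheme" (structure) +
  assumes smult_mult_left: "\<lbrakk>c \<in> carrier K; x \<in> carrier M; y \<in> carrier M\<rbrakk> \<Longrightarrow>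
      c \<odot>\<^bsub>M\<^esub> (x \<otimes>\<^bsub>M\<^esub> y) = (c \<odot>\<^bsub>M\<^esub> x) \<otimes>\<^bsub>M\<^esub> y"
    and smult_mult_right: "\<lbrakk>c \<in> carrier K; x \<in> carrier M; y \<in> carrier M\<rbrakk> \<Longrightarrow>
      c \<odot>\<^bsub>M\<^esub> (x \<otimes>\<^bsub>M\<^esub> y) = x \<otimes>\<^bsub>M\<^esub> (c \<odot>\<^bsub>M\<^esub> y)"

end

theory Submission
  imports Defs
begin

text \<open>Bracket products of three elements to the right in \<open>A\<close> and in \<open>B\<close>. Then both ways of
  multiplying \<open>a \<otimes> u \<otimes> b\<close>, \<open>a' \<otimes> u' \<otimes> b'\<close>, \<open>a'' \<otimes> u'' \<otimes> b''\<close> are obtained by letting an element of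
  \<open>H \<otimes> H \<otimes> H \<otimes> \<A> \<otimes> H \<otimes> H \<otimes> H\<close> act on \<open>a, a', a''\<close> and \<open>b, b', b''\<close>. The two elements are products of
  images of the reassociators and coactions, placed in consecutive legs. Four inverted pentagons and three
  quasi-coassociativity laws, applied from left to right, turn the first product into the second.
  For the unit one also needs \<open>(\<epsilon> \<otimes> id \<otimes> id) \<Phi>l\<rho> = 1 = (id \<otimes> id \<otimes> \<epsilon>) \<Phi>l\<rho>\<close>, which follows by applying
  \<open>\<epsilon>\<close> to the second leg of the left mixed pentagon and to the third leg of the right one.\<close>

subsection \<open>Linear extension\<close>

text \<open>Sweedler sums are taken over chosen representatives, whose sums and products agree with
  those of the tensors only modulo the relations. The choices are therefore kept, calculations take
  place in free vector spaces, and equations are between cosets; \<open>descends\<close> tells which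
  maps may be applied to both sides. Writing a nested Sweedler sum as a product of padded tensors
  replaces the bookkeeping of many summation variables by algebra in a monoid of tuples. The
  reassociators of A and B enter at opposite ends: rebracketing in A multiplies the coefficients by
  \<Phi> on the left, whereas in B, where H acts from the right, the inverse of \<Phi> is multiplied
  on the right. Between them stand coactions and inverses of the comodule reassociators, because the
  multiplication is built from these. The axioms concern the reassociators themselves, which is why
  the pentagons have to be inverted.\<close>

definition lext :: "('k \<Rightarrow> 'v \<Rightarrow> 'v) \<Rightarrow> ('x \<Rightarrow> 'v) \<Rightarrow> ('x \<Rightarrow>\<^sub>0 'k::field) \<Rightarrow> 'v::ab_group_add" where
  "lext s f v = (\<Sum>x\<in>Poly_Mapping.keys v. s (Poly_Mapping.lookup v x) (f x))"

text \<open>The zero vector needs no case of its own, as it is \<open>fscale 0 (gen x)\<close> for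
  any x.\<close>

lemma poly_mapping_gen_induct [case_names gen add]:
  assumes "\<And>c x. P (fscale c (gen x))" and "\<And>v w. P v \<Longrightarrow> P w \<Longrightarrow> P (v + w)"
  shows "P (v :: 'x \<Rightarrow>\<^sub>0 'k::field)"
proof (induction v rule: Poly_Mapping.update_induct)
  case const
  then show ?case using assms(1)[of 0 undefined] by simp
next
  case (update v x c)
  have "Poly_Mapping.update x c v = fscale c (gen x) + v"
    using update.hyps
    by (intro poly_mapping_eqI)
      (auto simp: gen_def lookup_update lookup_add lookup_single when_def in_keys_iff)
  then show ?case using assms update.IH by simp
qed

context vector_space
begin

text \<open>Terms may cancel in \<open>v + w\<close> and vanish in \<open>fscale 0 v\<close>, so the
  vectors to be compared have different keys. Summing over a common finite superset makes linearity
  a termwise matter.\<close>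

lemma lext_superset:
  assumes "finite S" and "Poly_Mapping.keys v \<subseteq> S"
  shows "lext scale f v = (\<Sum>x\<in>S. scale (Poly_Mapping.lookup v x) (f x))"
  unfolding lext_def by (rule sum.mono_neutral_left) (use assms in \<open>auto simp: in_keys_iff\<close>)

lemma lext_add: "lext scale f (v + w) = lext scale f v + lext scale f w"
proof -
  let ?S = "Poly_Mapping.keys v \<union> Poly_Mapping.keys w"
  have "Poly_Mapping.keys (v + w) \<subseteq> ?S" by (rule keys_add)
  then show ?thesis
    by (simp add: lext_superset[of ?S] lookup_add scale_left_distrib sum.distrib)
qed

lemma lext_fscale: "lext scale f (fscale c v) = scale c (lext scale f v)"
proof -
  have "Poly_Mapping.keys (fscale c v) \<subseteq> Poly_Mapping.keys v"
    by (auto simp: in_keys_iff)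
  then show ?thesis
    by (simp add: lext_superset[of "Poly_Mapping.keys v"] scale_sum_right)
qed

lemma lext_gen [simp]: "lext scale f (gen x) = f x"
  by (simp add: lext_def gen_def)

lemma linear_lext: "Vector_Spaces.linear fscale scale (lext scale f)"
  by unfold_locales (simp_all add: lext_add lext_fscale)

lemma lext_unique:
  assumes "Vector_Spaces.linear fscale scale L"
  shows "L v = lext scale (\<lambda>x. L (gen x)) v"
proof -
  interpret L: Vector_Spaces.linear fscale scale L by (fact assms)
  show ?thesis
    by (induction v rule: poly_mapping_gen_induct)
      (simp_all add: L.add L.scale lext_add lext_fscale)
qed

end

lemma linear_lext_apply:
  assumes "Vector_Spaces.linear s1 s2 L"
  shows "L (lext s1 f v) = lext s2 (\<lambda>x. L (f x)) v"
proof -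
  interpret L: Vector_Spaces.linear s1 s2 L by (fact assms)
  show ?thesis by (simp add: lext_def L.sum L.scale)
qed

lemma fext_eq_lext: "fext = lext fscale"
  by (intro ext) (simp add: fext_def lext_def)

lemma fext_add: "fext f (v + w) = fext f v + fext f w"
  by (simp add: fext_eq_lext free.lext_add)

lemma fext_fscale: "fext f (fscale c v) = fscale c (fext f v)"
  by (simp add: fext_eq_lext free.lext_fscale)

lemma fext_gen [simp]: "fext f (gen x) = f x"
  by (simp add: fext_eq_lext)

lemma fext_diff: "fext f (v - w) = fext f v - fext f w"
  using fext_add[of f "v - w" w] by (simp add: algebra_simps)

lemma fext_zero [simp]: "fext f 0 = 0"
  by (simp add: fext_def)

lemma fext_fext: "fext f (fext g v) = fext (\<lambda>x. fext f (g x)) v"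
  unfolding fext_eq_lext by (rule linear_lext_apply) (rule free.linear_lext)

lemma fext_gen_id [simp]: "fext gen v = v"
proof -
  have "Vector_Spaces.linear fscale fscale (\<lambda>v :: 'a \<Rightarrow>\<^sub>0 'b. v)" by unfold_locales auto
  from free.lext_unique[OF this] show ?thesis by (simp add: fext_eq_lext)
qed

lemma fext_add_fun: "fext (\<lambda>x. f x + g x) v = fext f v + fext g v"
  by (simp add: fext_def free.scale_right_distrib sum.distrib)

lemma fext_diff_fun: "fext (\<lambda>x. f x - g x) v = fext f v - fext g v"
  by (simp add: fext_def free.scale_right_diff_distrib sum_subtractf)

lemma fext_fscale_fun: "fext (\<lambda>x. fscale c (f x)) v = fscale c (fext f v)"
  by (simp add: fext_def free.scale_sum_right mult.commute)

text \<open>Both sides are linear in w and agree on generators, so uniqueness of linear extensions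
  applies. This exchanges two independent Sweedler sums.\<close>

lemma fext_swap: "fext (\<lambda>x. fext (\<lambda>y. f x y) w) v = fext (\<lambda>y. fext (\<lambda>x. f x y) v) w"
proof -
  let ?L = "\<lambda>w. fext (\<lambda>x. fext (f x) w) v"
  have "Vector_Spaces.linear fscale fscale ?L"
    by unfold_locales (simp_all add: fext_add fext_add_fun fext_fscale fext_fscale_fun)
  from free.lext_unique[OF this, of w] show ?thesis by (simp add: fext_eq_lext)
qed

subsection \<open>Maps descending to quotients\<close>

text \<open>The linear extension of \<open>f\<close> induces a map from the quotient by \<open>R\<close> to the quotient by \<open>S\<close>.
  Equality of classes modulo \<open>R\<close> is expressed as equality of cosets \<open>tcoset R\<close>.\<close>

definition descends :: "('x \<Rightarrow>\<^sub>0 'k) set \<Rightarrow> ('y \<Rightarrow>\<^sub>0 'k) set \<Rightarrow> ('x \<Rightarrow> ('y \<Rightarrow>\<^sub>0 'k::field)) \<Rightarrow> bool" where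
  "descends R S f \<longleftrightarrow> (\<forall>r\<in>R. fext f r \<in> free.span S)"

lemma descends_span:
  assumes "descends R S f" and "v \<in> free.span R"
  shows "fext f v \<in> free.span S"
  using assms(2)
proof (induction rule: free.span_induct_alt)
  case base
  then show ?case by (simp add: free.span_zero)
next
  case (step c x y)
  then show ?case using assms(1)
    by (simp add: fext_add fext_fscale free.span_add free.span_scale descends_def)
qed

lemma tcoset_fext:
  assumes "descends R S f" and "tcoset R v = tcoset R w"
  shows "tcoset S (fext f v) = tcoset S (fext f w)"
  using descends_span[OF assms(1), of "v - w"] assms(2) by (simp add: tcoset_eq_iff fext_diff)

text \<open>Counterpart of \<open>tcoset_fext\<close> in which the vector stays fixed and the map
  changes. The difference of the two sides is a linear combination of the vectors
  \<open>f x - g x\<close>.\<close>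

lemma tcoset_fext_cong:
  assumes "\<And>x. tcoset S (f x) = tcoset S (g x)"
  shows "tcoset S (fext f v) = tcoset S (fext g v)"
proof -
  have "(\<Sum>x\<in>Poly_Mapping.keys v. fscale (Poly_Mapping.lookup v x) (f x - g x)) \<in> free.span S"
    using assms by (intro free.span_sum free.span_scale) (simp add: tcoset_eq_iff)
  moreover have "fext f v - fext g v = fext (\<lambda>x. f x - g x) v" by (simp add: fext_diff_fun)
  ultimately show ?thesis unfolding tcoset_eq_iff by (simp add: fext_def)
qed

lemma tcoset_add_cong:
  "tcoset R v = tcoset R v' \<Longrightarrow> tcoset R w = tcoset R w' \<Longrightarrow> tcoset R (v + w) = tcoset R (v' + w')"
  unfolding tcoset_eq_iff using free.span_add[of "v - v'" R "w - w'"] by (simp add: algebra_simps)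

lemma tcoset_fscale_cong: "tcoset R v = tcoset R v' \<Longrightarrow> tcoset R (fscale c v) = tcoset R (fscale c v')"
  unfolding tcoset_eq_iff using free.span_scale[of "v - v'" R c]
  by (simp add: free.scale_right_diff_distrib)

text \<open>A relation of \<open>R \<boxtimes> S\<close> varies one component and freezes the other.
  Iterated along a tuple, this reduces well-definedness to one condition per leg, and by
  \<open>descends_vrel_iff\<close> that condition is linearity modulo T.\<close>

lemma descends_tensor_iff:
  "descends (R \<boxtimes> S) T f \<longleftrightarrow>
    (\<forall>y. descends R T (\<lambda>x. f (x, y))) \<and> (\<forall>x. descends S T (\<lambda>y. f (x, y)))"
proof -
  have "descends (R \<boxtimes> S) T f \<longleftrightarrow>
    (\<forall>y. \<forall>r\<in>R. fext f (fext (\<lambda>x. gen (x, y)) r) \<in> free.span T) \<and>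
    (\<forall>x. \<forall>r\<in>S. fext f (fext (\<lambda>y. gen (x, y)) r) \<in> free.span T)"
    unfolding descends_def rel_tensor_def by blast
  then show ?thesis by (simp add: descends_def fext_fext)
qed

lemma descends_vrel_iff:
  "descends (vrel s) T f \<longleftrightarrow>
    (\<forall>a a'. tcoset T (f (a + a')) = tcoset T (f a + f a')) \<and>
    (\<forall>c a. tcoset T (f (s c a)) = tcoset T (fscale c (f a)))"
proof -
  have "descends (vrel s) T f \<longleftrightarrow>
    (\<forall>a a'. fext f (gen (a + a') - gen a - gen a') \<in> free.span T) \<and>
    (\<forall>c a. fext f (gen (s c a) - fscale c (gen a)) \<in> free.span T)"
    unfolding descends_def vrel_def by blast
  then show ?thesis by (simp add: tcoset_eq_iff fext_diff fext_add fext_fscale diff_diff_eq)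
qed

lemma descends_self: "descends R R gen"
  by (simp add: descends_def free.span_base)

lemma descends_comp:
  assumes "descends S T g" and "descends R S f"
  shows "descends R T (\<lambda>x. fext g (f x))"
  using descends_span[OF assms(1)] assms(2) by (auto simp: descends_def fext_fext[symmetric])

lemma descends_pair_left: "descends R (R \<boxtimes> S) (\<lambda>x. gen (x, y))"
  unfolding descends_def by (intro ballI free.span_base) (auto simp: rel_tensor_def)

lemma descends_pair_right: "descends S (R \<boxtimes> S) (\<lambda>y. gen (x, y))"
  unfolding descends_def by (intro ballI free.span_base) (auto simp: rel_tensor_def)

lemma descends_gen_fst:
  assumes "descends V R (\<lambda>x. gen (g x))"
  shows "descends V (R \<boxtimes> S) (\<lambda>x. gen (g x, c))"
  using descends_comp[OF descends_pair_left assms] by simp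

lemma descends_gen_snd:
  assumes "descends V S (\<lambda>x. gen (g x))"
  shows "descends V (R \<boxtimes> S) (\<lambda>x. gen (c, g x))"
  using descends_comp[OF descends_pair_right assms] by simp

lemma descends_linear:
  assumes "Vector_Spaces.linear s t g"
  shows "descends (vrel s) (vrel t) (\<lambda>x. gen (g x))"
proof -
  interpret g: Vector_Spaces.linear s t g by (fact assms)
  show ?thesis
    unfolding descends_def
  proof (intro ballI free.span_base)
    fix r assume "r \<in> vrel s"
    then consider a a' where "r = gen (a + a') - gen a - gen a'"
      | c a where "r = gen (s c a) - fscale c (gen a)"
      unfolding vrel_def by blast
    then show "fext (\<lambda>x. gen (g x)) r \<in> vrel t"
    proof cases
      case 1
      then have "fext (\<lambda>x. gen (g x)) r = gen (g a + g a') - gen (g a) - gen (g a')"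
        by (simp add: fext_diff g.add)
      then show ?thesis unfolding vrel_def by blast
    next
      case 2
      then have "fext (\<lambda>x. gen (g x)) r = gen (t c (g a)) - fscale c (gen (g a))"
        by (simp add: fext_diff fext_fscale g.scale)
      then show ?thesis unfolding vrel_def by blast
    qed
  qed
qed

text \<open>After the two sums are exchanged, each inner sum lies in the span of S, and so does
  their combination.\<close>

lemma descends_fext_param:
  assumes "\<And>y. descends R S (\<lambda>x. f x y)"
  shows "descends R S (\<lambda>x. fext (f x) w)"
  unfolding descends_def
proof
  fix r assume "r \<in> R"
  then have "fext (\<lambda>y. fext (\<lambda>x. f x y) r) w \<in> free.span S"
    using assms unfolding fext_def[of _ w] descends_def
    by (intro free.span_sum free.span_scale) blast
  then show "fext (\<lambda>x. fext (f x) w) r \<in> free.span S" by (subst fext_swap)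
qed

lemma descends_fscale: "descends R S f \<Longrightarrow> descends R S (\<lambda>x. fscale c (f x))"
  by (simp add: descends_def fext_fscale_fun free.span_scale)

section \<open>Chosen representatives of cosets\<close>

lemma rep_tcoset: "tcoset R (rep (tcoset R v)) = tcoset R v"
proof -
  have "v \<in> tcoset R v" by (simp add: tcoset_def free.span_zero)
  then have "rep (tcoset R v) \<in> tcoset R v" unfolding rep_def by (rule someI)
  then show ?thesis unfolding tcoset_eq_iff by (simp add: tcoset_def)
qed

lemma tcoset_in_tensors [simp]: "tcoset R v \<in> tensors R"
  by (simp add: tensors_def)

lemma tadd_tcoset: "tadd R (tcoset R v) (tcoset R w) = tcoset R (v + w)"
  unfolding tadd_def by (intro tcoset_add_cong rep_tcoset)

lemma tscale_tcoset: "tscale R c (tcoset R v) = tcoset R (fscale c v)"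
  unfolding tscale_def by (intro tcoset_fscale_cong rep_tcoset)

text \<open>Here \<open>k\<close> places a vector into a leg of a tensor. The sum formed in the
  vector space and the formal sum of the placed vectors differ by relations, so a value of
  \<open>sweedler_val\<close> inside a leg can be expanded into pure tensors.\<close>

lemma tcoset_lext:
  assumes "vector_space s" and "descends (vrel s) S k"
  shows "tcoset S (k (lext s f v)) = tcoset S (fext (\<lambda>x. k (f x)) v)"
proof (induction v rule: poly_mapping_gen_induct)
  case (gen c x)
  interpret vector_space s by (fact assms(1))
  from assms(2) show ?case
    by (simp add: lext_fscale fext_fscale descends_vrel_iff)
next
  case (add v w)
  interpret vector_space s by (fact assms(1))
  show ?case
    using assms(2) tcoset_add_cong[OF add]
    by (simp add: lext_add fext_add descends_vrel_iff)
qed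

text \<open>The map sending x to \<open>rep (f x)\<close> need not be linear, as representatives are
  chosen independently. Its defects lie in the span of R, and \<open>k\<close> sends this span into
  that of S.\<close>

lemma descends_coaction:
  assumes "algebra_map_to_tensors s R f" and "descends R S k"
  shows "descends (vrel s) S (\<lambda>x. fext k (rep (f x)))"
  unfolding descends_vrel_iff
proof (intro conjI allI)
  fix a a' and c
  have "tcoset R (rep (f (a + a'))) = tcoset R (rep (f a) + rep (f a'))"
    using assms(1) by (simp add: algebra_map_to_tensors_def tadd_def rep_tcoset)
  from tcoset_fext[OF assms(2) this]
  show "tcoset S (fext k (rep (f (a + a')))) = tcoset S (fext k (rep (f a)) + fext k (rep (f a')))"
    by (simp add: fext_add)
  have "tcoset R (rep (f (s c a))) = tcoset R (fscale c (rep (f a)))"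
    using assms(1) by (simp add: algebra_map_to_tensors_def tscale_def rep_tcoset)
  from tcoset_fext[OF assms(2) this]
  show "tcoset S (fext k (rep (f (s c a)))) = tcoset S (fscale c (fext k (rep (f a))))"
    by (simp add: fext_fscale)
qed

subsection \<open>Multiplication of tensors\<close>

instance prod :: (semigroup_mult, semigroup_mult) semigroup_mult
  by standard (simp add: times_prod_def mult.assoc)

instance prod :: (monoid_mult, monoid_mult) monoid_mult
  by standard (simp_all add: times_prod_def one_prod_def)

text \<open>The times-instance of \<open>\<Rightarrow>\<^sub>0\<close> in the library uses the additive structure of the exponents, so it is
  not the multiplication needed here.\<close>

definition fmul :: "('x \<Rightarrow>\<^sub>0 'k) \<Rightarrow> ('x \<Rightarrow>\<^sub>0 'k) \<Rightarrow> ('x::times \<Rightarrow>\<^sub>0 'k::field)" (infixl \<open>\<star>\<close> 70) where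
  "v \<star> w = fext (\<lambda>x. fext (\<lambda>y. gen (x * y)) w) v"

lemma fmul_gen [simp]: "gen x \<star> gen y = gen (x * y)"
  by (simp add: fmul_def)

lemma fmul_fext_left: "fext f v \<star> w = fext (\<lambda>x. f x \<star> w) v"
  by (simp add: fmul_def fext_fext)

lemma fmul_fext_right: "w \<star> fext f v = fext (\<lambda>x. w \<star> f x) v"
  unfolding fmul_def fext_fext by (rule fext_swap)

lemma fmul_fext: "fext f v \<star> fext g w = fext (\<lambda>x. fext (\<lambda>y. f x \<star> g y) w) v"
  by (simp only: fmul_fext_left, simp only: fmul_fext_right)

lemma fmul_fscale_left: "fscale c v \<star> w = fscale c (v \<star> w)"
  by (simp add: fmul_def fext_fscale)

lemma fmul_fscale_right: "v \<star> fscale c w = fscale c (v \<star> w)"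
  by (simp add: fmul_def fext_fscale fext_fscale_fun)

lemma fmul_assoc: "(u \<star> v) \<star> w = u \<star> (v \<star> (w :: 'x::semigroup_mult \<Rightarrow>\<^sub>0 'k::field))"
proof -
  have "(fext gen u \<star> fext gen v) \<star> fext gen w = fext gen u \<star> (fext gen v \<star> fext gen w)"
    unfolding fmul_fext_left fmul_fext_right by (simp add: mult.assoc)
  then show ?thesis by simp
qed

lemma fmul_one_left [simp]: "gen 1 \<star> (v :: 'x::monoid_mult \<Rightarrow>\<^sub>0 'k::field) = v"
  by (simp add: fmul_def)

lemma fmul_one_right [simp]: "(v :: 'x::monoid_mult \<Rightarrow>\<^sub>0 'k::field) \<star> gen 1 = v"
  by (simp add: fmul_def)

text \<open>The condition makes the span of R a two-sided ideal for \<open>\<star>\<close>, so that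
  cosets can be multiplied.\<close>

definition mult_rel :: "('x::times \<Rightarrow>\<^sub>0 'k::field) set \<Rightarrow> bool" where
  "mult_rel R \<longleftrightarrow> (\<forall>x. descends R R (\<lambda>y. gen (x * y)) \<and> descends R R (\<lambda>y. gen (y * x)))"

lemma mult_rel_vrel:
  assumes "unital_algebra s"
  shows "mult_rel (vrel s)"
proof -
  interpret unital_algebra s by (fact assms)
  have "Vector_Spaces.linear s s (\<lambda>y. x * y)" for x
    by unfold_locales (simp_all add: distrib_left scale_mult_right)
  moreover have "Vector_Spaces.linear s s (\<lambda>y. y * x)" for x
    by unfold_locales (simp_all add: distrib_right scale_mult_left)
  ultimately show ?thesis unfolding mult_rel_def by (intro allI conjI descends_linear)
qed

lemma mult_rel_tensor: "mult_rel R \<Longrightarrow> mult_rel S \<Longrightarrow> mult_rel (R \<boxtimes> S)"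
  unfolding mult_rel_def descends_tensor_iff times_prod_def fst_conv snd_conv
  by (intro allI conjI descends_gen_fst descends_gen_snd) simp_all

lemma tcoset_fmul:
  assumes "mult_rel R" and v: "tcoset R v = tcoset R v'" and w: "tcoset R w = tcoset R w'"
  shows "tcoset R (v \<star> w) = tcoset R (v' \<star> w')"
proof -
  have "tcoset R (v \<star> w) = tcoset R (v' \<star> w)"
    unfolding fmul_def
    by (rule tcoset_fext[OF descends_fext_param v]) (use assms(1) in \<open>simp add: mult_rel_def\<close>)
  also have "\<dots> = tcoset R (v' \<star> w')"
    unfolding fmul_def
    by (rule tcoset_fext_cong, rule tcoset_fext[OF _ w]) (use assms(1) in \<open>simp add: mult_rel_def\<close>)
  finally show ?thesis .
qed

lemma tmul_eq: "tmul R S T = tcoset R (rep S \<star> rep T)"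
  by (simp add: tmul_def sweedler_def fmul_def)

lemma tmul_tcoset: "mult_rel R \<Longrightarrow> tmul R (tcoset R v) (tcoset R w) = tcoset R (v \<star> w)"
  unfolding tmul_eq by (intro tcoset_fmul rep_tcoset)

lemma tmul_assoc:
  fixes R :: "('x::semigroup_mult \<Rightarrow>\<^sub>0 'k::field) set"
  assumes "mult_rel R"
  shows "tmul R (tmul R S T) W = tmul R S (tmul R T W)"
proof -
  have "tmul R (tmul R S T) W = tcoset R ((rep S \<star> rep T) \<star> rep W)"
    unfolding tmul_eq by (intro tcoset_fmul[OF assms] rep_tcoset refl)
  moreover have "tmul R S (tmul R T W) = tcoset R (rep S \<star> (rep T \<star> rep W))"
    unfolding tmul_eq by (intro tcoset_fmul[OF assms] rep_tcoset refl)
  ultimately show ?thesis by (simp add: fmul_assoc)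
qed

text \<open>Multiplicativity is required on tuples and only modulo S, since in general
  representatives of comultiplications and coactions are multiplicative in no stronger
  sense.\<close>

definition mhom :: "('y \<Rightarrow>\<^sub>0 'k) set \<Rightarrow> ('x::times \<Rightarrow> ('y::times \<Rightarrow>\<^sub>0 'k::field)) \<Rightarrow> bool" where
  "mhom S f \<longleftrightarrow> (\<forall>x y. tcoset S (f (x * y)) = tcoset S (f x \<star> f y))"

lemma tcoset_mhom:
  assumes "mhom S f"
  shows "tcoset S (fext f (v \<star> w)) = tcoset S (fext f v \<star> fext f w)"
proof -
  have "fext f (v \<star> w) = fext (\<lambda>x. fext (\<lambda>y. f (x * y)) w) v"
    by (simp add: fmul_def fext_fext)
  moreover have "fext f v \<star> fext f w = fext (\<lambda>x. fext (\<lambda>y. f x \<star> f y) w) v"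
    by (rule fmul_fext)
  moreover have "tcoset S (fext (\<lambda>x. fext (\<lambda>y. f (x * y)) w) v) =
      tcoset S (fext (\<lambda>x. fext (\<lambda>y. f x \<star> f y) w) v)"
    using assms by (intro tcoset_fext_cong) (simp add: mhom_def)
  ultimately show ?thesis by simp
qed

lemma mhom_gen: "(\<And>x y. j (x * y) = j x * j y) \<Longrightarrow> mhom S (\<lambda>x. gen (j x))"
  by (simp add: mhom_def)

lemma mhom_coaction:
  assumes "mult_rel R" and "algebra_map_to_tensors s R f"
  shows "mhom R (\<lambda>x. rep (f x))"
  using assms by (simp add: mhom_def algebra_map_to_tensors_def tmul_eq rep_tcoset)

lemma mhom_cons:
  fixes R :: "('x::times \<Rightarrow>\<^sub>0 'k::field) set"
  assumes "mhom S f"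
  shows "mhom (R \<boxtimes> S) (\<lambda>(x, r). fext (\<lambda>y. gen (x, y)) (f r))"
proof -
  have "tcoset (R \<boxtimes> S) (fext (\<lambda>y. gen (x * x', y)) (f (r * r'))) =
    tcoset (R \<boxtimes> S) (fext (\<lambda>y. gen (x * x', y)) (f r \<star> f r'))" for x x' r r'
    using assms by (intro tcoset_fext[OF descends_pair_right]) (simp add: mhom_def)
  moreover have "fext (\<lambda>y. gen (x * x', y)) (f r \<star> f r') =
     fext (\<lambda>y. gen (x, y)) (f r) \<star> fext (\<lambda>y. gen (x', y)) (f r')" for x x' :: 'x and r r'
    unfolding fmul_fext by (simp add: fmul_def fext_fext times_prod_def)
  ultimately show ?thesis by (simp add: mhom_def times_prod_def case_prod_unfold)
qed

lemma mhom_split: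
  fixes R1 :: "('x::times \<Rightarrow>\<^sub>0 'k::field) set" and R2 :: "('y::times \<Rightarrow>\<^sub>0 'k) set"
  assumes f: "mhom S f" and d: "mhom (R1 \<boxtimes> R2) d"
  shows "mhom (R1 \<boxtimes> R2 \<boxtimes> S) (\<lambda>(x, r). fext (\<lambda>(x1, x2). fext (\<lambda>y. gen (x1, x2, y)) (f r)) (d x))"
    (is "mhom ?R (\<lambda>(x, r). fext (?k r) (d x))")
proof -
  have k: "descends (R1 \<boxtimes> R2) ?R (\<lambda>(x1, x2). fext (\<lambda>y. gen (x1, x2, y)) w)" for w
    unfolding descends_tensor_iff case_prod_conv
    by (intro allI conjI descends_fext_param descends_gen_fst descends_gen_snd descends_self)
  have s: "descends S ?R (\<lambda>y. gen (x1, x2, y))" for x1 x2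
    by (intro descends_gen_snd descends_self)
  have "tcoset ?R (fext (?k (r * r')) (d (x * x'))) =
        tcoset ?R (fext (?k r) (d x) \<star> fext (?k r') (d x'))" for x x' r r'
  proof -
    have "tcoset ?R (fext (?k (r * r')) (d (x * x'))) = tcoset ?R (fext (?k (r * r')) (d x \<star> d x'))"
      using d by (intro tcoset_fext[OF k]) (simp add: mhom_def)
    also have "\<dots> = tcoset ?R (fext (\<lambda>(x1, x2). fext (\<lambda>y. gen (x1, x2, y)) (f r \<star> f r')) (d x \<star> d x'))"
      unfolding case_prod_unfold using f
      by (intro tcoset_fext_cong tcoset_fext[OF s]) (simp add: mhom_def)
    also have "fext (\<lambda>(x1, x2). fext (\<lambda>y. gen (x1, x2, y)) (f r \<star> f r')) (d x \<star> d x') =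
      fext (\<lambda>p. fext (\<lambda>q. fext (\<lambda>y. gen (fst p * fst q, snd p * snd q, y)) (f r \<star> f r')) (d x')) (d x)"
      by (simp only: fmul_def[of "d x"] fext_fext fext_gen times_prod_def case_prod_unfold fst_conv snd_conv)
    also have "\<dots> = fext (?k r) (d x) \<star> fext (?k r') (d x')"
    proof -
      have "fext (\<lambda>y. gen (a * a', b * b', y)) (f r \<star> f r') =
        fext (\<lambda>y. gen (a, b, y)) (f r) \<star> fext (\<lambda>y. gen (a', b', y)) (f r')" for a a' :: 'x and b b' :: 'y
        unfolding fmul_fext by (simp add: fmul_def fext_fext times_prod_def)
      then show ?thesis by (simp only: fmul_fext[of _ "d x" _ "d x'"] case_prod_unfold)
    qed
    finally show ?thesis .
  qed
  then show ?thesis by (simp add: mhom_def times_prod_def case_prod_unfold)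
qed

lemma tmul_tcoset_left: "mult_rel R \<Longrightarrow> tmul R (tcoset R v) T = tcoset R (v \<star> rep T)"
  unfolding tmul_eq by (intro tcoset_fmul rep_tcoset refl)

lemma tmul_tcoset_right: "mult_rel R \<Longrightarrow> tmul R T (tcoset R v) = tcoset R (rep T \<star> v)"
  unfolding tmul_eq by (intro tcoset_fmul rep_tcoset refl)

subsection \<open>Homomorphisms and inverses\<close>

definition alg_hom :: "('x::{times,one} \<Rightarrow>\<^sub>0 'k) set \<Rightarrow> ('y \<Rightarrow>\<^sub>0 'k) set \<Rightarrow>
    ('x \<Rightarrow> ('y::{times,one} \<Rightarrow>\<^sub>0 'k::field)) \<Rightarrow> bool" where
  "alg_hom R S f \<longleftrightarrow> descends R S f \<and> mhom S f \<and> tcoset S (f 1) = tcoset S (gen 1)"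

lemma alg_hom_descends: "alg_hom R S f \<Longrightarrow> descends R S f"
  by (simp add: alg_hom_def)

lemma alg_hom_mult: "alg_hom R S f \<Longrightarrow> tcoset S (fext f (v \<star> w)) = tcoset S (fext f v \<star> fext f w)"
  by (simp add: alg_hom_def tcoset_mhom)

lemma alg_hom_one: "alg_hom R S f \<Longrightarrow> tcoset S (f 1) = tcoset S (gen 1)"
  by (simp add: alg_hom_def)

lemma alg_hom_gen:
  assumes "descends R S (\<lambda>x. gen (j x))" and "\<And>x y. j (x * y) = j x * j y" and "j 1 = 1"
  shows "alg_hom R S (\<lambda>x. gen (j x))"
  using assms by (simp add: alg_hom_def mhom_gen)

lemma alg_hom_id: "alg_hom R R gen"
  using alg_hom_gen[of R R "\<lambda>x. x"] by (simp add: descends_self)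

lemma alg_hom_coaction:
  assumes "mult_rel R" and "algebra_map_to_tensors s R f"
  shows "alg_hom (vrel s) R (\<lambda>x. rep (f x))"
proof -
  have "tcoset R (rep (f 1)) = tcoset R (gen 1)"
    using assms(2) by (simp add: algebra_map_to_tensors_def pure_def rep_tcoset)
  moreover have "descends (vrel s) R (\<lambda>x. rep (f x))"
    using descends_coaction[OF assms(2) descends_self] by simp
  ultimately show ?thesis by (simp add: alg_hom_def mhom_coaction[OF assms])
qed

lemma alg_hom_cons:
  assumes "alg_hom S T f"
  shows "alg_hom (R \<boxtimes> S) (R \<boxtimes> T) (\<lambda>(x, r). fext (\<lambda>y. gen (x, y)) (f r))"
proof -
  have "tcoset (R \<boxtimes> T) (fext (\<lambda>y. gen (1, y)) (f 1)) = tcoset (R \<boxtimes> T) (fext (\<lambda>y. gen (1, y)) (gen 1))"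
    using assms by (intro tcoset_fext[OF descends_pair_right]) (simp add: alg_hom_def)
  moreover have "descends (R \<boxtimes> S) (R \<boxtimes> T) (\<lambda>(x, r). fext (\<lambda>y. gen (x, y)) (f r))"
    unfolding descends_tensor_iff case_prod_conv
    using assms by (intro conjI allI descends_fext_param descends_pair_left
        descends_comp[OF descends_pair_right]) (simp add: alg_hom_def)
  ultimately show ?thesis
    using assms by (simp add: alg_hom_def mhom_cons one_prod_def)
qed

text \<open>Meant for two uses: with \<open>f\<close> the identity, one leg is split; with
  \<open>f\<close> splitting a later leg, one obtains maps such as \<open>D\<close> that comultiply
  two legs.\<close>

lemma alg_hom_split:
  assumes f: "alg_hom S T f" and d: "alg_hom V (R1 \<boxtimes> R2) d"
  shows "alg_hom (V \<boxtimes> S) (R1 \<boxtimes> R2 \<boxtimes> T)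
    (\<lambda>(x, r). fext (\<lambda>(x1, x2). fext (\<lambda>y. gen (x1, x2, y)) (f r)) (d x))"
    (is "alg_hom _ ?R ?f")
proof -
  have k: "descends (R1 \<boxtimes> R2) ?R (\<lambda>(x1, x2). fext (\<lambda>y. gen (x1, x2, y)) w)" for w
    unfolding descends_tensor_iff case_prod_conv
    by (intro allI conjI descends_fext_param descends_gen_fst descends_gen_snd descends_self)
  have s: "descends T ?R (\<lambda>y. gen (x1, x2, y))" for x1 x2
    by (intro descends_gen_snd descends_self)
  have "descends (V \<boxtimes> S) ?R ?f"
    unfolding descends_tensor_iff case_prod_conv
  proof (intro conjI allI)
    show "descends V ?R (\<lambda>x. fext (\<lambda>(x1, x2). fext (\<lambda>y. gen (x1, x2, y)) (f r)) (d x))" for r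
      by (rule descends_comp[OF k alg_hom_descends[OF d]])
    have "descends S ?R (\<lambda>r. case p of (x1, x2) \<Rightarrow> fext (\<lambda>y. gen (x1, x2, y)) (f r))" for p
      unfolding case_prod_unfold by (rule descends_comp[OF s alg_hom_descends[OF f]])
    then show "descends S ?R (\<lambda>r. fext (\<lambda>(x1, x2). fext (\<lambda>y. gen (x1, x2, y)) (f r)) (d x))" for x
      by (rule descends_fext_param)
  qed
  moreover have "tcoset ?R (?f 1) = tcoset ?R (gen 1)"
  proof -
    have "tcoset ?R (?f 1) = tcoset ?R (fext (\<lambda>(x1, x2). fext (\<lambda>y. gen (x1, x2, y)) (f 1)) (gen 1))"
      using tcoset_fext[OF k alg_hom_one[OF d]] by (simp add: one_prod_def)
    also have "\<dots> = tcoset ?R (gen 1)"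
      using tcoset_fext[OF s alg_hom_one[OF f]] by (simp add: one_prod_def)
    finally show ?thesis .
  qed
  ultimately show ?thesis
    using mhom_split f d by (auto simp: alg_hom_def)
qed

lemma mult_rel_one_left: "mult_rel R \<Longrightarrow> tcoset R v = tcoset R (gen 1) \<Longrightarrow>
    tcoset R (v \<star> w) = tcoset R (w :: 'x::monoid_mult \<Rightarrow>\<^sub>0 'k::field)"
  using tcoset_fmul[of R v "gen 1" w w] by simp

lemma mult_rel_one_right: "mult_rel R \<Longrightarrow> tcoset R w = tcoset R (gen 1) \<Longrightarrow>
    tcoset R (v \<star> w) = tcoset R (v :: 'x::monoid_mult \<Rightarrow>\<^sub>0 'k::field)"
  using tcoset_fmul[of R v v w "gen 1"] by simp

text \<open>\<open>tinverse\<close> speaks of cosets; the version for representatives allows the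
  linear extension of an algebra map to be applied to both elements.\<close>

definition inverses :: "('x::{times,one} \<Rightarrow>\<^sub>0 'k::field) set \<Rightarrow> ('x \<Rightarrow>\<^sub>0 'k) \<Rightarrow> ('x \<Rightarrow>\<^sub>0 'k) \<Rightarrow> bool" where
  "inverses R v w \<longleftrightarrow> tcoset R (v \<star> w) = tcoset R (gen 1) \<and> tcoset R (w \<star> v) = tcoset R (gen 1)"

lemma tinverse_inverses: "tinverse R T T' \<Longrightarrow> inverses R (rep T) (rep T')"
  by (simp add: tinverse_def inverses_def tmul_eq pure_def)

lemma inverses_fext:
  assumes "alg_hom R S f" and "inverses R v w"
  shows "inverses S (fext f v) (fext f w)"
  using alg_hom_mult[OF assms(1), of v w] alg_hom_mult[OF assms(1), of w v] assms
    tcoset_fext[OF alg_hom_descends[OF assms(1)], of "v \<star> w" "gen 1"]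
    tcoset_fext[OF alg_hom_descends[OF assms(1)], of "w \<star> v" "gen 1"]
  by (simp add: inverses_def alg_hom_one)

lemma inverses_sym: "inverses R v w \<Longrightarrow> inverses R w v"
  by (simp add: inverses_def)

context
  fixes R :: "('x::monoid_mult \<Rightarrow>\<^sub>0 'k::field) set"
  assumes R: "mult_rel R"
begin

lemma fmul_cancel_left:
  assumes "inverses R a a'"
  shows "tcoset R (a' \<star> v) = tcoset R w \<longleftrightarrow> tcoset R v = tcoset R (a \<star> w)"
proof
  assume "tcoset R (a' \<star> v) = tcoset R w"
  then have "tcoset R (a \<star> (a' \<star> v)) = tcoset R (a \<star> w)" by (intro tcoset_fmul[OF R] refl)
  then show "tcoset R v = tcoset R (a \<star> w)"
    using assms mult_rel_one_left[OF R, of "a \<star> a'" v] by (simp add: inverses_def fmul_assoc)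
next
  assume "tcoset R v = tcoset R (a \<star> w)"
  then have "tcoset R (a' \<star> v) = tcoset R (a' \<star> (a \<star> w))" by (intro tcoset_fmul[OF R] refl)
  then show "tcoset R (a' \<star> v) = tcoset R w"
    using assms mult_rel_one_left[OF R, of "a' \<star> a" w] by (simp add: inverses_def fmul_assoc[symmetric])
qed

lemma fmul_cancel_right:
  assumes "inverses R a a'"
  shows "tcoset R (v \<star> a') = tcoset R w \<longleftrightarrow> tcoset R v = tcoset R (w \<star> a)"
proof
  assume "tcoset R (v \<star> a') = tcoset R w"
  then have "tcoset R ((v \<star> a') \<star> a) = tcoset R (w \<star> a)" by (intro tcoset_fmul[OF R] refl)
  then show "tcoset R v = tcoset R (w \<star> a)"
    using assms mult_rel_one_right[OF R, of "a' \<star> a" v] by (simp add: inverses_def fmul_assoc)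
next
  assume "tcoset R v = tcoset R (w \<star> a)"
  then have "tcoset R (v \<star> a') = tcoset R ((w \<star> a) \<star> a')" by (intro tcoset_fmul[OF R] refl)
  then show "tcoset R (v \<star> a') = tcoset R w"
    using assms mult_rel_one_right[OF R, of "a \<star> a'" w] by (simp add: inverses_def fmul_assoc)
qed

lemma inverses_fmul:
  assumes "inverses R v v'" and "inverses R w w'"
  shows "inverses R (v \<star> w) (w' \<star> v')"
proof -
  have "tcoset R (v \<star> w \<star> (w' \<star> v')) = tcoset R (gen 1)"
    using assms fmul_cancel_right[OF assms(1), of "v \<star> w \<star> w'" "gen 1"]
      fmul_cancel_right[OF assms(2), of "v \<star> w" v]
    by (simp add: fmul_assoc)
  moreover have "tcoset R (w' \<star> v' \<star> (v \<star> w)) = tcoset R (gen 1)"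
    using assms fmul_cancel_right[OF inverses_sym[OF assms(2)], of "w' \<star> v' \<star> v" "gen 1"]
      fmul_cancel_right[OF inverses_sym[OF assms(1)], of "w' \<star> v'" w']
    by (simp add: fmul_assoc)
  ultimately show ?thesis by (simp add: inverses_def)
qed

lemma inverses_unique:
  assumes "inverses R v v'" and "inverses R w w'" and "tcoset R v = tcoset R w"
  shows "tcoset R v' = tcoset R w'"
proof -
  have "tcoset R (v' \<star> w) = tcoset R (gen 1)"
    using fmul_cancel_left[OF assms(1), of w "gen 1"] assms(3) by simp
  then show ?thesis
    using fmul_cancel_right[OF inverses_sym[OF assms(2)], of v' "gen 1"] by simp
qed

text \<open>Multiply by \<open>f'\<close> on both sides. Quasi-coassociativity laws thereby become
  laws for the inverse tensors.\<close>

lemma conjugate_inverse: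
  assumes "inverses R f f'" and "tcoset R (a \<star> f) = tcoset R (f \<star> b)"
  shows "tcoset R (f' \<star> a) = tcoset R (b \<star> f')"
proof -
  have "tcoset R a = tcoset R (f \<star> b \<star> f')"
    using fmul_cancel_right[OF inverses_sym[OF assms(1)], of a "f \<star> b"] assms(2) by simp
  then show ?thesis
    using fmul_cancel_left[OF assms(1), of a "b \<star> f'"] by (simp add: fmul_assoc)
qed

text \<open>Inverting a product reverses its factors, and congruent elements have congruent
  inverses.\<close>

lemma pentagon_inverse:
  assumes "tcoset R (a \<star> b \<star> c) = tcoset R (d \<star> e)"
    and "inverses R a a'" "inverses R b b'" "inverses R c c'" "inverses R d d'" "inverses R e e'"
  shows "tcoset R (c' \<star> b' \<star> a') = tcoset R (e' \<star> d')"
  using inverses_unique[OF inverses_fmul[OF inverses_fmul[OF assms(2,3)] assms(4)]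
      inverses_fmul[OF assms(5,6)] assms(1)]
  by (simp add: fmul_assoc)

text \<open>The counit axioms normalize the reassociators, whereas the multiplication contains their
  inverses; this carries the normalization over.\<close>

lemma alg_hom_inverse_one:
  assumes "alg_hom S R f" and "inverses S v w" and "tcoset R (fext f v) = tcoset R (gen 1)"
  shows "tcoset R (fext f w) = tcoset R (gen 1)"
  using inverses_unique[OF inverses_fext[OF assms(1,2)] _ assms(3), of "gen 1"]
  by (simp add: inverses_def)

end

subsection \<open>Padding and splitting legs\<close>

definition pad_left :: "'x \<times> 'y \<times> 'z \<Rightarrow> ('w::one \<times> 'x \<times> 'y \<times> 'z \<Rightarrow>\<^sub>0 'k::field)" where
  "pad_left = (\<lambda>(x, y, z). gen (1, x, y, z))"

definition pad_right :: "'x \<times> 'y \<times> 'z \<Rightarrow> ('x \<times> 'y \<times> 'z \<times> 'w::one \<Rightarrow>\<^sub>0 'k::field)" where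
  "pad_right = (\<lambda>(x, y, z). gen (x, y, z, 1))"

text \<open>Only the position is fixed, not the map \<open>d\<close>: with \<open>\<delta>\<close>,
  \<open>la\<close> and \<open>ro\<close> for \<open>d\<close>, the splittings of the three
  positions give all terms of the four pentagons that contain a comultiplication or a
  coaction.\<close>

definition split1 :: "('x \<Rightarrow> ('x1 \<times> 'x2 \<Rightarrow>\<^sub>0 'k)) \<Rightarrow> 'x \<times> 'y \<times> 'z \<Rightarrow> ('x1 \<times> 'x2 \<times> 'y \<times> 'z \<Rightarrow>\<^sub>0 'k::field)" where
  "split1 d = (\<lambda>(x, y, z). fext (\<lambda>(x1, x2). gen (x1, x2, y, z)) (d x))"

definition split2 :: "('y \<Rightarrow> ('y1 \<times> 'y2 \<Rightarrow>\<^sub>0 'k)) \<Rightarrow> 'x \<times> 'y \<times> 'z \<Rightarrow> ('x \<times> 'y1 \<times> 'y2 \<times> 'z \<Rightarrow>\<^sub>0 'k::field)" where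
  "split2 d = (\<lambda>(x, y, z). fext (\<lambda>(y1, y2). gen (x, y1, y2, z)) (d y))"

definition split3 :: "('z \<Rightarrow> ('z1 \<times> 'z2 \<Rightarrow>\<^sub>0 'k)) \<Rightarrow> 'x \<times> 'y \<times> 'z \<Rightarrow> ('x \<times> 'y \<times> 'z1 \<times> 'z2 \<Rightarrow>\<^sub>0 'k::field)" where
  "split3 d = (\<lambda>(x, y, z). fext (\<lambda>(z1, z2). gen (x, y, z1, z2)) (d z))"

definition split_fst :: "('x \<Rightarrow> ('x1 \<times> 'x2 \<Rightarrow>\<^sub>0 'k)) \<Rightarrow> 'x \<times> 'y \<Rightarrow> ('x1 \<times> 'x2 \<times> 'y \<Rightarrow>\<^sub>0 'k::field)" where
  "split_fst d = (\<lambda>(x, y). fext (\<lambda>(x1, x2). gen (x1, x2, y)) (d x))"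

definition split_snd :: "('y \<Rightarrow> ('y1 \<times> 'y2 \<Rightarrow>\<^sub>0 'k)) \<Rightarrow> 'x \<times> 'y \<Rightarrow> ('x \<times> 'y1 \<times> 'y2 \<Rightarrow>\<^sub>0 'k::field)" where
  "split_snd d = (\<lambda>(x, y). fext (\<lambda>(y1, y2). gen (x, y1, y2)) (d y))"

lemmas leg_defs = pad_left_def pad_right_def split1_def split2_def split3_def split_fst_def split_snd_def

lemma hom_split_fst: "alg_hom V (R1 \<boxtimes> R2) d \<Longrightarrow> alg_hom (V \<boxtimes> S) (R1 \<boxtimes> R2 \<boxtimes> S) (split_fst d)"
  using alg_hom_split[OF alg_hom_id[of S], of V R1 R2 d] by (simp add: case_prod_unfold split_fst_def)

lemma hom_split1: "alg_hom V (R1 \<boxtimes> R2) d \<Longrightarrow> alg_hom (V \<boxtimes> R \<boxtimes> S) (R1 \<boxtimes> R2 \<boxtimes> R \<boxtimes> S) (split1 d)"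
  using hom_split_fst[of V R1 R2 d "R \<boxtimes> S"] by (simp add: case_prod_unfold split1_def split_fst_def)

lemma hom_split2: "alg_hom V (R1 \<boxtimes> R2) d \<Longrightarrow> alg_hom (R \<boxtimes> V \<boxtimes> S) (R \<boxtimes> R1 \<boxtimes> R2 \<boxtimes> S) (split2 d)"
  using alg_hom_cons[OF hom_split_fst[of V R1 R2 d S], of R]
  by (simp add: case_prod_unfold split2_def split_fst_def fext_fext)

lemma hom_split_snd: "alg_hom V (R1 \<boxtimes> R2) d \<Longrightarrow> alg_hom (R \<boxtimes> V) (R \<boxtimes> R1 \<boxtimes> R2) (split_snd d)"
  using alg_hom_cons[of V "R1 \<boxtimes> R2" d R] by (simp add: case_prod_unfold split_snd_def)

lemma hom_split3: "alg_hom V (R1 \<boxtimes> R2) d \<Longrightarrow> alg_hom (R \<boxtimes> S \<boxtimes> V) (R \<boxtimes> S \<boxtimes> R1 \<boxtimes> R2) (split3 d)"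
  using alg_hom_cons[OF hom_split_snd[of V R1 R2 d S], of R]
  by (simp add: case_prod_unfold split_snd_def split3_def fext_fext)

lemmas descends_gen_intros =
  descends_gen_fst descends_gen_snd descends_self

lemma hom_pad_left:
  fixes R :: "('x::{times,one} \<Rightarrow>\<^sub>0 'k::field) set" and S :: "('y::{times,one} \<Rightarrow>\<^sub>0 'k) set"
    and T :: "('z::{times,one} \<Rightarrow>\<^sub>0 'k) set" and V :: "('w::monoid_mult \<Rightarrow>\<^sub>0 'k) set"
  shows "alg_hom (R \<boxtimes> S \<boxtimes> T) (V \<boxtimes> R \<boxtimes> S \<boxtimes> T) pad_left"
  unfolding pad_left_def case_prod_unfold
  by (rule alg_hom_gen)
    (unfold descends_tensor_iff fst_conv snd_conv, intro allI conjI descends_gen_intros,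
      simp_all add: times_prod_def one_prod_def)

lemma hom_pad_right:
  fixes R :: "('x::{times,one} \<Rightarrow>\<^sub>0 'k::field) set" and S :: "('y::{times,one} \<Rightarrow>\<^sub>0 'k) set"
    and T :: "('z::{times,one} \<Rightarrow>\<^sub>0 'k) set" and V :: "('w::monoid_mult \<Rightarrow>\<^sub>0 'k) set"
  shows "alg_hom (R \<boxtimes> S \<boxtimes> T) (R \<boxtimes> S \<boxtimes> T \<boxtimes> V) pad_right"
  unfolding pad_right_def case_prod_unfold
  by (rule alg_hom_gen)
    (unfold descends_tensor_iff fst_conv snd_conv, intro allI conjI descends_gen_intros,
      simp_all add: times_prod_def one_prod_def)

section \<open>Composites, counit maps and products of several factors\<close>

lemma alg_hom_comp:
  assumes f: "alg_hom R S f" and g: "alg_hom S T g"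
  shows "alg_hom R T (\<lambda>x. fext g (f x))"
proof -
  note dg = alg_hom_descends[OF g]
  have "tcoset T (fext g (f (x * y))) = tcoset T (fext g (f x) \<star> fext g (f y))" for x y
  proof -
    have "tcoset T (fext g (f (x * y))) = tcoset T (fext g (f x \<star> f y))"
      using f by (intro tcoset_fext[OF dg]) (simp add: alg_hom_def mhom_def)
    also have "\<dots> = tcoset T (fext g (f x) \<star> fext g (f y))" by (rule alg_hom_mult[OF g])
    finally show ?thesis .
  qed
  moreover have "tcoset T (fext g (f 1)) = tcoset T (gen 1)"
    using tcoset_fext[OF dg alg_hom_one[OF f]] alg_hom_one[OF g] by simp
  ultimately show ?thesis
    using descends_comp[OF dg alg_hom_descends[OF f]] by (simp add: alg_hom_def mhom_def)
qed

text \<open>Maps of this form apply \<epsilon> to some legs and forget them: \<open>c\<close> is the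
  product of the counits, \<open>j\<close> the projection to the remaining legs.\<close>

lemma alg_hom_scaled:
  assumes "descends R S (\<lambda>x. fscale (c x) (gen (j x)))"
    and "\<And>x y. c (x * y) = c x * c y" and "\<And>x y. j (x * y) = j x * j y" and "c 1 = 1" and "j 1 = 1"
  shows "alg_hom R S (\<lambda>x. fscale (c x) (gen (j x)))"
  using assms by (simp add: alg_hom_def mhom_def fmul_fscale_left fmul_fscale_right mult.commute)

lemma sweedler_val_eq: "sweedler_val s T f = lext s f (rep T)"
  by (simp add: sweedler_val_def lext_def)

lemma descends_fmul_left:
  assumes "mult_rel S" and "descends R S f"
  shows "descends R S (\<lambda>x. f x \<star> w)"
  unfolding fmul_def
  by (rule descends_comp[OF descends_fext_param assms(2)]) (use assms(1) in \<open>simp add: mult_rel_def\<close>)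

lemma descends_fmul_right:
  assumes "mult_rel S" and "descends R S f"
  shows "descends R S (\<lambda>x. w \<star> f x)"
  unfolding fmul_def
  by (rule descends_fext_param, rule descends_comp[OF _ assms(2)])
    (use assms(1) in \<open>simp add: mult_rel_def\<close>)

lemma fmul_gen_fext: "gen x \<star> fext g w = fext (\<lambda>y. gen x \<star> g y) w"
  by (rule fmul_fext_right)

lemma fext_fmul_middle: "fext (\<lambda>s. fext g (v \<star> f s \<star> w)) q = fext g (v \<star> fext f q \<star> w)"
  by (simp add: fmul_fext_left fmul_fext_right fext_fext)

text \<open>The counit axioms are equations between vectors, here between a sum and
  \<open>a\<close>. Placing both into a leg by \<open>k\<close> and pulling the counits out as
  scalars gives an equation between tensors.\<close>

lemma counit_collapse:
  assumes s: "vector_space s" and k: "descends (vrel s) S k"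
    and a: "lext s (\<lambda>p. s (c p) (j p)) v = a"
  shows "tcoset S (fext (\<lambda>p. fscale (c p) (k (j p))) v) = tcoset S (k a)"
proof -
  have "tcoset S (k a) = tcoset S (fext (\<lambda>p. k (s (c p) (j p))) v)"
    unfolding a[symmetric] by (rule tcoset_lext[OF s k])
  also have "\<dots> = tcoset S (fext (\<lambda>p. fscale (c p) (k (j p))) v)"
    using k by (intro tcoset_fext_cong) (simp add: descends_vrel_iff)
  finally show ?thesis by simp
qed

lemma tcoset_lext2:
  assumes "vector_space s" and "descends (vrel s) S k"
  shows "tcoset S (k (lext s (\<lambda>x. lext s (f x) w) v)) = tcoset S (fext (\<lambda>x. fext (\<lambda>y. k (f x y)) w) v)"
  unfolding tcoset_lext[OF assms, of _ v] by (rule tcoset_fext_cong) (rule tcoset_lext[OF assms])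

text \<open>Five is the number of factors of the coefficient \<open>Q\<close> of the
  multiplication.\<close>

lemma alg_hom_mult5:
  assumes f: "alg_hom R S f" and S: "mult_rel S"
  shows "tcoset S (fext f (v1 \<star> v2 \<star> v3 \<star> v4 \<star> v5)) =
    tcoset S (fext f v1 \<star> fext f v2 \<star> fext f v3 \<star> fext f v4 \<star> fext f v5)"
proof -
  note h = alg_hom_mult[OF f] and m = tcoset_fmul[OF S _ refl]
  show ?thesis
    using h[of "v1 \<star> v2 \<star> v3 \<star> v4" v5] m[OF h[of "v1 \<star> v2 \<star> v3" v4], of "fext f v5"]
      m[OF m[OF h[of "v1 \<star> v2" v3], of "fext f v4"], of "fext f v5"]
      m[OF m[OF m[OF h[of v1 v2], of "fext f v3"], of "fext f v4"], of "fext f v5"]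
    by simp
qed

lemma tcoset_fmul5:
  assumes "mult_rel S"
    and "tcoset S v1 = tcoset S w1" "tcoset S v2 = tcoset S w2" "tcoset S v3 = tcoset S w3"
    and "tcoset S v4 = tcoset S w4" "tcoset S v5 = tcoset S w5"
  shows "tcoset S (v1 \<star> v2 \<star> v3 \<star> v4 \<star> v5) = tcoset S (w1 \<star> w2 \<star> w3 \<star> w4 \<star> w5)"
  by (intro tcoset_fmul assms)

lemma bilinear_map_scale:
  assumes "bilinear_map s1 s2 s3 f"
  shows "f (s1 c x) y = s3 c (f x y)" and "f x (s2 c y) = s3 c (f x y)"
proof -
  interpret f1: Vector_Spaces.linear s1 s3 "\<lambda>x. f x y" using assms by (simp add: bilinear_map_def)
  interpret f2: Vector_Spaces.linear s2 s3 "f x" using assms by (simp add: bilinear_map_def)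
  show "f (s1 c x) y = s3 c (f x y)" and "f x (s2 c y) = s3 c (f x y)"
    by (rule f1.scale, rule f2.scale)
qed

text \<open>Products are kept nested to the right. An equation for two leading factors must then
  carry the rest \<open>X\<close> along in order to serve as a rewrite rule.\<close>

lemma tmul_rewrite:
  fixes R :: "('x::semigroup_mult \<Rightarrow>\<^sub>0 'k::field) set"
  assumes "mult_rel R"
  shows "tmul R S T = tmul R U V \<Longrightarrow> tmul R S (tmul R T X) = tmul R U (tmul R V X)"
  unfolding tmul_assoc[OF assms, symmetric] by simp

lemma fmul_left_commute:
  "x \<star> y = y \<star> x \<Longrightarrow> x \<star> (y \<star> z) = y \<star> (x \<star> (z :: 'x::semigroup_mult \<Rightarrow>\<^sub>0 'k::field))"
  by (simp only: fmul_assoc[symmetric])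

text \<open>Later \<open>h\<close> and \<open>k\<close> are coefficients of an inner product and the
  other factors belong to the outer one. Factors with disjoint nontrivial legs commute, so
  \<open>k\<close> moves in from the left and \<open>h\<close> from the right until they enclose the
  factor that comes from the inner middle component.\<close>

lemma fmul_commute_around:
  fixes h k :: "'x::semigroup_mult \<Rightarrow>\<^sub>0 'k::field"
  shows "k \<star> d1 = d1 \<star> k \<Longrightarrow> d3 \<star> h = h \<star> d3 \<Longrightarrow> d4 \<star> h = h \<star> d4 \<Longrightarrow> d5 \<star> h = h \<star> d5 \<Longrightarrow>
      k \<star> (d1 \<star> d2 \<star> d3 \<star> d4 \<star> d5) \<star> h = d1 \<star> (k \<star> d2 \<star> h) \<star> d3 \<star> d4 \<star> d5"
    and "k \<star> d1 = d1 \<star> k \<Longrightarrow> k \<star> d2 = d2 \<star> k \<Longrightarrow> k \<star> d3 = d3 \<star> k \<Longrightarrow> d5 \<star> h = h \<star> d5 \<Longrightarrow>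
      k \<star> (d1 \<star> d2 \<star> d3 \<star> d4 \<star> d5) \<star> h = d1 \<star> d2 \<star> d3 \<star> (k \<star> d4 \<star> h) \<star> d5"
  by (simp_all only: fmul_assoc fmul_left_commute)

lemma cring_field_record: "cring (field_record :: 'k::field ring)"
proof (rule cringI)
  show "abelian_group (field_record :: 'k ring)"
    by (rule abelian_groupI)
      (auto simp: field_record_def algebra_simps intro: exI[of _ "- x" for x] add.right_inverse)
  show "comm_monoid (field_record :: 'k ring)"
    by (rule comm_monoidI) (auto simp: field_record_def algebra_simps)
qed (simp add: field_record_def algebra_simps)

lemma tensors_cases:
  assumes "T \<in> tensors R"
  obtains v where "T = tcoset R v"
  using assms by (auto simp: tensors_def)

section \<open>The structures through their representatives\<close>

locale two_sided =
  bicomodule_algebra sH \<Delta> \<epsilon> \<Phi> \<Phi>' sU lam \<Phi>l \<Phi>l' \<rho> \<Phi>\<rho> \<Phi>\<rho>' \<Phi>l\<rho> \<Phi>l\<rho>' +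
  A: left_module_algebra sH \<Delta> \<epsilon> \<Phi> \<Phi>' sA mA eA actA +
  B: right_module_algebra sH \<Delta> \<epsilon> \<Phi> \<Phi>' sB mB eB actB
  for sH :: "'k::field \<Rightarrow> 'h::{ring,monoid_mult} \<Rightarrow> 'h"
    and \<Delta> \<epsilon> \<Phi> \<Phi>'
    and sU :: "'k \<Rightarrow> 'u::{ring,monoid_mult} \<Rightarrow> 'u"
    and lam \<Phi>l \<Phi>l' \<rho> \<Phi>\<rho> \<Phi>\<rho>' \<Phi>l\<rho> \<Phi>l\<rho>'
    and sA :: "'k \<Rightarrow> 'a::ab_group_add \<Rightarrow> 'a" and mA eA actA
    and sB :: "'k \<Rightarrow> 'b::ab_group_add \<Rightarrow> 'b" and mB eB actB
begin

abbreviation "RH \<equiv> vrel sH"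
abbreviation "RU \<equiv> vrel sU"
abbreviation "\<delta> \<equiv> \<lambda>h. rep (\<Delta> h)"
abbreviation "la \<equiv> \<lambda>u. rep (lam u)"
abbreviation "ro \<equiv> \<lambda>u. rep (\<rho> u)"
abbreviation "\<phi> \<equiv> rep \<Phi>"
abbreviation "\<phi>' \<equiv> rep \<Phi>'"
abbreviation "\<phi>l \<equiv> rep \<Phi>l"
abbreviation "\<phi>l' \<equiv> rep \<Phi>l'"
abbreviation "\<phi>r \<equiv> rep \<Phi>\<rho>"
abbreviation "\<phi>r' \<equiv> rep \<Phi>\<rho>'"
abbreviation "\<phi>m \<equiv> rep \<Phi>l\<rho>"
abbreviation "\<phi>m' \<equiv> rep \<Phi>l\<rho>'"

lemma mult_rel_H: "mult_rel RH" and mult_rel_U: "mult_rel RU"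
  by (rule mult_rel_vrel, unfold_locales)+

lemmas mult_rels = mult_rel_tensor mult_rel_H mult_rel_U

lemma \<delta>_hom: "alg_hom RH (RH \<boxtimes> RH) \<delta>"
  by (rule alg_hom_coaction[OF _ comult]) (intro mult_rels)

lemma lam_hom: "alg_hom RU (RH \<boxtimes> RU) la"
  by (rule alg_hom_coaction[OF _ left_coaction]) (intro mult_rels)

lemma \<rho>_hom: "alg_hom RU (RU \<boxtimes> RH) ro"
  by (rule alg_hom_coaction[OF _ right_coaction]) (intro mult_rels)

lemmas axiom_inverses =
  reassociator_inverse[THEN tinverse_inverses] left_inverse[THEN tinverse_inverses]
  right_inverse[THEN tinverse_inverses] mixed_inverse[THEN tinverse_inverses]

lemmas leg_inverses =
  inverses_fext[OF hom_pad_left] inverses_fext[OF hom_pad_right]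
  inverses_fext[OF hom_split1[OF \<delta>_hom]] inverses_fext[OF hom_split2[OF \<delta>_hom]] inverses_fext[OF hom_split3[OF \<delta>_hom]]
  inverses_fext[OF hom_split1[OF lam_hom]] inverses_fext[OF hom_split2[OF lam_hom]] inverses_fext[OF hom_split3[OF lam_hom]]
  inverses_fext[OF hom_split1[OF \<rho>_hom]] inverses_fext[OF hom_split2[OF \<rho>_hom]] inverses_fext[OF hom_split3[OF \<rho>_hom]]

subsection \<open>Inverted pentagons\<close>

lemma left_pentagon_eq:
  "tcoset (RH \<boxtimes> RH \<boxtimes> RH \<boxtimes> RU)
    (fext pad_left \<phi>l \<star> fext (split2 \<delta>) \<phi>l \<star> fext pad_right \<phi>) =
   tcoset (RH \<boxtimes> RH \<boxtimes> RH \<boxtimes> RU) (fext (split3 la) \<phi>l \<star> fext (split1 \<delta>) \<phi>l)"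
proof -
  have "mult_rel (RH \<boxtimes> RH \<boxtimes> RH \<boxtimes> RU)" by (intro mult_rels)
  from left_pentagon show ?thesis
    unfolding tmap_def sweedler_def tmul_tcoset[OF \<open>mult_rel _\<close>] leg_defs .
qed

lemma right_pentagon_eq:
  "tcoset (RU \<boxtimes> RH \<boxtimes> RH \<boxtimes> RH)
    (fext pad_left \<phi> \<star> fext (split2 \<delta>) \<phi>r \<star> fext pad_right \<phi>r) =
   tcoset (RU \<boxtimes> RH \<boxtimes> RH \<boxtimes> RH) (fext (split3 \<delta>) \<phi>r \<star> fext (split1 ro) \<phi>r)"
proof -
  have "mult_rel (RU \<boxtimes> RH \<boxtimes> RH \<boxtimes> RH)" by (intro mult_rels)
  from right_pentagon show ?thesis
    unfolding tmap_def sweedler_def tmul_tcoset[OF \<open>mult_rel _\<close>] leg_defs .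
qed

lemma mixed_pentagon_left_eq:
  "tcoset (RH \<boxtimes> RH \<boxtimes> RU \<boxtimes> RH)
    (fext pad_left \<phi>m \<star> fext (split2 la) \<phi>m \<star> fext pad_right \<phi>l) =
   tcoset (RH \<boxtimes> RH \<boxtimes> RU \<boxtimes> RH) (fext (split3 ro) \<phi>l \<star> fext (split1 \<delta>) \<phi>m)"
proof -
  have "mult_rel (RH \<boxtimes> RH \<boxtimes> RU \<boxtimes> RH)" by (intro mult_rels)
  from mixed_pentagon_left show ?thesis
    unfolding tmap_def sweedler_def tmul_tcoset[OF \<open>mult_rel _\<close>] leg_defs .
qed

lemma mixed_pentagon_right_eq:
  "tcoset (RH \<boxtimes> RU \<boxtimes> RH \<boxtimes> RH)
    (fext pad_left \<phi>r \<star> fext (split2 ro) \<phi>m \<star> fext pad_right \<phi>m) =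
   tcoset (RH \<boxtimes> RU \<boxtimes> RH \<boxtimes> RH) (fext (split3 \<delta>) \<phi>m \<star> fext (split1 la) \<phi>r)"
proof -
  have "mult_rel (RH \<boxtimes> RU \<boxtimes> RH \<boxtimes> RH)" by (intro mult_rels)
  from mixed_pentagon_right show ?thesis
    unfolding tmap_def sweedler_def tmul_tcoset[OF \<open>mult_rel _\<close>] leg_defs .
qed

text \<open>\<Phi> stays uninverted because this is how it arises when a product in A is
  rebracketed. The factor \<open>fext pad_left \<phi>l'\<close> at the right end is trivial in the
  first leg, so it can also be read in the next window of four legs.\<close>

lemma left_pentagon_inverse:
  "tcoset (RH \<boxtimes> RH \<boxtimes> RH \<boxtimes> RU)
    (fext pad_right \<phi> \<star> fext (split1 \<delta>) \<phi>l' \<star> fext (split3 la) \<phi>l') =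
   tcoset (RH \<boxtimes> RH \<boxtimes> RH \<boxtimes> RU) (fext (split2 \<delta>) \<phi>l' \<star> fext pad_left \<phi>l')"
proof -
  have R: "mult_rel (RH \<boxtimes> RH \<boxtimes> RH \<boxtimes> RU)" by (intro mult_rels)
  have "tcoset (RH \<boxtimes> RH \<boxtimes> RH \<boxtimes> RU)
     (fext pad_right \<phi>' \<star> fext (split2 \<delta>) \<phi>l' \<star> fext pad_left \<phi>l') =
    tcoset (RH \<boxtimes> RH \<boxtimes> RH \<boxtimes> RU) (fext (split1 \<delta>) \<phi>l' \<star> fext (split3 la) \<phi>l')"
    by (rule pentagon_inverse[OF R left_pentagon_eq])
      (intro leg_inverses axiom_inverses)+
  moreover have "inverses (RH \<boxtimes> RH \<boxtimes> RH \<boxtimes> RU) (fext pad_right \<phi>) (fext pad_right \<phi>')"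
    by (intro leg_inverses axiom_inverses)
  ultimately show ?thesis
    using fmul_cancel_left[OF R, of "fext pad_right \<phi>" "fext pad_right \<phi>'"]
    by (simp add: fmul_assoc)
qed

lemma right_pentagon_inverse:
  "tcoset (RU \<boxtimes> RH \<boxtimes> RH \<boxtimes> RH)
    (fext pad_right \<phi>r' \<star> fext (split2 \<delta>) \<phi>r' \<star> fext pad_left \<phi>') =
   tcoset (RU \<boxtimes> RH \<boxtimes> RH \<boxtimes> RH) (fext (split1 ro) \<phi>r' \<star> fext (split3 \<delta>) \<phi>r')"
proof -
  have R: "mult_rel (RU \<boxtimes> RH \<boxtimes> RH \<boxtimes> RH)" by (intro mult_rels)
  show ?thesis
    by (rule pentagon_inverse[OF R right_pentagon_eq])
      (intro leg_inverses axiom_inverses)+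
qed

text \<open>The mixed reassociator has been moved to the right side, hence uninverted, so that the
  last factor is again trivial in the first leg. \<open>mixed_pentagon_right_inverse\<close> takes
  it up at its front.\<close>

lemma mixed_pentagon_left_inverse:
  "tcoset (RH \<boxtimes> RH \<boxtimes> RU \<boxtimes> RH)
    (fext pad_right \<phi>l' \<star> fext (split2 la) \<phi>m') =
   tcoset (RH \<boxtimes> RH \<boxtimes> RU \<boxtimes> RH)
    (fext (split1 \<delta>) \<phi>m' \<star> fext (split3 ro) \<phi>l' \<star> fext pad_left \<phi>m)"
proof -
  have R: "mult_rel (RH \<boxtimes> RH \<boxtimes> RU \<boxtimes> RH)" by (intro mult_rels)
  have "tcoset (RH \<boxtimes> RH \<boxtimes> RU \<boxtimes> RH)
     (fext pad_right \<phi>l' \<star> fext (split2 la) \<phi>m' \<star> fext pad_left \<phi>m') =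
    tcoset (RH \<boxtimes> RH \<boxtimes> RU \<boxtimes> RH) (fext (split1 \<delta>) \<phi>m' \<star> fext (split3 ro) \<phi>l')"
    by (rule pentagon_inverse[OF R mixed_pentagon_left_eq])
      (intro leg_inverses axiom_inverses)+
  moreover have "inverses (RH \<boxtimes> RH \<boxtimes> RU \<boxtimes> RH) (fext pad_left \<phi>m) (fext pad_left \<phi>m')"
    by (intro leg_inverses axiom_inverses)
  ultimately show ?thesis
    using fmul_cancel_right[OF R, of "fext pad_left \<phi>m" "fext pad_left \<phi>m'"] by simp
qed

lemma mixed_pentagon_right_inverse:
  "tcoset (RH \<boxtimes> RU \<boxtimes> RH \<boxtimes> RH)
    (fext pad_right \<phi>m \<star> fext (split1 la) \<phi>r' \<star> fext (split3 \<delta>) \<phi>m') =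
   tcoset (RH \<boxtimes> RU \<boxtimes> RH \<boxtimes> RH) (fext (split2 ro) \<phi>m' \<star> fext pad_left \<phi>r')"
proof -
  have R: "mult_rel (RH \<boxtimes> RU \<boxtimes> RH \<boxtimes> RH)" by (intro mult_rels)
  have "tcoset (RH \<boxtimes> RU \<boxtimes> RH \<boxtimes> RH)
     (fext pad_right \<phi>m' \<star> fext (split2 ro) \<phi>m' \<star> fext pad_left \<phi>r') =
    tcoset (RH \<boxtimes> RU \<boxtimes> RH \<boxtimes> RH) (fext (split1 la) \<phi>r' \<star> fext (split3 \<delta>) \<phi>m')"
    by (rule pentagon_inverse[OF R mixed_pentagon_right_eq])
      (intro leg_inverses axiom_inverses)+
  moreover have "inverses (RH \<boxtimes> RU \<boxtimes> RH \<boxtimes> RH) (fext pad_right \<phi>m) (fext pad_right \<phi>m')"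
    by (intro leg_inverses axiom_inverses)
  ultimately show ?thesis
    using fmul_cancel_left[OF R, of "fext pad_right \<phi>m" "fext pad_right \<phi>m'"]
    by (simp add: fmul_assoc)
qed

section \<open>Quasi-coassociativity laws\<close>

lemma left_coassociative_inverse:
  "tcoset (RH \<boxtimes> RH \<boxtimes> RU) (\<phi>l' \<star> fext (split_snd la) (la u)) =
   tcoset (RH \<boxtimes> RH \<boxtimes> RU) (fext (split_fst \<delta>) (la u) \<star> \<phi>l')"
proof -
  have R: "mult_rel (RH \<boxtimes> RH \<boxtimes> RU)" by (intro mult_rels)
  from left_quasi_coassociative[of u]
  have "tcoset (RH \<boxtimes> RH \<boxtimes> RU) (fext (split_snd la) (la u) \<star> \<phi>l) =
    tcoset (RH \<boxtimes> RH \<boxtimes> RU) (\<phi>l \<star> fext (split_fst \<delta>) (la u))"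
    unfolding tmap_def sweedler_def leg_defs tmul_tcoset_left[OF R] tmul_tcoset_right[OF R] .
  then show ?thesis
    by (rule conjugate_inverse[OF R axiom_inverses(2)])
qed

lemma right_coassociative_inverse:
  "tcoset (RU \<boxtimes> RH \<boxtimes> RH) (\<phi>r' \<star> fext (split_snd \<delta>) (ro u)) =
   tcoset (RU \<boxtimes> RH \<boxtimes> RH) (fext (split_fst ro) (ro u) \<star> \<phi>r')"
proof -
  have R: "mult_rel (RU \<boxtimes> RH \<boxtimes> RH)" by (intro mult_rels)
  from right_quasi_coassociative[of u]
  have "tcoset (RU \<boxtimes> RH \<boxtimes> RH) (\<phi>r \<star> fext (split_fst ro) (ro u)) =
    tcoset (RU \<boxtimes> RH \<boxtimes> RH) (fext (split_snd \<delta>) (ro u) \<star> \<phi>r)"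
    unfolding tmap_def sweedler_def leg_defs tmul_tcoset_left[OF R] tmul_tcoset_right[OF R] .
  from this[symmetric] show ?thesis
    by (rule conjugate_inverse[OF R axiom_inverses(3)])
qed

lemma mixed_coassociative:
  "tcoset (RH \<boxtimes> RU \<boxtimes> RH) (\<phi>m \<star> fext (split_fst la) (ro u)) =
   tcoset (RH \<boxtimes> RU \<boxtimes> RH) (fext (split_snd ro) (la u) \<star> \<phi>m)"
proof -
  have R: "mult_rel (RH \<boxtimes> RU \<boxtimes> RH)" by (intro mult_rels)
  from mixed_quasi_coassociative[of u] show ?thesis
    unfolding tmap_def sweedler_def leg_defs tmul_tcoset_left[OF R] tmul_tcoset_right[OF R] .
qed

lemma vector_space_U: "vector_space sU" and vector_space_H: "vector_space sH"
  by unfold_locales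

subsection \<open>Counits\<close>

lemma counit_add: "\<epsilon> (h + h') = \<epsilon> h + \<epsilon> h'" and counit_scale: "\<epsilon> (sH c h) = c * \<epsilon> h"
proof -
  interpret \<epsilon>: Vector_Spaces.linear sH "(*)" \<epsilon> by (rule counit_linear)
  show "\<epsilon> (h + h') = \<epsilon> h + \<epsilon> h'" by (rule \<epsilon>.add)
  show "\<epsilon> (sH c h) = c * \<epsilon> h" by (rule \<epsilon>.scale)
qed

text \<open>The counit of a leg may stand alone or be either factor of a product of two counits, and
  rules are applied syntactically; hence the three forms.\<close>

lemma descends_counit: "descends RH S (\<lambda>h. fscale (\<epsilon> h * c) w)" "descends RH S (\<lambda>h. fscale (c * \<epsilon> h) w)"
  "descends RH S (\<lambda>h. fscale (\<epsilon> h) w)"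
  by (simp_all add: descends_vrel_iff counit_add counit_scale free.scale_left_distrib
      distrib_left distrib_right mult.assoc mult.left_commute)

lemmas descends_scaled_intros = descends_counit descends_fscale descends_gen_intros

lemma hom_counit_3: "alg_hom (RH \<boxtimes> RU \<boxtimes> RH \<boxtimes> RH) (RH \<boxtimes> RU \<boxtimes> RH) (\<lambda>(x, v, y, z). fscale (\<epsilon> y) (gen (x, v, z)))"
  unfolding case_prod_unfold
  by (rule alg_hom_scaled)
    (unfold descends_tensor_iff fst_conv snd_conv, intro allI conjI descends_scaled_intros,
      simp_all add: times_prod_def one_prod_def counit_mult counit_one)

lemma hom_counit_2: "alg_hom (RH \<boxtimes> RH \<boxtimes> RU \<boxtimes> RH) (RH \<boxtimes> RU \<boxtimes> RH) (\<lambda>(x, y, v, z). fscale (\<epsilon> y) (gen (x, v, z)))"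
  unfolding case_prod_unfold
  by (rule alg_hom_scaled)
    (unfold descends_tensor_iff fst_conv snd_conv, intro allI conjI descends_scaled_intros,
      simp_all add: times_prod_def one_prod_def counit_mult counit_one)

lemma coaction_counit:
  "descends RH S k \<Longrightarrow> tcoset S (fext (\<lambda>(x, y). fscale (\<epsilon> y) (k x)) (\<delta> h)) = tcoset S (k h)"
  "descends RH S k \<Longrightarrow> tcoset S (fext (\<lambda>(x, y). fscale (\<epsilon> x) (k y)) (\<delta> h)) = tcoset S (k h)"
  "descends RU S k' \<Longrightarrow> tcoset S (fext (\<lambda>(x, y). fscale (\<epsilon> y) (k' x)) (ro u)) = tcoset S (k' u)"
  "descends RU S k' \<Longrightarrow> tcoset S (fext (\<lambda>(x, y). fscale (\<epsilon> x) (k' y)) (la u)) = tcoset S (k' u)"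
  using counit_collapse[OF vector_space_H, of S k "\<lambda>p. \<epsilon> (snd p)" fst "\<delta> h" h]
    counit_collapse[OF vector_space_H, of S k "\<lambda>p. \<epsilon> (fst p)" snd "\<delta> h" h]
    counit_collapse[OF vector_space_U, of S k' "\<lambda>p. \<epsilon> (snd p)" fst "ro u" u]
    counit_collapse[OF vector_space_U, of S k' "\<lambda>p. \<epsilon> (fst p)" snd "la u" u]
    counit_right[of h] counit_left[of h] right_coaction_counit[of u] left_coaction_counit[of u]
  unfolding sweedler_val_eq case_prod_unfold by simp_all

abbreviation "RHUH \<equiv> RH \<boxtimes> RU \<boxtimes> RH"

lemma mult_rel_HUH: "mult_rel RHUH"
  by (intro mult_rels)

lemma axiom_counits:
  "tcoset (RH \<boxtimes> RU) (fext (\<lambda>(x, y, u). fscale (\<epsilon> x) (gen (y, u))) \<phi>l) = tcoset (RH \<boxtimes> RU) (gen 1)"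
  "tcoset (RH \<boxtimes> RU) (fext (\<lambda>(x, y, u). fscale (\<epsilon> y) (gen (x, u))) \<phi>l) = tcoset (RH \<boxtimes> RU) (gen 1)"
  "tcoset (RU \<boxtimes> RH) (fext (\<lambda>(u, y, z). fscale (\<epsilon> y) (gen (u, z))) \<phi>r) = tcoset (RU \<boxtimes> RH) (gen 1)"
  "tcoset (RU \<boxtimes> RH) (fext (\<lambda>(u, y, z). fscale (\<epsilon> z) (gen (u, y))) \<phi>r) = tcoset (RU \<boxtimes> RH) (gen 1)"
  using left_counit_1 left_counit_2 right_counit_2 right_counit_3
  by (simp_all add: tmap_def pure_def sweedler_def)

text \<open>The counit \<open>?g\<close> sends the five factors of the pentagon to 1, \<Phi>l\<rho>,
  \<open>?X\<close> on the left and to \<Phi>l\<rho>, 1 on the right. So \<Phi>l\<rho> times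
  \<open>?X\<close> is \<Phi>l\<rho>, and \<Phi>l\<rho> cancels. The leg on which \<epsilon> acted
  is filled with 1, so that the claim stays in the algebra where \<Phi>l\<rho> is
  invertible.\<close>

lemma mixed_counit_right:
  "tcoset RHUH (fext (\<lambda>(x, v, z). fscale (\<epsilon> z) (gen (x, v, 1))) \<phi>m) = tcoset RHUH (gen 1)"
proof -
  let ?g = "\<lambda>(x, v, y, z). fscale (\<epsilon> y) (gen (x, v, z)) :: ('h \<times> 'u \<times> 'h \<Rightarrow>\<^sub>0 'k)"
  let ?X = "fext (\<lambda>(x, v, z). fscale (\<epsilon> z) (gen (x, v, 1))) \<phi>m :: ('h \<times> 'u \<times> 'h \<Rightarrow>\<^sub>0 'k)"
  have la_hom: "alg_hom (RU \<boxtimes> RH) RHUH (split_fst la)"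
    by (rule hom_split_fst[OF lam_hom])
  note counit_\<phi>r = axiom_counits(3)
  have a: "tcoset RHUH (fext ?g (fext pad_left \<phi>r)) = tcoset RHUH (gen 1)"
  proof -
    have "descends (RU \<boxtimes> RH) RHUH (\<lambda>p. gen (1, p))" by (rule descends_pair_right)
    from tcoset_fext[OF this counit_\<phi>r] show ?thesis
      by (simp add: fext_fext fext_fscale case_prod_unfold pad_left_def one_prod_def)
  qed
  have b: "tcoset RHUH (fext ?g (fext (split2 ro) \<phi>m)) = tcoset RHUH \<phi>m"
  proof -
    have "tcoset RHUH (fext (\<lambda>(v0, v1). fscale (\<epsilon> v1) (gen (x, v0, z))) (ro v)) = tcoset RHUH (gen (x, v, z))" for x v z
      by (rule coaction_counit(3)) (intro descends_gen_intros)
    then have "tcoset RHUH (fext (\<lambda>(x, v, z). fext (\<lambda>(v0, v1). fscale (\<epsilon> v1) (gen (x, v0, z))) (ro v)) \<phi>m) =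
      tcoset RHUH (fext gen \<phi>m)"
      by (intro tcoset_fext_cong) (simp add: case_prod_unfold)
    then show ?thesis by (simp add: fext_fext fext_fscale case_prod_unfold split2_def)
  qed
  have d: "tcoset RHUH (fext ?g (fext (split3 \<delta>) \<phi>m)) = tcoset RHUH \<phi>m"
  proof -
    have "tcoset RHUH (fext (\<lambda>(z1, z2). fscale (\<epsilon> z1) (gen (x, v, z2))) (\<delta> z)) = tcoset RHUH (gen (x, v, z))" for x v z
      by (rule coaction_counit(2)) (intro descends_gen_intros)
    then have "tcoset RHUH (fext (\<lambda>(x, v, z). fext (\<lambda>(z1, z2). fscale (\<epsilon> z1) (gen (x, v, z2))) (\<delta> z)) \<phi>m) =
      tcoset RHUH (fext gen \<phi>m)"
      by (intro tcoset_fext_cong) (simp add: case_prod_unfold)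
    then show ?thesis by (simp add: fext_fext fext_fscale case_prod_unfold split3_def)
  qed
  have e: "tcoset RHUH (fext ?g (fext (split1 la) \<phi>r)) = tcoset RHUH (gen 1)"
  proof -
    have "fext ?g (fext (split1 la) \<phi>r) =
        fext (split_fst la) (fext (\<lambda>(u, y, z). fscale (\<epsilon> y) (gen (u, z))) \<phi>r)"
      by (simp add: fext_fext fext_fscale fext_fscale_fun case_prod_unfold split1_def split_fst_def)
    then show ?thesis
      using tcoset_fext[OF alg_hom_descends[OF la_hom] counit_\<phi>r] alg_hom_one[OF la_hom] by simp
  qed
  have c: "fext ?g (fext pad_right \<phi>m) = ?X"
    by (simp add: fext_fext fext_fscale case_prod_unfold pad_right_def)
  note h = alg_hom_mult[OF hom_counit_3]
  have "tcoset RHUH (\<phi>m \<star> ?X) =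
      tcoset RHUH (fext ?g (fext pad_left \<phi>r) \<star> fext ?g (fext (split2 ro) \<phi>m) \<star> fext ?g (fext pad_right \<phi>m))"
    unfolding c
    by (intro tcoset_fmul[OF mult_rel_HUH] refl)
      (use mult_rel_one_left[OF mult_rel_HUH a] b in simp)
  also have "\<dots> = tcoset RHUH (fext ?g (fext pad_left \<phi>r \<star> fext (split2 ro) \<phi>m) \<star> fext ?g (fext pad_right \<phi>m))"
    by (intro tcoset_fmul[OF mult_rel_HUH] refl h[symmetric])
  also have "\<dots> = tcoset RHUH (fext ?g (fext pad_left \<phi>r \<star> fext (split2 ro) \<phi>m \<star> fext pad_right \<phi>m))"
    by (rule h[symmetric])
  also have "\<dots> = tcoset RHUH (fext ?g (fext (split3 \<delta>) \<phi>m \<star> fext (split1 la) \<phi>r))"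
    by (rule tcoset_fext[OF alg_hom_descends[OF hom_counit_3] mixed_pentagon_right_eq])
  also have "\<dots> = tcoset RHUH (fext ?g (fext (split3 \<delta>) \<phi>m) \<star> fext ?g (fext (split1 la) \<phi>r))"
    by (rule h)
  also have "\<dots> = tcoset RHUH \<phi>m"
    using mult_rel_one_right[OF mult_rel_HUH e] d by simp
  finally have "tcoset RHUH ?X = tcoset RHUH (\<phi>m' \<star> \<phi>m)"
    by (simp only: fmul_cancel_left[OF mult_rel_HUH inverses_sym[OF axiom_inverses(4)]])
  then show ?thesis using axiom_inverses(4) by (simp add: inverses_def)
qed

text \<open>This time the counit leaves \<open>?Y\<close> times \<Phi>l\<rho> equal to
  \<Phi>l\<rho>, and the cancellation is on the right.\<close>

lemma mixed_counit_left:
  "tcoset RHUH (fext (\<lambda>(x, v, z). fscale (\<epsilon> x) (gen (1, v, z))) \<phi>m) = tcoset RHUH (gen 1)"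
proof -
  let ?g = "\<lambda>(x, y, v, z). fscale (\<epsilon> y) (gen (x, v, z)) :: ('h \<times> 'u \<times> 'h \<Rightarrow>\<^sub>0 'k)"
  let ?Y = "fext (\<lambda>(x, v, z). fscale (\<epsilon> x) (gen (1, v, z))) \<phi>m :: ('h \<times> 'u \<times> 'h \<Rightarrow>\<^sub>0 'k)"
  have ro_hom: "alg_hom (RH \<boxtimes> RU) RHUH (split_snd ro)"
    by (rule hom_split_snd[OF \<rho>_hom])
  note counit_\<phi>l = axiom_counits(2)
  have b: "tcoset RHUH (fext ?g (fext (split2 la) \<phi>m)) = tcoset RHUH \<phi>m"
  proof -
    have "tcoset RHUH (fext (\<lambda>(m, v0). fscale (\<epsilon> m) (gen (x, v0, z))) (la v)) = tcoset RHUH (gen (x, v, z))" for x v z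
      by (rule coaction_counit(4)) (intro descends_gen_intros)
    then have "tcoset RHUH (fext (\<lambda>(x, v, z). fext (\<lambda>(m, v0). fscale (\<epsilon> m) (gen (x, v0, z))) (la v)) \<phi>m) =
      tcoset RHUH (fext gen \<phi>m)"
      by (intro tcoset_fext_cong) (simp add: case_prod_unfold)
    then show ?thesis by (simp add: fext_fext fext_fscale case_prod_unfold split2_def)
  qed
  have c: "tcoset RHUH (fext ?g (fext pad_right \<phi>l)) = tcoset RHUH (gen 1)"
  proof -
    have "descends (RH \<boxtimes> RU) RHUH (\<lambda>(x, u). gen (x, u, 1))"
      unfolding descends_tensor_iff case_prod_conv by (intro allI conjI descends_gen_intros)
    from tcoset_fext[OF this counit_\<phi>l] show ?thesis
      by (simp add: fext_fext fext_fscale case_prod_unfold pad_right_def one_prod_def)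
  qed
  have d: "tcoset RHUH (fext ?g (fext (split3 ro) \<phi>l)) = tcoset RHUH (gen 1)"
  proof -
    have "fext ?g (fext (split3 ro) \<phi>l) =
        fext (split_snd ro) (fext (\<lambda>(x, y, u). fscale (\<epsilon> y) (gen (x, u))) \<phi>l)"
      by (simp add: fext_fext fext_fscale fext_fscale_fun case_prod_unfold split3_def split_snd_def)
    then show ?thesis
      using tcoset_fext[OF alg_hom_descends[OF ro_hom] counit_\<phi>l] alg_hom_one[OF ro_hom] by simp
  qed
  have e: "tcoset RHUH (fext ?g (fext (split1 \<delta>) \<phi>m)) = tcoset RHUH \<phi>m"
  proof -
    have "tcoset RHUH (fext (\<lambda>(x1, x2). fscale (\<epsilon> x2) (gen (x1, v, z))) (\<delta> x)) = tcoset RHUH (gen (x, v, z))" for x v z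
      by (rule coaction_counit(1)) (intro descends_gen_intros)
    then have "tcoset RHUH (fext (\<lambda>(x, v, z). fext (\<lambda>(x1, x2). fscale (\<epsilon> x2) (gen (x1, v, z))) (\<delta> x)) \<phi>m) =
      tcoset RHUH (fext gen \<phi>m)"
      by (intro tcoset_fext_cong) (simp only: split_paired_all case_prod_conv)
    then show ?thesis by (simp add: fext_fext fext_fscale case_prod_unfold split1_def)
  qed
  have a: "fext ?g (fext pad_left \<phi>m) = ?Y"
    by (simp add: fext_fext fext_fscale case_prod_unfold pad_left_def)
  note h = alg_hom_mult[OF hom_counit_2]
  have "tcoset RHUH (?Y \<star> \<phi>m) =
      tcoset RHUH (fext ?g (fext pad_left \<phi>m) \<star> fext ?g (fext (split2 la) \<phi>m))"
    unfolding a by (intro tcoset_fmul[OF mult_rel_HUH] refl b[symmetric])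
  also have "\<dots> = tcoset RHUH (fext ?g (fext pad_left \<phi>m \<star> fext (split2 la) \<phi>m) \<star> fext ?g (fext pad_right \<phi>l))"
    unfolding mult_rel_one_right[OF mult_rel_HUH c] by (rule h[symmetric])
  also have "\<dots> = tcoset RHUH (fext ?g (fext pad_left \<phi>m \<star> fext (split2 la) \<phi>m \<star> fext pad_right \<phi>l))"
    by (rule h[symmetric])
  also have "\<dots> = tcoset RHUH (fext ?g (fext (split3 ro) \<phi>l \<star> fext (split1 \<delta>) \<phi>m))"
    by (rule tcoset_fext[OF alg_hom_descends[OF hom_counit_2] mixed_pentagon_left_eq])
  also have "\<dots> = tcoset RHUH (fext ?g (fext (split3 ro) \<phi>l) \<star> fext ?g (fext (split1 \<delta>) \<phi>m))"
    by (rule h)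
  also have "\<dots> = tcoset RHUH \<phi>m"
    using mult_rel_one_left[OF mult_rel_HUH d] e by simp
  finally have "tcoset RHUH ?Y = tcoset RHUH (\<phi>m \<star> \<phi>m')"
    by (simp only: fmul_cancel_right[OF mult_rel_HUH inverses_sym[OF axiom_inverses(4)]])
  then show ?thesis using axiom_inverses(4) by (simp add: inverses_def)
qed

subsection \<open>The multiplication on pure tensors\<close>

abbreviation "RA \<equiv> vrel sA"
abbreviation "RB \<equiv> vrel sB"
abbreviation "RAUB \<equiv> RA \<boxtimes> RU \<boxtimes> RB"
abbreviation "R5 \<equiv> RH \<boxtimes> RH \<boxtimes> RU \<boxtimes> RH \<boxtimes> RH"
abbreviation "R7 \<equiv> RH \<boxtimes> RH \<boxtimes> RH \<boxtimes> RU \<boxtimes> RH \<boxtimes> RH \<boxtimes> RH"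

text \<open>\<open>Q u u'\<close> collects the coefficients of a product \<open>(a \<otimes> u \<otimes> b) (a' \<otimes> u' \<otimes> b')\<close> that act on
  \<open>a\<close>, \<open>a'\<close>, the middle factor, \<open>b\<close> and \<open>b'\<close>.\<close>

definition Q :: "'u \<Rightarrow> 'u \<Rightarrow> ('h \<times> 'h \<times> 'u \<times> 'h \<times> 'h \<Rightarrow>\<^sub>0 'k)" where
  "Q u u' = fext (\<lambda>(x, y, w). gen (x, y, w, 1, 1)) \<phi>l' \<star> fext (\<lambda>(x, w). gen (1, x, w, 1, 1)) (la u) \<star>
    fext (\<lambda>(x, w, y). gen (1, x, w, y, 1)) \<phi>m' \<star> fext (\<lambda>(w, y). gen (1, 1, w, y, 1)) (ro u') \<star>
    fext (\<lambda>(w, y, z). gen (1, 1, w, y, z)) \<phi>r'"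

definition ev2 :: "'a \<Rightarrow> 'a \<Rightarrow> 'b \<Rightarrow> 'b \<Rightarrow> 'h \<times> 'h \<times> 'u \<times> 'h \<times> 'h \<Rightarrow> ('a \<times> 'u \<times> 'b \<Rightarrow>\<^sub>0 'k)" where
  "ev2 a a' b b' = (\<lambda>(h1, h2, w, k1, k2). gen (mA (actA h1 a) (actA h2 a'), w, mB (actB b k1) (actB b' k2)))"

definition ev3 :: "'a \<Rightarrow> 'a \<Rightarrow> 'a \<Rightarrow> 'b \<Rightarrow> 'b \<Rightarrow> 'b \<Rightarrow> 'h \<times> 'h \<times> 'h \<times> 'u \<times> 'h \<times> 'h \<times> 'h \<Rightarrow>
    ('a \<times> 'u \<times> 'b \<Rightarrow>\<^sub>0 'k)" where
  "ev3 a a' a'' b b' b'' = (\<lambda>(h1, h2, h3, w, k1, k2, k3).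
    gen (mA (actA h1 a) (mA (actA h2 a') (actA h3 a'')), w,
      mB (actB b k1) (mB (actB b' k2) (actB b'' k3))))"

abbreviation "F \<equiv> two_sided_formula mA actA mB actB lam \<Phi>l' \<rho> \<Phi>\<rho>' \<Phi>l\<rho>'"

text \<open>The five nested sums contribute to each leg in one and the same order, so they combine
  into a product of five tensors, each padded with 1 where it does not contribute.\<close>

lemma F_eq: "F (a, u, b) (a', u', b') = fext (ev2 a a' b b') (Q u u')"
  by (simp add: two_sided_formula_def Q_def ev2_def sweedler_def fmul_fext_left fmul_gen_fext
      fext_fext case_prod_unfold times_prod_def mult.assoc)

lemma descends_gen_bilinear:
  assumes "bilinear_map s1 s2 s3 f"
  shows "descends V (vrel s1) (\<lambda>x. gen (g x)) \<Longrightarrow> descends V (vrel s3) (\<lambda>x. gen (f (g x) c))"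
    and "descends V (vrel s2) (\<lambda>x. gen (h x)) \<Longrightarrow> descends V (vrel s3) (\<lambda>x. gen (f d (h x)))"
proof -
  have "Vector_Spaces.linear s1 s3 (\<lambda>x. f x c)" and "Vector_Spaces.linear s2 s3 (f d)"
    using assms by (simp_all add: bilinear_map_def)
  then have 1: "descends (vrel s1) (vrel s3) (\<lambda>x. gen (f x c))"
    and 2: "descends (vrel s2) (vrel s3) (\<lambda>x. gen (f d x))"
    by - (rule descends_linear, assumption)+
  show "descends V (vrel s1) (\<lambda>x. gen (g x)) \<Longrightarrow> descends V (vrel s3) (\<lambda>x. gen (f (g x) c))"
    using descends_comp[OF 1, of V "\<lambda>x. gen (g x)"] by simp
  show "descends V (vrel s2) (\<lambda>x. gen (h x)) \<Longrightarrow> descends V (vrel s3) (\<lambda>x. gen (f d (h x)))"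
    using descends_comp[OF 2, of V "\<lambda>x. gen (h x)"] by simp
qed

lemmas descends_action_intros =
  descends_gen_bilinear[OF A.act_bilinear] descends_gen_bilinear[OF A.mult_bilinear]
  descends_gen_bilinear[OF B.act_bilinear] descends_gen_bilinear[OF B.mult_bilinear]
  descends_gen_intros

lemma descends_ev2: "descends R5 RAUB (ev2 a a' b b')"
  unfolding ev2_def descends_tensor_iff case_prod_unfold fst_conv snd_conv
  by (intro allI conjI descends_action_intros)

lemma descends_ev3: "descends R7 RAUB (ev3 a a' a'' b b' b'')"
  unfolding ev3_def descends_tensor_iff case_prod_unfold fst_conv snd_conv
  by (intro allI conjI descends_action_intros)

lemma mult_rel_5: "mult_rel R5" and mult_rel_7: "mult_rel R7"
  by (intro mult_rels)+

lemma descends_Q_left: "descends RU R5 (\<lambda>u. Q u u')"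
proof -
  have "descends (RH \<boxtimes> RU) R5 (\<lambda>(x, w). gen (1, x, w, 1, 1))"
    unfolding descends_tensor_iff case_prod_conv by (intro allI conjI descends_gen_intros)
  from descends_comp[OF this alg_hom_descends[OF lam_hom]] show ?thesis
    unfolding Q_def
    by (intro descends_fmul_left[OF mult_rel_5] descends_fmul_right[OF mult_rel_5])
qed

lemma descends_Q_right: "descends RU R5 (\<lambda>u'. Q u u')"
proof -
  have "descends (RU \<boxtimes> RH) R5 (\<lambda>(w, y). gen (1, 1, w, y, 1))"
    unfolding descends_tensor_iff case_prod_conv by (intro allI conjI descends_gen_intros)
  from descends_comp[OF this alg_hom_descends[OF \<rho>_hom]] show ?thesis
    unfolding Q_def
    by (intro descends_fmul_left[OF mult_rel_5] descends_fmul_right[OF mult_rel_5])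
qed

lemma F_pair: "F p q = fext (ev2 (fst p) (fst q) (snd (snd p)) (snd (snd q))) (Q (fst (snd p)) (fst (snd q)))"
  by (cases p, cases q) (simp add: F_eq)

text \<open>The middle component enters only through \<open>Q\<close>, the outer components only
  through \<open>ev2\<close>; the two kinds of legs are treated separately.\<close>

lemma descends_F_left: "descends RAUB RAUB (\<lambda>p. F p q)"
  unfolding descends_tensor_iff F_pair fst_conv snd_conv
proof (intro allI conjI)
  show "descends RU RAUB (\<lambda>u. fext (ev2 a a' b b') (Q u u'))" for a a' b b' u'
    by (rule descends_comp[OF descends_ev2 descends_Q_left])
qed (unfold ev2_def case_prod_unfold, (rule descends_fext_param, intro descends_action_intros)+)

lemma descends_F_right: "descends RAUB RAUB (F p)"
  unfolding descends_tensor_iff F_pair fst_conv snd_conv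
proof (intro allI conjI)
  show "descends RU RAUB (\<lambda>u'. fext (ev2 a a' b b') (Q u u'))" for a a' b b' u
    by (rule descends_comp[OF descends_ev2 descends_Q_right])
qed (unfold ev2_def case_prod_unfold, (rule descends_fext_param, intro descends_action_intros)+)

subsection \<open>Units\<close>

text \<open>H acts on \<open>eA\<close> and \<open>eB\<close> through \<epsilon>. With the unit as
  first factor of a product, the coefficients \<open>h1\<close> and \<open>k1\<close> that act on it
  become scalars.\<close>

lemma hom_counit_unit_left:
  "alg_hom R5 RHUH (\<lambda>(h1, h2, w, k1, k2). fscale (\<epsilon> h1 * \<epsilon> k1) (gen (h2, w, k2)))"
  unfolding case_prod_unfold
  by (rule alg_hom_scaled)
    (unfold descends_tensor_iff fst_conv snd_conv, intro allI conjI descends_scaled_intros,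
      simp_all add: times_prod_def one_prod_def counit_mult counit_one)

lemma hom_counit_unit_right:
  "alg_hom R5 RHUH (\<lambda>(h1, h2, w, k1, k2). fscale (\<epsilon> h2 * \<epsilon> k2) (gen (h1, w, k1)))"
  unfolding case_prod_unfold
  by (rule alg_hom_scaled)
    (unfold descends_tensor_iff fst_conv snd_conv, intro allI conjI descends_scaled_intros,
      simp_all add: times_prod_def one_prod_def counit_mult counit_one)

lemma hom_Q_leg1: "alg_hom (RH \<boxtimes> RH \<boxtimes> RU) R5 (\<lambda>(x, y, w). gen (x, y, w, 1, 1))"
  and hom_Q_leg2: "alg_hom (RH \<boxtimes> RU) R5 (\<lambda>(x, w). gen (1, x, w, 1, 1))"
  and hom_Q_leg3: "alg_hom RHUH R5 (\<lambda>(x, w, y). gen (1, x, w, y, 1))"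
  and hom_Q_leg4: "alg_hom (RU \<boxtimes> RH) R5 (\<lambda>(w, y). gen (1, 1, w, y, 1))"
  and hom_Q_leg5: "alg_hom (RU \<boxtimes> RH \<boxtimes> RH) R5 (\<lambda>(w, y, z). gen (1, 1, w, y, z))"
  unfolding case_prod_unfold
  by (rule alg_hom_gen, unfold descends_tensor_iff fst_conv snd_conv, intro allI conjI descends_gen_intros,
      simp_all add: times_prod_def one_prod_def)+

lemma descends_HUH: "descends (RH \<boxtimes> RU) RHUH (\<lambda>(y, u). gen (y, u, 1))" "descends (RU \<boxtimes> RH) RHUH (\<lambda>p. gen (1, p))"
  unfolding descends_tensor_iff case_prod_conv by (intro allI conjI descends_gen_intros)+

lemma tcoset_gen_scale: "tcoset RAUB (gen (sA c a, w, sB d b)) = tcoset RAUB (fscale (c * d) (gen (a, w, b)))"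
proof -
  have "descends RA RAUB (\<lambda>a. gen (a, w, sB d b))" and "descends RB RAUB (\<lambda>b. gen (a, w, b))"
    by (intro descends_gen_intros)+
  then have "tcoset RAUB (gen (sA c a, w, sB d b)) = tcoset RAUB (fscale c (gen (a, w, sB d b)))"
    and "tcoset RAUB (gen (a, w, sB d b)) = tcoset RAUB (fscale d (gen (a, w, b)))"
    by (simp_all add: descends_vrel_iff)
  from this(1) tcoset_fscale_cong[OF this(2), of c] show ?thesis by simp
qed

lemmas scale_mA = bilinear_map_scale[OF A.mult_bilinear]
lemmas scale_mB = bilinear_map_scale[OF B.mult_bilinear]

definition ev1 :: "'a \<Rightarrow> 'b \<Rightarrow> 'h \<times> 'u \<times> 'h \<Rightarrow> ('a \<times> 'u \<times> 'b \<Rightarrow>\<^sub>0 'k)" where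
  "ev1 a b = (\<lambda>(h, w, k). gen (actA h a, w, actB b k))"

lemma descends_ev1: "descends RHUH RAUB (ev1 a b)"
  unfolding ev1_def descends_tensor_iff case_prod_unfold fst_conv snd_conv
  by (intro allI conjI descends_action_intros)

text \<open>The map \<open>E\<close> sends the inverse reassociators and \<open>la 1\<close> to 1,
  while the factor \<open>ro u\<close> becomes u in the middle leg. What is left acts trivially on a
  and b.\<close>

lemma F_unit_left: "tcoset RAUB (F (eA, 1, eB) q) = tcoset RAUB (gen q)"
proof -
  obtain a u b where q: "q = (a, u, b)" by (cases q) auto
  define E where "E = (\<lambda>(h1, h2, w, k1, k2). fscale (\<epsilon> h1 * \<epsilon> k1) (gen (h2, w, k2)) :: ('h \<times> 'u \<times> 'h \<Rightarrow>\<^sub>0 'k))"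
  have E: "alg_hom R5 RHUH E" unfolding E_def by (rule hom_counit_unit_left)
  note inverse_one = alg_hom_inverse_one[OF mult_rel_HUH alg_hom_comp[OF _ E]]
  have "tcoset RAUB (F (eA, 1, eB) q) = tcoset RAUB (fext (\<lambda>t. fext (ev1 a b) (E t)) (Q 1 u))"
    unfolding q F_eq
    by (intro tcoset_fext_cong)
      (simp add: split_paired_all ev2_def ev1_def E_def A.act_unit B.act_unit scale_mA scale_mB
        A.unit_left B.unit_left tcoset_gen_scale fext_fscale)
  also have "\<dots> = tcoset RAUB (fext (ev1 a b) (fext E (Q 1 u)))"
    by (simp add: fext_fext)
  also have "\<dots> = tcoset RAUB (fext (ev1 a b) (gen 1 \<star> gen 1 \<star> gen 1 \<star> gen (1, u, 1) \<star> gen 1))"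
  proof (rule tcoset_fext[OF descends_ev1])
    have 1: "tcoset RHUH (fext E (fext (\<lambda>(x, y, w). gen (x, y, w, 1, 1)) \<phi>l')) = tcoset RHUH (gen 1)"
      unfolding fext_fext
    proof (rule inverse_one[OF hom_Q_leg1 axiom_inverses(2)])
      show "tcoset RHUH (fext (\<lambda>t. fext E (case t of (x, y, w) \<Rightarrow> gen (x, y, w, 1, 1))) \<phi>l) = tcoset RHUH (gen 1)"
        using tcoset_fext[OF descends_HUH(1) axiom_counits(1)]
        by (simp add: E_def case_prod_unfold fext_fext fext_fscale counit_one one_prod_def)
    qed
    have 2: "tcoset RHUH (fext E (fext (\<lambda>(x, w). gen (1, x, w, 1, 1)) (la 1))) = tcoset RHUH (gen 1)"
      using alg_hom_one[OF alg_hom_comp[OF lam_hom alg_hom_comp[OF hom_Q_leg2 E]]] by (simp add: fext_fext)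
    \<comment> \<open>It is the third leg of the mixed tensor that acts on \<open>eB\<close>, hence
      the normalization by \<epsilon> in that leg.\<close>
    have 3: "tcoset RHUH (fext E (fext (\<lambda>(x, w, y). gen (1, x, w, y, 1)) \<phi>m')) = tcoset RHUH (gen 1)"
      unfolding fext_fext
    proof (rule inverse_one[OF hom_Q_leg3 axiom_inverses(4)])
      show "tcoset RHUH (fext (\<lambda>t. fext E (case t of (x, w, y) \<Rightarrow> gen (1, x, w, y, 1))) \<phi>m) = tcoset RHUH (gen 1)"
        using mixed_counit_right by (simp add: E_def case_prod_unfold counit_one)
    qed
    have 4: "tcoset RHUH (fext E (fext (\<lambda>(w, y). gen (1, 1, w, y, 1)) (ro u))) = tcoset RHUH (gen (1, u, 1))"
    proof -
      have "descends RU RHUH (\<lambda>u. gen (1, u, 1))" by (intro descends_gen_intros)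
      from coaction_counit(3)[OF this, of u] show ?thesis
        by (simp add: E_def case_prod_unfold counit_one fext_fext)
    qed
    have 5: "tcoset RHUH (fext E (fext (\<lambda>(w, y, z). gen (1, 1, w, y, z)) \<phi>r')) = tcoset RHUH (gen 1)"
      unfolding fext_fext
    proof (rule inverse_one[OF hom_Q_leg5 axiom_inverses(3)])
      show "tcoset RHUH (fext (\<lambda>t. fext E (case t of (w, y, z) \<Rightarrow> gen (1, 1, w, y, z))) \<phi>r) = tcoset RHUH (gen 1)"
        using tcoset_fext[OF descends_HUH(2) axiom_counits(3)]
        by (simp add: E_def case_prod_unfold fext_fext fext_fscale counit_one one_prod_def)
    qed
    show "tcoset RHUH (fext E (Q 1 u)) = tcoset RHUH (gen 1 \<star> gen 1 \<star> gen 1 \<star> gen (1, u, 1) \<star> gen 1)"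
      unfolding Q_def alg_hom_mult5[OF E mult_rel_HUH]
      by (rule tcoset_fmul5[OF mult_rel_HUH 1 2 3 4 5])
  qed
  also have "\<dots> = tcoset RAUB (gen q)"
    by (simp del: fmul_gen add: q ev1_def A.act_one B.act_one)
  finally show ?thesis .
qed

text \<open>Mirror image of \<open>F_unit_left\<close>: now \<open>ro 1\<close> becomes 1, and u
  comes from \<open>la u\<close>.\<close>

lemma F_unit_right: "tcoset RAUB (F q (eA, 1, eB)) = tcoset RAUB (gen q)"
proof -
  obtain a u b where q: "q = (a, u, b)" by (cases q) auto
  define E where "E = (\<lambda>(h1, h2, w, k1, k2). fscale (\<epsilon> h2 * \<epsilon> k2) (gen (h1, w, k1)) :: ('h \<times> 'u \<times> 'h \<Rightarrow>\<^sub>0 'k))"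
  have E: "alg_hom R5 RHUH E" unfolding E_def by (rule hom_counit_unit_right)
  note inverse_one = alg_hom_inverse_one[OF mult_rel_HUH alg_hom_comp[OF _ E]]
  have "tcoset RAUB (F q (eA, 1, eB)) = tcoset RAUB (fext (\<lambda>t. fext (ev1 a b) (E t)) (Q u 1))"
    unfolding q F_eq
    by (intro tcoset_fext_cong)
      (simp add: split_paired_all ev2_def ev1_def E_def A.act_unit B.act_unit scale_mA scale_mB
        A.unit_right B.unit_right tcoset_gen_scale fext_fscale)
  also have "\<dots> = tcoset RAUB (fext (ev1 a b) (fext E (Q u 1)))"
    by (simp add: fext_fext)
  also have "\<dots> = tcoset RAUB (fext (ev1 a b) (gen 1 \<star> gen (1, u, 1) \<star> gen 1 \<star> gen 1 \<star> gen 1))"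
  proof (rule tcoset_fext[OF descends_ev1])
    have 1: "tcoset RHUH (fext E (fext (\<lambda>(x, y, w). gen (x, y, w, 1, 1)) \<phi>l')) = tcoset RHUH (gen 1)"
      unfolding fext_fext
    proof (rule inverse_one[OF hom_Q_leg1 axiom_inverses(2)])
      show "tcoset RHUH (fext (\<lambda>t. fext E (case t of (x, y, w) \<Rightarrow> gen (x, y, w, 1, 1))) \<phi>l) = tcoset RHUH (gen 1)"
        using tcoset_fext[OF descends_HUH(1) axiom_counits(2)]
        by (simp add: E_def case_prod_unfold fext_fext fext_fscale counit_one one_prod_def)
    qed
    have 2: "tcoset RHUH (fext E (fext (\<lambda>(x, w). gen (1, x, w, 1, 1)) (la u))) = tcoset RHUH (gen (1, u, 1))"
    proof -
      have "descends RU RHUH (\<lambda>u. gen (1, u, 1))" by (intro descends_gen_intros)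
      from coaction_counit(4)[OF this, of u] show ?thesis
        by (simp add: E_def case_prod_unfold counit_one fext_fext)
    qed
    have 3: "tcoset RHUH (fext E (fext (\<lambda>(x, w, y). gen (1, x, w, y, 1)) \<phi>m')) = tcoset RHUH (gen 1)"
      unfolding fext_fext
    proof (rule inverse_one[OF hom_Q_leg3 axiom_inverses(4)])
      show "tcoset RHUH (fext (\<lambda>t. fext E (case t of (x, w, y) \<Rightarrow> gen (1, x, w, y, 1))) \<phi>m) = tcoset RHUH (gen 1)"
        using mixed_counit_left by (simp add: E_def case_prod_unfold counit_one)
    qed
    have 4: "tcoset RHUH (fext E (fext (\<lambda>(w, y). gen (1, 1, w, y, 1)) (ro 1))) = tcoset RHUH (gen 1)"
      using alg_hom_one[OF alg_hom_comp[OF \<rho>_hom alg_hom_comp[OF hom_Q_leg4 E]]] by (simp add: fext_fext)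
    have 5: "tcoset RHUH (fext E (fext (\<lambda>(w, y, z). gen (1, 1, w, y, z)) \<phi>r')) = tcoset RHUH (gen 1)"
      unfolding fext_fext
    proof (rule inverse_one[OF hom_Q_leg5 axiom_inverses(3)])
      show "tcoset RHUH (fext (\<lambda>t. fext E (case t of (w, y, z) \<Rightarrow> gen (1, 1, w, y, z))) \<phi>r) = tcoset RHUH (gen 1)"
        using tcoset_fext[OF descends_HUH(2) axiom_counits(4)]
        by (simp add: E_def case_prod_unfold fext_fext fext_fscale counit_one one_prod_def)
    qed
    show "tcoset RHUH (fext E (Q u 1)) = tcoset RHUH (gen 1 \<star> gen (1, u, 1) \<star> gen 1 \<star> gen 1 \<star> gen 1)"
      unfolding Q_def alg_hom_mult5[OF E mult_rel_HUH]
      by (rule tcoset_fmul5[OF mult_rel_HUH 1 2 3 4 5])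
  qed
  also have "\<dots> = tcoset RAUB (gen q)"
    by (simp del: fmul_gen add: q ev1_def A.act_one B.act_one)
  finally show ?thesis .
qed

subsection \<open>Associativity\<close>

text \<open>The index of \<open>leg\<close>\<open>i\<close> is the position of the first of four legs. \<open>leg\<close>\<open>ij\<close> embeds the three legs common to
  \<open>leg\<close>\<open>i\<close> and \<open>leg\<close>\<open>j\<close>.\<close>

definition leg1 :: "'h \<times> 'h \<times> 'h \<times> 'u \<Rightarrow> ('h \<times> 'h \<times> 'h \<times> 'u \<times> 'h \<times> 'h \<times> 'h \<Rightarrow>\<^sub>0 'k)" where
  "leg1 = (\<lambda>(x, y, z, w). gen (x, y, z, w, 1, 1, 1))"
definition leg2 :: "'h \<times> 'h \<times> 'u \<times> 'h \<Rightarrow> ('h \<times> 'h \<times> 'h \<times> 'u \<times> 'h \<times> 'h \<times> 'h \<Rightarrow>\<^sub>0 'k)" where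
  "leg2 = (\<lambda>(x, y, w, z). gen (1, x, y, w, z, 1, 1))"
definition leg3 :: "'h \<times> 'u \<times> 'h \<times> 'h \<Rightarrow> ('h \<times> 'h \<times> 'h \<times> 'u \<times> 'h \<times> 'h \<times> 'h \<Rightarrow>\<^sub>0 'k)" where
  "leg3 = (\<lambda>(x, w, y, z). gen (1, 1, x, w, y, z, 1))"
definition leg4 :: "'u \<times> 'h \<times> 'h \<times> 'h \<Rightarrow> ('h \<times> 'h \<times> 'h \<times> 'u \<times> 'h \<times> 'h \<times> 'h \<Rightarrow>\<^sub>0 'k)" where
  "leg4 = (\<lambda>(w, x, y, z). gen (1, 1, 1, w, x, y, z))"
definition leg12 :: "'h \<times> 'h \<times> 'u \<Rightarrow> ('h \<times> 'h \<times> 'h \<times> 'u \<times> 'h \<times> 'h \<times> 'h \<Rightarrow>\<^sub>0 'k)" where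
  "leg12 = (\<lambda>(x, y, w). gen (1, x, y, w, 1, 1, 1))"
definition leg23 :: "'h \<times> 'u \<times> 'h \<Rightarrow> ('h \<times> 'h \<times> 'h \<times> 'u \<times> 'h \<times> 'h \<times> 'h \<Rightarrow>\<^sub>0 'k)" where
  "leg23 = (\<lambda>(x, w, y). gen (1, 1, x, w, y, 1, 1))"
definition leg34 :: "'u \<times> 'h \<times> 'h \<Rightarrow> ('h \<times> 'h \<times> 'h \<times> 'u \<times> 'h \<times> 'h \<times> 'h \<Rightarrow>\<^sub>0 'k)" where
  "leg34 = (\<lambda>(w, x, y). gen (1, 1, 1, w, x, y, 1))"

lemmas leg7_defs = leg1_def leg2_def leg3_def leg4_def leg12_def leg23_def leg34_def

section \<open>The identity in seven legs\<close>

lemma hom_legs: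
  "alg_hom (RH \<boxtimes> RH \<boxtimes> RH \<boxtimes> RU) R7 leg1" "alg_hom (RH \<boxtimes> RH \<boxtimes> RU \<boxtimes> RH) R7 leg2"
  "alg_hom (RH \<boxtimes> RU \<boxtimes> RH \<boxtimes> RH) R7 leg3" "alg_hom (RU \<boxtimes> RH \<boxtimes> RH \<boxtimes> RH) R7 leg4"
  "alg_hom (RH \<boxtimes> RH \<boxtimes> RU) R7 leg12" "alg_hom (RH \<boxtimes> RU \<boxtimes> RH) R7 leg23"
  "alg_hom (RU \<boxtimes> RH \<boxtimes> RH) R7 leg34"
  unfolding leg7_defs case_prod_unfold
  by (rule alg_hom_gen, unfold descends_tensor_iff fst_conv snd_conv, intro allI conjI descends_gen_intros,
      simp_all add: times_prod_def one_prod_def)+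

text \<open>Consecutive windows share three legs. A tensor on these is padded on the left in the
  earlier window and on the right in the later one, which is how the output of one pentagon becomes
  the input of the next.\<close>

lemma leg_overlaps:
  "fext leg1 (fext pad_left v) = fext leg12 v" "fext leg2 (fext pad_right v) = fext leg12 v"
  "fext leg2 (fext pad_left v') = fext leg23 v'" "fext leg3 (fext pad_right v') = fext leg23 v'"
  "fext leg3 (fext pad_left v'') = fext leg34 v''" "fext leg4 (fext pad_right v'') = fext leg34 v''"
  by (simp_all add: fext_fext leg7_defs pad_left_def pad_right_def case_prod_unfold)

text \<open>On cosets the congruences become equations, so that the long products can be treated by
  plain rewriting.\<close>

abbreviation cl7 (\<open>\<langle>_\<rangle>\<close>) where "\<langle>v\<rangle> \<equiv> tcoset R7 v"
abbreviation mul7 (infixr \<open>\<diamondop>\<close> 70) where "S \<diamondop> T \<equiv> tmul R7 S T"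

lemma cl7_fmul: "\<langle>v \<star> w\<rangle> = \<langle>v\<rangle> \<diamondop> \<langle>w\<rangle>"
  by (rule tmul_tcoset[OF mult_rel_7, symmetric])

lemma cl7_hom: "alg_hom R R7 f \<Longrightarrow> \<langle>fext f (v \<star> w)\<rangle> = \<langle>fext f v\<rangle> \<diamondop> \<langle>fext f w\<rangle>"
  unfolding cl7_fmul[symmetric] by (rule alg_hom_mult)

lemma cl7_assoc: "(S \<diamondop> T) \<diamondop> U = S \<diamondop> (T \<diamondop> U)"
  by (rule tmul_assoc[OF mult_rel_7])

text \<open>One tensor travels through the windows. The left pentagon absorbs \<Phi> and releases
  \<open>\<phi>l'\<close>, which passes the coaction of u; the left mixed pentagon exchanges it for
  \<open>\<phi>m\<close>, which passes the coactions of the second middle factor; the right mixed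
  pentagon exchanges that for \<open>\<phi>r'\<close>, which passes the coaction of the third; the
  right pentagon absorbs it together with \<open>\<phi>'\<close>. Each left side starts with the
  incoming tensor and each right side ends with the outgoing one, except that nothing goes out of
  the last.\<close>

lemma seven_leg_rewrites:
  "\<langle>fext leg1 (fext pad_right \<phi>)\<rangle> \<diamondop> \<langle>fext leg1 (fext (split1 \<delta>) \<phi>l')\<rangle> \<diamondop> \<langle>fext leg1 (fext (split3 la) \<phi>l')\<rangle> =
   \<langle>fext leg1 (fext (split2 \<delta>) \<phi>l')\<rangle> \<diamondop> \<langle>fext leg12 \<phi>l'\<rangle>"
  "\<langle>fext leg12 \<phi>l'\<rangle> \<diamondop> \<langle>fext leg12 (fext (split_snd la) (la u))\<rangle> =
   \<langle>fext leg12 (fext (split_fst \<delta>) (la u))\<rangle> \<diamondop> \<langle>fext leg12 \<phi>l'\<rangle>"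
  "\<langle>fext leg12 \<phi>l'\<rangle> \<diamondop> \<langle>fext leg2 (fext (split2 la) \<phi>m')\<rangle> =
   \<langle>fext leg2 (fext (split1 \<delta>) \<phi>m')\<rangle> \<diamondop> \<langle>fext leg2 (fext (split3 ro) \<phi>l')\<rangle> \<diamondop> \<langle>fext leg23 \<phi>m\<rangle>"
  "\<langle>fext leg23 \<phi>m\<rangle> \<diamondop> \<langle>fext leg23 (fext (split_fst la) (ro u))\<rangle> =
   \<langle>fext leg23 (fext (split_snd ro) (la u))\<rangle> \<diamondop> \<langle>fext leg23 \<phi>m\<rangle>"
  "\<langle>fext leg23 \<phi>m\<rangle> \<diamondop> \<langle>fext leg3 (fext (split1 la) \<phi>r')\<rangle> \<diamondop> \<langle>fext leg3 (fext (split3 \<delta>) \<phi>m')\<rangle> =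
   \<langle>fext leg3 (fext (split2 ro) \<phi>m')\<rangle> \<diamondop> \<langle>fext leg34 \<phi>r'\<rangle>"
  "\<langle>fext leg34 \<phi>r'\<rangle> \<diamondop> \<langle>fext leg34 (fext (split_snd \<delta>) (ro u))\<rangle> =
   \<langle>fext leg34 (fext (split_fst ro) (ro u))\<rangle> \<diamondop> \<langle>fext leg34 \<phi>r'\<rangle>"
  "\<langle>fext leg34 \<phi>r'\<rangle> \<diamondop> \<langle>fext leg4 (fext (split2 \<delta>) \<phi>r')\<rangle> \<diamondop> \<langle>fext leg4 (fext pad_left \<phi>')\<rangle> =
   \<langle>fext leg4 (fext (split1 ro) \<phi>r')\<rangle> \<diamondop> \<langle>fext leg4 (fext (split3 \<delta>) \<phi>r')\<rangle>"
  subgoal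
    using tcoset_fext[OF alg_hom_descends[OF hom_legs(1)] left_pentagon_inverse]
    unfolding cl7_hom[OF hom_legs(1)] leg_overlaps cl7_assoc .
  subgoal
    using tcoset_fext[OF alg_hom_descends[OF hom_legs(5)] left_coassociative_inverse[of u]]
    unfolding cl7_hom[OF hom_legs(5)] leg_overlaps cl7_assoc .
  subgoal
    using tcoset_fext[OF alg_hom_descends[OF hom_legs(2)] mixed_pentagon_left_inverse]
    unfolding cl7_hom[OF hom_legs(2)] leg_overlaps cl7_assoc .
  subgoal
    using tcoset_fext[OF alg_hom_descends[OF hom_legs(6)] mixed_coassociative[of u]]
    unfolding cl7_hom[OF hom_legs(6)] leg_overlaps cl7_assoc .
  subgoal
    using tcoset_fext[OF alg_hom_descends[OF hom_legs(3)] mixed_pentagon_right_inverse]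
    unfolding cl7_hom[OF hom_legs(3)] leg_overlaps cl7_assoc .
  subgoal
    using tcoset_fext[OF alg_hom_descends[OF hom_legs(7)] right_coassociative_inverse[of u]]
    unfolding cl7_hom[OF hom_legs(7)] leg_overlaps cl7_assoc .
  subgoal
    using tcoset_fext[OF alg_hom_descends[OF hom_legs(4)] right_pentagon_inverse]
    unfolding cl7_hom[OF hom_legs(4)] leg_overlaps cl7_assoc .
  done

text \<open>The left side collects the coefficients of the product bracketed to the left, including
  the reassociators that rebracket A and B; the right side collects those of the product bracketed
  to the right.\<close>

lemma seven_leg_identity:
  "\<langle>fext leg1 (fext pad_right \<phi>)\<rangle> \<diamondop> \<langle>fext leg1 (fext (split1 \<delta>) \<phi>l')\<rangle> \<diamondop> \<langle>fext leg1 (fext (split3 la) \<phi>l')\<rangle> \<diamondop>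
   \<langle>fext leg12 (fext (split_snd la) (la u))\<rangle> \<diamondop> \<langle>fext leg2 (fext (split2 la) \<phi>m')\<rangle> \<diamondop>
   \<langle>fext leg23 (fext (split_fst la) (ro u'))\<rangle> \<diamondop> \<langle>fext leg3 (fext (split1 la) \<phi>r')\<rangle> \<diamondop>
   \<langle>fext leg3 (fext (split3 \<delta>) \<phi>m')\<rangle> \<diamondop> \<langle>fext leg34 (fext (split_snd \<delta>) (ro u''))\<rangle> \<diamondop>
   \<langle>fext leg4 (fext (split2 \<delta>) \<phi>r')\<rangle> \<diamondop> \<langle>fext leg4 (fext pad_left \<phi>')\<rangle> =
   \<langle>fext leg1 (fext (split2 \<delta>) \<phi>l')\<rangle> \<diamondop> \<langle>fext leg12 (fext (split_fst \<delta>) (la u))\<rangle> \<diamondop>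
   \<langle>fext leg2 (fext (split1 \<delta>) \<phi>m')\<rangle> \<diamondop> \<langle>fext leg2 (fext (split3 ro) \<phi>l')\<rangle> \<diamondop>
   \<langle>fext leg23 (fext (split_snd ro) (la u'))\<rangle> \<diamondop> \<langle>fext leg3 (fext (split2 ro) \<phi>m')\<rangle> \<diamondop>
   \<langle>fext leg34 (fext (split_fst ro) (ro u''))\<rangle> \<diamondop> \<langle>fext leg4 (fext (split1 ro) \<phi>r')\<rangle> \<diamondop>
   \<langle>fext leg4 (fext (split3 \<delta>) \<phi>r')\<rangle>"
proof -
  note r = seven_leg_rewrites[THEN tmul_rewrite[OF mult_rel_7], unfolded cl7_assoc]
  show ?thesis
    \<comment> \<open>The last pentagon reaches the end of the product, so it is also supplied in
      its form without a tail.\<close>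
    by (simp only: r seven_leg_rewrites(7))
qed

text \<open>\<open>D\<close> and \<open>D'\<close> come from the action of the coefficients of the outer product on an inner product in the
  first and second argument, respectively. \<open>Lam\<close> and \<open>Rho\<close> come from the coaction of the outer product
  on the middle factor of the inner one.\<close>

definition D :: "'h \<times> 'h \<times> 'u \<times> 'h \<times> 'h \<Rightarrow> ('h \<times> 'h \<times> 'h \<times> 'u \<times> 'h \<times> 'h \<times> 'h \<Rightarrow>\<^sub>0 'k)" where
  "D = (\<lambda>(x, y, w, k, l). fext (\<lambda>(p, q). fext (\<lambda>(r, s). gen (p, q, y, w, r, s, l)) (\<delta> k)) (\<delta> x))"

definition D' :: "'h \<times> 'h \<times> 'u \<times> 'h \<times> 'h \<Rightarrow> ('h \<times> 'h \<times> 'h \<times> 'u \<times> 'h \<times> 'h \<times> 'h \<Rightarrow>\<^sub>0 'k)" where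
  "D' = (\<lambda>(x, y, w, k, l). fext (\<lambda>(p, q). fext (\<lambda>(r, s). gen (x, p, q, w, k, r, s)) (\<delta> l)) (\<delta> y))"

definition Lam :: "'h \<times> 'h \<times> 'u \<times> 'h \<times> 'h \<Rightarrow> ('h \<times> 'h \<times> 'h \<times> 'u \<times> 'h \<times> 'h \<times> 'h \<Rightarrow>\<^sub>0 'k)" where
  "Lam = (\<lambda>(x, y, w, k, l). fext (\<lambda>(p, q). gen (x, y, p, q, k, l, 1)) (la w))"

definition Rho :: "'h \<times> 'h \<times> 'u \<times> 'h \<times> 'h \<Rightarrow> ('h \<times> 'h \<times> 'h \<times> 'u \<times> 'h \<times> 'h \<times> 'h \<Rightarrow>\<^sub>0 'k)" where
  "Rho = (\<lambda>(x, y, w, k, l). fext (\<lambda>(p, q). gen (1, x, y, p, q, k, l)) (ro w))"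

lemma hom_D: "alg_hom R5 R7 D"
  using alg_hom_split[OF alg_hom_cons[OF alg_hom_cons[OF hom_split_fst[OF \<delta>_hom, of RH], of RU], of RH] \<delta>_hom]
  by (simp add: D_def case_prod_unfold fext_fext split_fst_def)

lemma hom_D': "alg_hom R5 R7 D'"
  using alg_hom_cons[OF alg_hom_split[OF alg_hom_cons[OF hom_split_snd[OF \<delta>_hom, of RH], of RU] \<delta>_hom], of RH]
  by (simp add: D'_def case_prod_unfold fext_fext split_snd_def)

lemma hom_Lam: "alg_hom R5 R7 Lam"
proof -
  have "alg_hom (RH \<boxtimes> RH) (RH \<boxtimes> RH \<boxtimes> RH) (\<lambda>(x, y). gen (x, y, 1))"
    unfolding case_prod_unfold
    by (rule alg_hom_gen, unfold descends_tensor_iff fst_conv snd_conv, intro allI conjI descends_gen_intros,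
      simp_all add: times_prod_def one_prod_def)
  from alg_hom_cons[OF alg_hom_cons[OF alg_hom_split[OF this lam_hom], of RH], of RH]
  show ?thesis by (simp add: Lam_def case_prod_unfold fext_fext)
qed

lemma hom_Rho: "alg_hom R5 R7 Rho"
proof -
  have "alg_hom (RH \<boxtimes> RH \<boxtimes> RU \<boxtimes> RH \<boxtimes> RH \<boxtimes> RH) R7 (\<lambda>r. gen (1, r))"
    by (rule alg_hom_gen) (auto simp: times_prod_def one_prod_def intro: descends_pair_right)
  from alg_hom_comp[OF alg_hom_cons[OF alg_hom_cons[OF alg_hom_split[OF alg_hom_id \<rho>_hom], of RH], of RH] this]
  show ?thesis by (simp add: Rho_def case_prod_unfold fext_fext)
qed

text \<open>The representative of \<Delta> 1 need not be \<open>gen (1, 1)\<close>, so legs with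
  entry 1 that are split by \<open>D\<close> or \<open>D'\<close> can be simplified only modulo
  relations.\<close>

lemma \<delta>_one: "descends (RH \<boxtimes> RH) S k \<Longrightarrow> tcoset S (fext k (\<delta> 1)) = tcoset S (k (1, 1))"
  using tcoset_fext[OF _ alg_hom_one[OF \<delta>_hom], of S k] by (simp add: one_prod_def)

lemma D_one_right: "\<langle>D (x, y, w, 1, l)\<rangle> = \<langle>fext (\<lambda>(p, q). gen (p, q, y, w, 1, 1, l)) (\<delta> x)\<rangle>"
proof -
  have "descends (RH \<boxtimes> RH) R7 (\<lambda>(r, s). gen (p, q, y, w, r, s, l))" for p q
    unfolding descends_tensor_iff case_prod_conv by (intro allI conjI descends_gen_intros)
  from \<delta>_one[OF this] show ?thesis
    by (simp add: D_def) (intro tcoset_fext_cong, simp add: case_prod_unfold)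
qed

lemma D_one_left: "\<langle>D (1, y, w, k, l)\<rangle> = \<langle>fext (\<lambda>(r, s). gen (1, 1, y, w, r, s, l)) (\<delta> k)\<rangle>"
proof -
  have "descends (RH \<boxtimes> RH) R7 (\<lambda>(p, q). fext (\<lambda>(r, s). gen (p, q, y, w, r, s, l)) (\<delta> k))"
    unfolding descends_tensor_iff case_prod_unfold fst_conv snd_conv
    by (intro allI conjI descends_fext_param descends_gen_intros)
  from \<delta>_one[OF this] show ?thesis by (simp add: D_def)
qed

lemma D'_one_right: "\<langle>D' (x, y, w, k, 1)\<rangle> = \<langle>fext (\<lambda>(p, q). gen (x, p, q, w, k, 1, 1)) (\<delta> y)\<rangle>"
proof -
  have "descends (RH \<boxtimes> RH) R7 (\<lambda>(r, s). gen (x, p, q, w, k, r, s))" for p q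
    unfolding descends_tensor_iff case_prod_conv by (intro allI conjI descends_gen_intros)
  from \<delta>_one[OF this] show ?thesis
    by (simp add: D'_def) (intro tcoset_fext_cong, simp add: case_prod_unfold)
qed

lemma D'_one_left: "\<langle>D' (x, 1, w, k, l)\<rangle> = \<langle>fext (\<lambda>(r, s). gen (x, 1, 1, w, k, r, s)) (\<delta> l)\<rangle>"
proof -
  have "descends (RH \<boxtimes> RH) R7 (\<lambda>(p, q). fext (\<lambda>(r, s). gen (x, p, q, w, k, r, s)) (\<delta> l))"
    unfolding descends_tensor_iff case_prod_unfold fst_conv snd_conv
    by (intro allI conjI descends_fext_param descends_gen_intros)
  from \<delta>_one[OF this] show ?thesis by (simp add: D'_def)
qed

lemma D_one: "\<langle>D (1, y, w, 1, l)\<rangle> = \<langle>gen (1, 1, y, w, 1, 1, l)\<rangle>"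
proof -
  have "descends (RH \<boxtimes> RH) R7 (\<lambda>(r, s). gen (1, 1, y, w, r, s, l))"
    unfolding descends_tensor_iff case_prod_conv by (intro allI conjI descends_gen_intros)
  from \<delta>_one[OF this] show ?thesis by (simp add: D_one_left)
qed

lemma D'_one: "\<langle>D' (x, 1, w, k, 1)\<rangle> = \<langle>gen (x, 1, 1, w, k, 1, 1)\<rangle>"
proof -
  have "descends (RH \<boxtimes> RH) R7 (\<lambda>(r, s). gen (x, 1, 1, w, k, r, s))"
    unfolding descends_tensor_iff case_prod_conv by (intro allI conjI descends_gen_intros)
  from \<delta>_one[OF this] show ?thesis by (simp add: D'_one_left)
qed

text \<open>\<open>D\<close> comultiplies the first and fourth legs, and no factor of
  \<open>Q\<close> is nontrivial in both, so at most one \<Delta> survives per factor. The factor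
  with \<open>la w\<close> is trivial in both; w will be the middle component of an inner
  product.\<close>

lemma D_Q: "\<langle>fext D (Q w u)\<rangle> = \<langle>fext leg1 (fext (split1 \<delta>) \<phi>l') \<star> fext (\<lambda>(x, v). gen (1, 1, x, v, 1, 1, 1)) (la w) \<star>
    fext leg3 (fext (split3 \<delta>) \<phi>m') \<star> fext leg34 (fext (split_snd \<delta>) (ro u)) \<star> fext leg4 (fext (split2 \<delta>) \<phi>r')\<rangle>"
  unfolding Q_def alg_hom_mult5[OF hom_D mult_rel_7]
proof (rule tcoset_fmul5[OF mult_rel_7], goal_cases)
  case 1
  show ?case
    unfolding fext_fext leg7_defs leg_defs case_prod_unfold fext_gen fst_conv snd_conv
    by (rule tcoset_fext_cong) (simp only: D_one_right case_prod_unfold fst_conv snd_conv)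
next
  case 2
  show ?case
    unfolding fext_fext leg7_defs leg_defs case_prod_unfold fext_gen fst_conv snd_conv
    by (rule tcoset_fext_cong) (simp only: D_one case_prod_unfold fst_conv snd_conv)
next
  case 3
  show ?case
    unfolding fext_fext leg7_defs leg_defs case_prod_unfold fext_gen fst_conv snd_conv
    by (rule tcoset_fext_cong) (simp only: D_one_left case_prod_unfold fst_conv snd_conv)
next
  case 4
  show ?case
    unfolding fext_fext leg7_defs leg_defs case_prod_unfold fext_gen fst_conv snd_conv
    by (rule tcoset_fext_cong) (simp only: D_one_left case_prod_unfold fst_conv snd_conv)
next
  case 5
  show ?case
    unfolding fext_fext leg7_defs leg_defs case_prod_unfold fext_gen fst_conv snd_conv
    by (rule tcoset_fext_cong) (simp only: D_one_left case_prod_unfold fst_conv snd_conv)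
qed

text \<open>As for \<open>D_Q\<close>: the second and fifth legs are never both nontrivial in one
  factor, and the factor with \<open>ro w\<close> is trivial in both.\<close>

lemma D'_Q: "\<langle>fext D' (Q u w)\<rangle> = \<langle>fext leg1 (fext (split2 \<delta>) \<phi>l') \<star> fext leg12 (fext (split_fst \<delta>) (la u)) \<star>
    fext leg2 (fext (split1 \<delta>) \<phi>m') \<star> fext (\<lambda>(v, y). gen (1, 1, 1, v, y, 1, 1)) (ro w) \<star> fext leg4 (fext (split3 \<delta>) \<phi>r')\<rangle>"
  unfolding Q_def alg_hom_mult5[OF hom_D' mult_rel_7]
proof (rule tcoset_fmul5[OF mult_rel_7], goal_cases)
  case 1
  show ?case
    unfolding fext_fext leg7_defs leg_defs case_prod_unfold fext_gen fst_conv snd_conv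
    by (rule tcoset_fext_cong) (simp only: D'_one_right case_prod_unfold fst_conv snd_conv)
next
  case 2
  show ?case
    unfolding fext_fext leg7_defs leg_defs case_prod_unfold fext_gen fst_conv snd_conv
    by (rule tcoset_fext_cong) (simp only: D'_one_right case_prod_unfold fst_conv snd_conv)
next
  case 3
  show ?case
    unfolding fext_fext leg7_defs leg_defs case_prod_unfold fext_gen fst_conv snd_conv
    by (rule tcoset_fext_cong) (simp only: D'_one_right case_prod_unfold fst_conv snd_conv)
next
  case 4
  show ?case
    unfolding fext_fext leg7_defs leg_defs case_prod_unfold fext_gen fst_conv snd_conv
    by (rule tcoset_fext_cong) (simp only: D'_one case_prod_unfold fst_conv snd_conv)
next
  case 5
  show ?case
    unfolding fext_fext leg7_defs leg_defs case_prod_unfold fext_gen fst_conv snd_conv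
    by (rule tcoset_fext_cong) (simp only: D'_one_left case_prod_unfold fst_conv snd_conv)
qed

text \<open>Every factor of \<open>Q\<close> has an entry of its own in the middle leg, so no
  coaction of 1 arises and the factors match literally.\<close>

lemma Lam_Q: "\<langle>fext Lam (Q u u')\<rangle> = \<langle>fext leg1 (fext (split3 la) \<phi>l') \<star> fext leg12 (fext (split_snd la) (la u)) \<star>
    fext leg2 (fext (split2 la) \<phi>m') \<star> fext leg23 (fext (split_fst la) (ro u')) \<star> fext leg3 (fext (split1 la) \<phi>r')\<rangle>"
  unfolding Q_def alg_hom_mult5[OF hom_Lam mult_rel_7]
  by (simp add: fext_fext leg7_defs leg_defs Lam_def case_prod_unfold)

lemma Rho_Q: "\<langle>fext Rho (Q u u')\<rangle> = \<langle>fext leg2 (fext (split3 ro) \<phi>l') \<star> fext leg23 (fext (split_snd ro) (la u)) \<star>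
    fext leg3 (fext (split2 ro) \<phi>m') \<star> fext leg34 (fext (split_fst ro) (ro u')) \<star> fext leg4 (fext (split1 ro) \<phi>r')\<rangle>"
  unfolding Q_def alg_hom_mult5[OF hom_Rho mult_rel_7]
  by (simp add: fext_fext leg7_defs leg_defs Rho_def case_prod_unfold)

section \<open>The two iterated products\<close>

lemma vector_space_A: "vector_space sA" and vector_space_B: "vector_space sB"
  by unfold_locales

lemma mA_lext: "mA (lext sA f v) a = lext sA (\<lambda>x. mA (f x) a) v" "mA a (lext sA f v) = lext sA (\<lambda>x. mA a (f x)) v"
  and mB_lext: "mB (lext sB g w) b = lext sB (\<lambda>x. mB (g x) b) w" "mB b (lext sB g w) = lext sB (\<lambda>x. mB b (g x)) w"
  using A.mult_bilinear B.mult_bilinear linear_lext_apply[of sA sA "\<lambda>x. mA x a" f v] linear_lext_apply[of sA sA "mA a" f v]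
    linear_lext_apply[of sB sB "\<lambda>x. mB x b" g w] linear_lext_apply[of sB sB "mB b" g w]
  by (simp_all add: bilinear_map_def)

text \<open>Acting on the inner product gives \<Delta> of the acting coefficient, and rebracketing
  then gives \<Phi> in A and its inverse in B. Later actions multiply coefficients on the left in A
  and on the right in B; this is why \<open>h1\<close>, \<open>h2\<close> stand to the right of
  \<open>D t\<close> and \<open>k1\<close>, \<open>k2\<close> to its left.\<close>

lemma ev3_left:
  "tcoset RAUB (ev2 (mA (actA h1 a) (actA h2 a')) a'' (mB (actB b k1) (actB b' k2)) b'' t) =
   tcoset RAUB (fext (ev3 a a' a'' b b' b'')
    (fext leg1 (fext pad_right \<phi>) \<star> gen (1, 1, 1, 1, k1, k2, 1) \<star> D t \<star> gen (h1, h2, 1, 1, 1, 1, 1) \<star>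
      fext leg4 (fext pad_left \<phi>')))"
proof -
  obtain g1 g2 w l1 l2 where t: "t = (g1, g2, w, l1, l2)" by (cases t) auto
  define fA where "fA = (\<lambda>(p, q) (x, y, z). mA (actA (x * p * h1) a) (mA (actA (y * q * h2) a') (actA (z * g2) a'')))"
  define fB where "fB = (\<lambda>(r, s) (x, y, z). mB (actB b (k1 * r * x)) (mB (actB b' (k2 * s * y)) (actB b'' (l2 * z))))"
  have A: "mA (actA g1 (mA (actA h1 a) (actA h2 a'))) (actA g2 a'') = lext sA (\<lambda>p. lext sA (fA p) \<phi>) (\<delta> g1)"
    by (simp add: A.act_mA sweedler_val_eq mA_lext A.mult_quasi_assoc fA_def case_prod_unfold A.act_mult)
  have B: "mB (actB (mB (actB b k1) (actB b' k2)) l1) (actB b'' l2) = lext sB (\<lambda>p. lext sB (fB p) \<phi>') (\<delta> l1)"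
    by (simp add: B.act_mB sweedler_val_eq mB_lext B.mult_quasi_assoc fB_def case_prod_unfold B.act_mult)
  have desc: "descends RA RAUB (\<lambda>a. gen (a, w, b))" "descends RB RAUB (\<lambda>b. gen (a, w, b))" for a b
    by (intro descends_gen_intros)+
  have "tcoset RAUB (gen (lext sA (\<lambda>p. lext sA (fA p) \<phi>) (\<delta> g1), w, lext sB (\<lambda>p. lext sB (fB p) \<phi>') (\<delta> l1))) =
    tcoset RAUB (fext (\<lambda>p. fext (\<lambda>z. gen (fA p z, w, lext sB (\<lambda>p. lext sB (fB p) \<phi>') (\<delta> l1))) \<phi>) (\<delta> g1))"
    by (rule tcoset_lext2[OF vector_space_A desc(1)])
  also have "\<dots> = tcoset RAUB (fext (\<lambda>p. fext (\<lambda>z. fext (\<lambda>q. fext (\<lambda>z'. gen (fA p z, w, fB q z')) \<phi>') (\<delta> l1)) \<phi>) (\<delta> g1))"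
    by (intro tcoset_fext_cong tcoset_lext2[OF vector_space_B desc(2)])
  \<comment> \<open>The sum over \<Phi> is moved outermost, because \<Phi> is the leftmost factor of
    the product to be matched.\<close>
  also have "fext (\<lambda>p. fext (\<lambda>z. fext (\<lambda>q. fext (\<lambda>z'. gen (fA p z, w, fB q z')) \<phi>') (\<delta> l1)) \<phi>) (\<delta> g1) =
    fext (\<lambda>z. fext (\<lambda>p. fext (\<lambda>q. fext (\<lambda>z'. gen (fA p z, w, fB q z')) \<phi>') (\<delta> l1)) (\<delta> g1)) \<phi>"
    by (rule fext_swap)
  also have "\<dots> = fext (ev3 a a' a'' b b' b'')
    (fext leg1 (fext pad_right \<phi>) \<star> gen (1, 1, 1, 1, k1, k2, 1) \<star> D t \<star> gen (h1, h2, 1, 1, 1, 1, 1) \<star>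
      fext leg4 (fext pad_left \<phi>'))"
    by (simp add: t D_def leg7_defs leg_defs ev3_def fext_fext case_prod_unfold fmul_fext_left fmul_gen_fext
        times_prod_def fA_def fB_def)
  finally show ?thesis by (simp add: ev2_def t A B)
qed

text \<open>Products in A and B are already bracketed to the right here, so the actions produce only
  \<Delta> and no reassociator appears.\<close>

lemma ev3_right:
  "tcoset RAUB (ev2 a (mA (actA h2 a') (actA h3 a'')) b (mB (actB b' k2) (actB b'' k3)) t) =
   tcoset RAUB (fext (ev3 a a' a'' b b' b'')
    (gen (1, 1, 1, 1, 1, k2, k3) \<star> D' t \<star> gen (1, h2, h3, 1, 1, 1, 1)))"
proof -
  obtain g1 g2 w l1 l2 where t: "t = (g1, g2, w, l1, l2)" by (cases t) auto
  define fA where "fA = (\<lambda>(p, q). mA (actA g1 a) (mA (actA (p * h2) a') (actA (q * h3) a'')))"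
  define fB where "fB = (\<lambda>(r, s). mB (actB b l1) (mB (actB b' (k2 * r)) (actB b'' (k3 * s))))"
  have A: "mA (actA g1 a) (actA g2 (mA (actA h2 a') (actA h3 a''))) = lext sA fA (\<delta> g2)"
    by (simp add: A.act_mA sweedler_val_eq mA_lext fA_def case_prod_unfold A.act_mult)
  have B: "mB (actB b l1) (actB (mB (actB b' k2) (actB b'' k3)) l2) = lext sB fB (\<delta> l2)"
    by (simp add: B.act_mB sweedler_val_eq mB_lext fB_def case_prod_unfold B.act_mult)
  have desc: "descends RA RAUB (\<lambda>a. gen (a, w, b))" "descends RB RAUB (\<lambda>b. gen (a, w, b))" for a b
    by (intro descends_gen_intros)+
  have "tcoset RAUB (gen (lext sA fA (\<delta> g2), w, lext sB fB (\<delta> l2))) =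
    tcoset RAUB (fext (\<lambda>p. gen (fA p, w, lext sB fB (\<delta> l2))) (\<delta> g2))"
    by (rule tcoset_lext[OF vector_space_A desc(1)])
  also have "\<dots> = tcoset RAUB (fext (\<lambda>p. fext (\<lambda>q. gen (fA p, w, fB q)) (\<delta> l2)) (\<delta> g2))"
    by (intro tcoset_fext_cong tcoset_lext[OF vector_space_B desc(2)])
  also have "fext (\<lambda>p. fext (\<lambda>q. gen (fA p, w, fB q)) (\<delta> l2)) (\<delta> g2) = fext (ev3 a a' a'' b b' b'')
    (gen (1, 1, 1, 1, 1, k2, k3) \<star> D' t \<star> gen (1, h2, h3, 1, 1, 1, 1))"
    by (simp add: t D'_def ev3_def fext_fext case_prod_unfold fmul_fext_left fmul_gen_fext
        times_prod_def fA_def fB_def)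
  finally show ?thesis by (simp add: ev2_def t A B)
qed

text \<open>For one summand of the inner product, its coefficients \<open>?H\<close> and
  \<open>?K\<close> surround the factors of the outer product. They share nontrivial legs with none
  of those to be passed, so they move inward to \<open>?d2\<close> and form \<open>Lam\<close>
  there. Summation over the inner \<open>Q\<close> then gives
  \<open>fext Lam (Q u u')\<close>.\<close>

lemma F_F_left:
  "tcoset RAUB (fext (\<lambda>x. F x (a'', u'', b'')) (F (a, u, b) (a', u', b'))) =
   tcoset RAUB (fext (ev3 a a' a'' b b' b'')
    (fext leg1 (fext pad_right \<phi>) \<star> fext leg1 (fext (split1 \<delta>) \<phi>l') \<star> fext Lam (Q u u') \<star>
      (fext leg3 (fext (split3 \<delta>) \<phi>m') \<star> fext leg34 (fext (split_snd \<delta>) (ro u'')) \<star> fext leg4 (fext (split2 \<delta>) \<phi>r') \<star>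
      fext leg4 (fext pad_left \<phi>'))))"
    (is "_ = tcoset RAUB (fext ?e (?P \<star> ?d1 \<star> fext Lam (Q u u') \<star> (?d3 \<star> ?d4 \<star> ?d5 \<star> ?P')))")
proof -
  have step: "tcoset RAUB (F (mA (actA h1 a) (actA h2 a'), w, mB (actB b k1) (actB b' k2)) (a'', u'', b'')) =
      tcoset RAUB (fext ?e (?P \<star> ?d1 \<star> Lam (h1, h2, w, k1, k2) \<star> (?d3 \<star> ?d4 \<star> ?d5 \<star> ?P')))"
    for h1 h2 w k1 k2
  proof -
    let ?K = "gen (1, 1, 1, 1, k1, k2, 1)" and ?H = "gen (h1, h2, 1, 1, 1, 1, 1)"
    let ?d2 = "fext (\<lambda>(x, v). gen (1, 1, x, v, 1, 1, 1)) (la w)"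
    have "tcoset RAUB (F (mA (actA h1 a) (actA h2 a'), w, mB (actB b k1) (actB b' k2)) (a'', u'', b'')) =
       tcoset RAUB (fext (\<lambda>t. fext ?e (?P \<star> ?K \<star> D t \<star> ?H \<star> ?P')) (Q w u''))"
      unfolding F_eq by (intro tcoset_fext_cong ev3_left)
    also have "fext (\<lambda>t. fext ?e (?P \<star> ?K \<star> D t \<star> ?H \<star> ?P')) (Q w u'') =
        fext ?e (?P \<star> ?K \<star> fext D (Q w u'') \<star> ?H \<star> ?P')"
      using fext_fmul_middle[of ?e "?P \<star> ?K" D "?H \<star> ?P'" "Q w u''"] by (simp only: fmul_assoc)
    also have "tcoset RAUB \<dots> = tcoset RAUB (fext ?e (?P \<star> ?K \<star> (?d1 \<star> ?d2 \<star> ?d3 \<star> ?d4 \<star> ?d5) \<star> ?H \<star> ?P'))"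
      by (intro tcoset_fext[OF descends_ev3] tcoset_fmul[OF mult_rel_7] refl D_Q)
    also have "?P \<star> ?K \<star> (?d1 \<star> ?d2 \<star> ?d3 \<star> ?d4 \<star> ?d5) \<star> ?H \<star> ?P' =
        ?P \<star> ?d1 \<star> Lam (h1, h2, w, k1, k2) \<star> (?d3 \<star> ?d4 \<star> ?d5 \<star> ?P')"
    proof -
      have K: "?K \<star> ?d1 = ?d1 \<star> ?K"
        by (simp add: leg_defs leg7_defs fext_fext case_prod_unfold fmul_fext_left fmul_gen_fext times_prod_def)
      have H: "?d3 \<star> ?H = ?H \<star> ?d3" "?d4 \<star> ?H = ?H \<star> ?d4" "?d5 \<star> ?H = ?H \<star> ?d5"
        by (simp_all add: leg_defs leg7_defs fext_fext case_prod_unfold fmul_fext_left fmul_gen_fext times_prod_def)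
      have "Lam (h1, h2, w, k1, k2) = ?K \<star> ?d2 \<star> ?H"
        by (simp add: Lam_def case_prod_unfold fmul_fext_left fmul_gen_fext times_prod_def)
      moreover have "?K \<star> (?d1 \<star> ?d2 \<star> ?d3 \<star> ?d4 \<star> ?d5) \<star> ?H = ?d1 \<star> (?K \<star> ?d2 \<star> ?H) \<star> ?d3 \<star> ?d4 \<star> ?d5"
        by (rule fmul_commute_around(1)[OF K H])
      ultimately show ?thesis by (simp only: fmul_assoc)
    qed
    finally show ?thesis .
  qed
  have "tcoset RAUB (fext (\<lambda>x. F x (a'', u'', b'')) (F (a, u, b) (a', u', b'))) =
    tcoset RAUB (fext (\<lambda>t. fext ?e (?P \<star> ?d1 \<star> Lam t \<star> (?d3 \<star> ?d4 \<star> ?d5 \<star> ?P'))) (Q u u'))"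
    unfolding F_eq[of a] fext_fext[of _ "ev2 a a' b b'"]
    by (rule tcoset_fext_cong) (simp only: split_paired_all ev2_def case_prod_conv fext_gen step)
  then show ?thesis by (simp only: fext_fmul_middle)
qed

text \<open>As for \<open>F_F_left\<close>, with \<open>?K\<close> and \<open>?H\<close> meeting at
  \<open>?c4\<close>, where they form \<open>Rho\<close>.\<close>

lemma F_F_right:
  "tcoset RAUB (fext (F (a, u, b)) (F (a', u', b') (a'', u'', b''))) =
   tcoset RAUB (fext (ev3 a a' a'' b b' b'')
    (fext leg1 (fext (split2 \<delta>) \<phi>l') \<star> fext leg12 (fext (split_fst \<delta>) (la u)) \<star> fext leg2 (fext (split1 \<delta>) \<phi>m') \<star>
      fext Rho (Q u' u'') \<star> fext leg4 (fext (split3 \<delta>) \<phi>r')))"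
    (is "_ = tcoset RAUB (fext ?e (?c1 \<star> ?c2 \<star> ?c3 \<star> fext Rho (Q u' u'') \<star> ?c5))")
proof -
  have step: "tcoset RAUB (F (a, u, b) (mA (actA h2 a') (actA h3 a''), w, mB (actB b' k2) (actB b'' k3))) =
      tcoset RAUB (fext ?e (?c1 \<star> ?c2 \<star> ?c3 \<star> Rho (h2, h3, w, k2, k3) \<star> ?c5))"
    for h2 h3 w k2 k3
  proof -
    let ?K = "gen (1, 1, 1, 1, 1, k2, k3)" and ?H = "gen (1, h2, h3, 1, 1, 1, 1)"
    let ?c4 = "fext (\<lambda>(v, y). gen (1, 1, 1, v, y, 1, 1)) (ro w)"
    have "tcoset RAUB (F (a, u, b) (mA (actA h2 a') (actA h3 a''), w, mB (actB b' k2) (actB b'' k3))) =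
       tcoset RAUB (fext (\<lambda>t. fext ?e (?K \<star> D' t \<star> ?H)) (Q u w))"
      unfolding F_eq by (intro tcoset_fext_cong ev3_right)
    also have "fext (\<lambda>t. fext ?e (?K \<star> D' t \<star> ?H)) (Q u w) = fext ?e (?K \<star> fext D' (Q u w) \<star> ?H)"
      by (rule fext_fmul_middle)
    also have "tcoset RAUB \<dots> = tcoset RAUB (fext ?e (?K \<star> (?c1 \<star> ?c2 \<star> ?c3 \<star> ?c4 \<star> ?c5) \<star> ?H))"
      by (intro tcoset_fext[OF descends_ev3] tcoset_fmul[OF mult_rel_7] refl D'_Q)
    also have "?K \<star> (?c1 \<star> ?c2 \<star> ?c3 \<star> ?c4 \<star> ?c5) \<star> ?H = ?c1 \<star> ?c2 \<star> ?c3 \<star> Rho (h2, h3, w, k2, k3) \<star> ?c5"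
    proof -
      have K: "?K \<star> ?c1 = ?c1 \<star> ?K" "?K \<star> ?c2 = ?c2 \<star> ?K" "?K \<star> ?c3 = ?c3 \<star> ?K"
        by (simp_all add: leg_defs leg7_defs fext_fext case_prod_unfold fmul_fext_left fmul_gen_fext times_prod_def)
      have H: "?c5 \<star> ?H = ?H \<star> ?c5"
        by (simp add: leg_defs leg7_defs fext_fext case_prod_unfold fmul_fext_left fmul_gen_fext times_prod_def)
      have "Rho (h2, h3, w, k2, k3) = ?K \<star> ?c4 \<star> ?H"
        by (simp add: Rho_def case_prod_unfold fmul_fext_left fmul_gen_fext times_prod_def)
      moreover have "?K \<star> (?c1 \<star> ?c2 \<star> ?c3 \<star> ?c4 \<star> ?c5) \<star> ?H = ?c1 \<star> ?c2 \<star> ?c3 \<star> (?K \<star> ?c4 \<star> ?H) \<star> ?c5"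
        by (rule fmul_commute_around(2)[OF K H])
      ultimately show ?thesis by (simp only: fmul_assoc)
    qed
    finally show ?thesis .
  qed
  have "tcoset RAUB (fext (F (a, u, b)) (F (a', u', b') (a'', u'', b''))) =
    tcoset RAUB (fext (\<lambda>t. fext ?e (?c1 \<star> ?c2 \<star> ?c3 \<star> Rho t \<star> ?c5)) (Q u' u''))"
    unfolding F_eq[of a'] fext_fext[of _ "ev2 a' a'' b' b''"]
    by (rule tcoset_fext_cong) (simp only: split_paired_all ev2_def case_prod_conv fext_gen step)
  then show ?thesis by (simp only: fext_fmul_middle)
qed

lemma F_assoc: "tcoset RAUB (fext (\<lambda>x. F x r) (F p q)) = tcoset RAUB (fext (F p) (F q r))"
proof -
  obtain a u b where p: "p = (a, u, b)" by (cases p) auto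
  obtain a' u' b' where q: "q = (a', u', b')" by (cases q) auto
  obtain a'' u'' b'' where r: "r = (a'', u'', b'')" by (cases r) auto
  show ?thesis
    unfolding p q r F_F_left F_F_right
    by (rule tcoset_fext[OF descends_ev3])
      (simp only: cl7_fmul Lam_Q Rho_Q cl7_assoc seven_leg_identity)
qed

section \<open>The algebra structure on cosets\<close>

abbreviation "P \<equiv> two_sided_product sA mA eA actA sB mB eB actB sU lam \<Phi>l' \<rho> \<Phi>\<rho>' \<Phi>l\<rho>'"

lemma P_simps:
  "carrier P = tensors RAUB" "\<one>\<^bsub>P\<^esub> = pure RAUB (eA, 1, eB)" "\<zero>\<^bsub>P\<^esub> = tcoset RAUB 0"
  "tcoset RAUB v \<oplus>\<^bsub>P\<^esub> tcoset RAUB w = tcoset RAUB (v + w)"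
  "c \<odot>\<^bsub>P\<^esub> tcoset RAUB v = tcoset RAUB (fscale c v)"
  by (simp_all add: two_sided_product_def Let_def tadd_tcoset tscale_tcoset)

text \<open>The definition multiplies chosen representatives; since \<open>F\<close> respects the
  relations in each argument, any others give the same coset.\<close>

lemma mult_tcoset: "tcoset RAUB v \<otimes>\<^bsub>P\<^esub> tcoset RAUB w = tcoset RAUB (fext (\<lambda>p. fext (F p) w) v)"
proof -
  have "tcoset RAUB v \<otimes>\<^bsub>P\<^esub> tcoset RAUB w =
      tcoset RAUB (fext (\<lambda>p. fext (F p) (rep (tcoset RAUB w))) (rep (tcoset RAUB v)))"
    by (simp add: two_sided_product_def Let_def sweedler_def)
  also have "\<dots> = tcoset RAUB (fext (\<lambda>p. fext (F p) (rep (tcoset RAUB w))) v)"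
    by (rule tcoset_fext[OF descends_fext_param[OF descends_F_left] rep_tcoset])
  also have "\<dots> = tcoset RAUB (fext (\<lambda>p. fext (F p) w) v)"
    by (intro tcoset_fext_cong tcoset_fext[OF descends_F_right] rep_tcoset)
  finally show ?thesis .
qed

lemma mult_tcoset_assoc:
  "(tcoset RAUB u \<otimes>\<^bsub>P\<^esub> tcoset RAUB v) \<otimes>\<^bsub>P\<^esub> tcoset RAUB w = tcoset RAUB u \<otimes>\<^bsub>P\<^esub> (tcoset RAUB v \<otimes>\<^bsub>P\<^esub> tcoset RAUB w)"
proof -
  have "tcoset RAUB (fext (\<lambda>x. fext (F x) w) (F p q)) = tcoset RAUB (fext (F p) (fext (F q) w))" for p q
    \<comment> \<open>Exchanging the sums brings w outermost on both sides, which leaves a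
      comparison on generators.\<close>
    unfolding fext_swap[of F w] fext_fext by (intro tcoset_fext_cong F_assoc)
  then show ?thesis
    unfolding mult_tcoset fext_fext
    by (intro tcoset_fext_cong) (simp add: fext_fext)
qed

lemma assoc_unital_algebra_P: "assoc_unital_algebra field_record P"
proof -
  have abelian: "abelian_group P"
  proof (rule abelian_groupI)
    fix x assume "x \<in> carrier P"
    then obtain v where v: "x = tcoset RAUB v" unfolding P_simps by (rule tensors_cases)
    then have "tcoset RAUB (- v) \<oplus>\<^bsub>P\<^esub> x = \<zero>\<^bsub>P\<^esub>" by (simp add: P_simps)
    then show "\<exists>y\<in>carrier P. y \<oplus>\<^bsub>P\<^esub> x = \<zero>\<^bsub>P\<^esub>" by (auto simp: P_simps)
  qed (auto simp: P_simps algebra_simps elim!: tensors_cases)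
  have "module field_record P"
    by (rule moduleI[OF cring_field_record abelian])
      (auto simp: P_simps field_record_def free.scale_left_distrib free.scale_right_distrib elim!: tensors_cases)
  moreover have "ring P"
  proof (rule ringI[OF abelian])
    show "Group.monoid P"
    proof (rule Group.monoidI)
      show "x \<otimes>\<^bsub>P\<^esub> y \<in> carrier P" if "x \<in> carrier P" "y \<in> carrier P" for x y
        using that by (auto simp: P_simps mult_tcoset elim!: tensors_cases)
      show "\<one>\<^bsub>P\<^esub> \<in> carrier P" by (simp add: P_simps pure_def)
      show "x \<otimes>\<^bsub>P\<^esub> y \<otimes>\<^bsub>P\<^esub> z = x \<otimes>\<^bsub>P\<^esub> (y \<otimes>\<^bsub>P\<^esub> z)"
        if "x \<in> carrier P" "y \<in> carrier P" "z \<in> carrier P" for x y z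
        using that by (auto simp: P_simps mult_tcoset_assoc elim!: tensors_cases)
      show "\<one>\<^bsub>P\<^esub> \<otimes>\<^bsub>P\<^esub> x = x" if "x \<in> carrier P" for x
      proof -
        from that obtain v where v: "x = tcoset RAUB v" unfolding P_simps by (rule tensors_cases)
        have "tcoset RAUB (fext (F (eA, 1, eB)) v) = tcoset RAUB (fext gen v)"
          by (intro tcoset_fext_cong F_unit_left)
        then show ?thesis by (simp add: v P_simps pure_def mult_tcoset)
      qed
      show "x \<otimes>\<^bsub>P\<^esub> \<one>\<^bsub>P\<^esub> = x" if "x \<in> carrier P" for x
      proof -
        from that obtain v where v: "x = tcoset RAUB v" unfolding P_simps by (rule tensors_cases)
        have "tcoset RAUB (fext (\<lambda>p. F p (eA, 1, eB)) v) = tcoset RAUB (fext gen v)"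
          by (intro tcoset_fext_cong F_unit_right)
        then show ?thesis by (simp add: v P_simps pure_def mult_tcoset)
      qed
    qed
  qed (auto simp: P_simps mult_tcoset fext_add fext_add_fun elim!: tensors_cases)
  ultimately show ?thesis
    by (rule assoc_unital_algebra.intro)
      (unfold_locales, auto simp: P_simps mult_tcoset fext_fscale fext_fscale_fun elim!: tensors_cases)
qed

end

theorem proposition5p1:
  fixes sH :: "'k::field \<Rightarrow> 'h::{ring,monoid_mult} \<Rightarrow> 'h"
    and \<Delta> :: "'h \<Rightarrow> ('h \<times> 'h \<Rightarrow>\<^sub>0 'k) set"
    and \<epsilon> :: "'h \<Rightarrow> 'k"
    and \<Phi> \<Phi>' :: "('h \<times> 'h \<times> 'h \<Rightarrow>\<^sub>0 'k) set"
    and sA :: "'k \<Rightarrow> 'a::ab_group_add \<Rightarrow> 'a"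
    and mA :: "'a \<Rightarrow> 'a \<Rightarrow> 'a" and eA :: 'a and actA :: "'h \<Rightarrow> 'a \<Rightarrow> 'a"
    and sB :: "'k \<Rightarrow> 'b::ab_group_add \<Rightarrow> 'b"
    and mB :: "'b \<Rightarrow> 'b \<Rightarrow> 'b" and eB :: 'b and actB :: "'b \<Rightarrow> 'h \<Rightarrow> 'b"
    and sU :: "'k \<Rightarrow> 'u::{ring,monoid_mult} \<Rightarrow> 'u"
    and lam :: "'u \<Rightarrow> ('h \<times> 'u \<Rightarrow>\<^sub>0 'k) set"
    and \<Phi>l \<Phi>l' :: "('h \<times> 'h \<times> 'u \<Rightarrow>\<^sub>0 'k) set"
    and \<rho> :: "'u \<Rightarrow> ('u \<times> 'h \<Rightarrow>\<^sub>0 'k) set"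
    and \<Phi>\<rho> \<Phi>\<rho>' :: "('u \<times> 'h \<times> 'h \<Rightarrow>\<^sub>0 'k) set"
    and \<Phi>l\<rho> \<Phi>l\<rho>' :: "('h \<times> 'u \<times> 'h \<Rightarrow>\<^sub>0 'k) set"
  assumes "quasi_bialgebra sH \<Delta> \<epsilon> \<Phi> \<Phi>'"
    and "left_module_algebra sH \<Delta> \<epsilon> \<Phi> \<Phi>' sA mA eA actA"
    and "right_module_algebra sH \<Delta> \<epsilon> \<Phi> \<Phi>' sB mB eB actB"
    and "bicomodule_algebra sH \<Delta> \<epsilon> \<Phi> \<Phi>' sU lam \<Phi>l \<Phi>l' \<rho> \<Phi>\<rho> \<Phi>\<rho>' \<Phi>l\<rho> \<Phi>l\<rho>'"
  defines "R \<equiv> vrel sA \<boxtimes> vrel sU \<boxtimes> vrel sB"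
    and "P \<equiv> two_sided_product sA mA eA actA sB mB eB actB sU lam \<Phi>l' \<rho> \<Phi>\<rho>' \<Phi>l\<rho>'"
  shows "(\<forall>a u b a' u' b'. pure R (a, u, b) \<otimes>\<^bsub>P\<^esub> pure R (a', u', b') =
            tcoset R (two_sided_formula mA actA mB actB lam \<Phi>l' \<rho> \<Phi>\<rho>' \<Phi>l\<rho>' (a, u, b) (a', u', b')))
       \<and> assoc_unital_algebra field_record P
       \<and> \<one>\<^bsub>P\<^esub> = pure R (eA, 1, eB)"
proof -
  interpret two_sided sH \<Delta> \<epsilon> \<Phi> \<Phi>' sU lam \<Phi>l \<Phi>l' \<rho> \<Phi>\<rho> \<Phi>\<rho>' \<Phi>l\<rho> \<Phi>l\<rho>' sA mA eA actA sB mB eB actB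
    by (intro two_sided.intro assms)
  show ?thesis
    unfolding R_def P_def
    by (simp add: assoc_unital_algebra_P P_simps mult_tcoset pure_def)
qed

end
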